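(* Let $M\subset\mathbb R^4$ be an embedded para-CR manifold and let $V$ be a local infinitesimal para-CR automorphism of $M$, defined on an open subset $U\subset M$. Then $V$ extends to a para-holomorphic vector field $\tilde V$ in some neighbourhood of $U$ in $\mathbb R^4$. Conversely, if $\tilde V$ is a para-holomorphic vector field on an open subset $D$ of $\mathbb R^4$ such that $\tilde V|_{M\cap D}$ is tangent to $M$, then $\tilde V|_{M\cap D}$ is a local infinitesimal para-CR automorphism of $M$.
   Context: All functions, maps and vector fields are smooth. Let $\mathbb R^4=\mathbb R^2_{xy}\times\mathbb R^2_{ab}$ with coordinates $(x,y)$ and $(a,b)$ on the two factors. An embedded para-CR manifold is a hypersurface $M\subset\mathbb R^4$ given (locally, near the origin) by an equation $y=a+\phi(a,b,x)$ with $\frac{\partial\phi}{\partial a}(0)=0$; the neighbourhood is taken small enough that $1+\frac{\partial \phi}{\partial a}$ does not vanish. It carries the two direction fields $TM\cap T\mathbb R^2_{xy}$ and $TM\cap T\mathbb R^2_{ab}$, spanned in the coordinates $(x,a,b)$ on $M$ by $X=\partial_x$ and $Y=(1+\frac{\partial\phi}{\partial a})\partial_b-\frac{\partial\phi}{\partial b}\partial_a$ respectively. A local para-CR automorphism of $M$ is a diffeomorphism $F$ from an open subset $U_1\subset M$ onto an open subset $U_2\subset M$ with $F_*X=\lambda X$ and $F_*Y=\mu Y$ for some non-vanishing functions $\lambda,\mu$. A vector field $V$ on an open subset of $M$ is a local infinitesimal para-CR automorphism if its (local) flow consists of local para-CR automorphisms. A para-holomorphic vector field on an open subset of $\mathbb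 R^4$ is a vector field of the form $\alpha\,\partial_a+\beta\,\partial_b+\xi\,\partial_x+\eta\,\partial_y$ where $\alpha,\beta$ have vanishing partial derivatives with respect to $x,y$ and $\xi,\eta$ have vanishing partial derivatives with respect to $a,b$. *)

theory Defs
  imports "HOL-Analysis.Analysis"
begin

subsection \<open>Smooth functions on open sets\<close>

primrec k_differentiable_on ::
  "nat \<Rightarrow> 'a::real_normed_vector set \<Rightarrow> ('a \<Rightarrow> 'b::real_normed_vector) \<Rightarrow> bool" where
  "k_differentiable_on 0 S f \<longleftrightarrow> continuous_on S f"
| "k_differentiable_on (Suc k) S f \<longleftrightarrow>
     (\<forall>x\<in>S. f differentiable (at x)) \<and>
     (\<forall>v. k_differentiable_on k S (\<lambda>x. frechet_derivative f (at x) v))"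

text \<open>Only meaningful for open sets; the set is open wherever this is used below.\<close>

definition smooth_on :: "'a::real_normed_vector set \<Rightarrow> ('a \<Rightarrow> 'b::real_normed_vector) \<Rightarrow> bool" where
  "smooth_on S f \<longleftrightarrow> (\<forall>k. k_differentiable_on k S f)"

subsection \<open>Embedded para-CR manifolds\<close>

text \<open>A point of the ambient space is written \<open>((x, y), (a, b))\<close>; a point of the coordinate
  domain of \<open>\<phi>\<close> is written \<open>(a, b, x)\<close>.\<close>

type_synonym R3 = "real \<times> real \<times> real"
type_synonym R4 = "(real \<times> real) \<times> (real \<times> real)"

definition d_a :: "(R3 \<Rightarrow> real) \<Rightarrow> R3 \<Rightarrow> real" where
  "d_a \<phi> q = frechet_derivative \<phi> (at q) (1, 0, 0)"

definition d_b :: "(R3 \<Rightarrow> real) \<Rightarrow> R3 \<Rightarrow> real" where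
  "d_b \<phi> q = frechet_derivative \<phi> (at q) (0, 1, 0)"

text \<open>\<open>N\<close> is the neighbourhood of the origin in the \<open>(a, b, x)\<close>-space over which the hypersurface is
  considered.\<close>

definition embedded_para_CR :: "R3 set \<Rightarrow> (R3 \<Rightarrow> real) \<Rightarrow> bool" where
  "embedded_para_CR N \<phi> \<longleftrightarrow>
     open N \<and> 0 \<in> N \<and> smooth_on N \<phi> \<and> d_a \<phi> 0 = 0 \<and> (\<forall>q\<in>N. 1 + d_a \<phi> q \<noteq> 0)"

definition para_CR_manifold :: "R3 set \<Rightarrow> (R3 \<Rightarrow> real) \<Rightarrow> R4 set" where
  "para_CR_manifold N \<phi> = {((x, y), (a, b)) | x y a b. (a, b, x) \<in> N \<and> y = a + \<phi> (a, b, x)}"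

text \<open>The global coordinates \<open>(a, b, x)\<close> on the hypersurface (the restriction of a linear map of the
  ambient space), and the inverse parametrisation.\<close>

definition coords :: "R4 \<Rightarrow> R3" where
  "coords = (\<lambda>((x, y), (a, b)). (a, b, x))"

definition param :: "(R3 \<Rightarrow> real) \<Rightarrow> R3 \<Rightarrow> R4" where
  "param \<phi> = (\<lambda>(a, b, x). ((x, a + \<phi> (a, b, x)), (a, b)))"

text \<open>Calculus on the hypersurface. The set \<open>U\<close> is a relatively open subset of it, so that
  \<open>coords ` U\<close> is open. As \<open>coords\<close> is linear, \<open>coords v\<close> is the coordinate vector of a tangent
  vector \<open>v\<close>; hence \<open>differential \<phi> F p v\<close> is the differential of \<open>F\<close> at \<open>p\<close> applied to \<open>v\<close>.\<close>

definition M_smooth_on ::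
  "(R3 \<Rightarrow> real) \<Rightarrow> R4 set \<Rightarrow> (R4 \<Rightarrow> 'b::real_normed_vector) \<Rightarrow> bool" where
  "M_smooth_on \<phi> U f \<longleftrightarrow> smooth_on (coords ` U) (f \<circ> param \<phi>)"

definition tangent_space :: "(R3 \<Rightarrow> real) \<Rightarrow> R4 \<Rightarrow> R4 set" where
  "tangent_space \<phi> p = range (frechet_derivative (param \<phi>) (at (coords p)))"

definition differential ::
  "(R3 \<Rightarrow> real) \<Rightarrow> (R4 \<Rightarrow> 'b::real_normed_vector) \<Rightarrow> R4 \<Rightarrow> R4 \<Rightarrow> 'b" where
  "differential \<phi> F p v = frechet_derivative (F \<circ> param \<phi>) (at (coords p)) (coords v)"

text \<open>The fields \<open>X\<close> and \<open>Y\<close>, as tangent vectors in the ambient space: the images under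
  the parametrisation of \<open>\<partial>\<^sub>x\<close> and of \<open>(1 + \<phi>\<^sub>a) \<partial>\<^sub>b - \<phi>\<^sub>b \<partial>\<^sub>a\<close>.\<close>

definition X_field :: "(R3 \<Rightarrow> real) \<Rightarrow> R4 \<Rightarrow> R4" where
  "X_field \<phi> p = frechet_derivative (param \<phi>) (at (coords p)) (0, 0, 1)"

definition Y_field :: "(R3 \<Rightarrow> real) \<Rightarrow> R4 \<Rightarrow> R4" where
  "Y_field \<phi> p = frechet_derivative (param \<phi>) (at (coords p))
                   (- d_b \<phi> (coords p), 1 + d_a \<phi> (coords p), 0)"

subsection \<open>Local para-CR automorphisms\<close>

definition local_para_CR_automorphism ::
  "R3 set \<Rightarrow> (R3 \<Rightarrow> real) \<Rightarrow> R4 set \<Rightarrow> R4 set \<Rightarrow> (R4 \<Rightarrow> R4) \<Rightarrow> bool" where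
  "local_para_CR_automorphism N \<phi> U1 U2 F \<longleftrightarrow>
     openin (top_of_set (para_CR_manifold N \<phi>)) U1 \<and>
     openin (top_of_set (para_CR_manifold N \<phi>)) U2 \<and>
     bij_betw F U1 U2 \<and> M_smooth_on \<phi> U1 F \<and> M_smooth_on \<phi> U2 (inv_into U1 F) \<and>
     (\<exists>l m :: R4 \<Rightarrow> real.
        M_smooth_on \<phi> U2 l \<and> M_smooth_on \<phi> U2 m \<and> (\<forall>q\<in>U2. l q \<noteq> 0 \<and> m q \<noteq> 0) \<and>
        (\<forall>p\<in>U1. differential \<phi> F p (X_field \<phi> p) = l (F p) *\<^sub>R X_field \<phi> (F p) \<and>
                differential \<phi> F p (Y_field \<phi> p) = m (F p) *\<^sub>R Y_field \<phi> (F p)))"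

subsection \<open>Local flows and infinitesimal automorphisms\<close>

definition M_vector_field :: "R3 set \<Rightarrow> (R3 \<Rightarrow> real) \<Rightarrow> R4 set \<Rightarrow> (R4 \<Rightarrow> R4) \<Rightarrow> bool" where
  "M_vector_field N \<phi> U V \<longleftrightarrow>
     openin (top_of_set (para_CR_manifold N \<phi>)) U \<and>
     (\<forall>p\<in>U. V p \<in> tangent_space \<phi> p) \<and> M_smooth_on \<phi> U V"

definition integral_curve :: "R4 set \<Rightarrow> (R4 \<Rightarrow> R4) \<Rightarrow> real set \<Rightarrow> (real \<Rightarrow> R4) \<Rightarrow> bool" where
  "integral_curve U V I \<gamma> \<longleftrightarrow>
     (\<forall>t\<in>I. \<gamma> t \<in> U \<and> (\<gamma> has_vector_derivative V (\<gamma> t)) (at t within I))"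

text \<open>The maximal local flow: the time-\<open>t\<close> map is defined at the points whose integral
  curve in \<open>U\<close> exists up to time \<open>t\<close>, which may be negative.\<close>

definition flow_domain :: "R4 set \<Rightarrow> (R4 \<Rightarrow> R4) \<Rightarrow> real \<Rightarrow> R4 set" where
  "flow_domain U V t = {p. \<exists>\<gamma>. \<gamma> 0 = p \<and> integral_curve U V (closed_segment 0 t) \<gamma>}"

definition flow :: "R4 set \<Rightarrow> (R4 \<Rightarrow> R4) \<Rightarrow> real \<Rightarrow> R4 \<Rightarrow> R4" where
  "flow U V t p =
     (THE q. \<exists>\<gamma>. \<gamma> 0 = p \<and> \<gamma> t = q \<and> integral_curve U V (closed_segment 0 t) \<gamma>)"

definition infinitesimal_para_CR_automorphism ::
  "R3 set \<Rightarrow> (R3 \<Rightarrow> real) \<Rightarrow> R4 set \<Rightarrow> (R4 \<Rightarrow> R4) \<Rightarrow> bool" where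
  "infinitesimal_para_CR_automorphism N \<phi> U V \<longleftrightarrow>
     M_vector_field N \<phi> U V \<and>
     (\<forall>t. local_para_CR_automorphism N \<phi>
            (flow_domain U V t) (flow U V t ` flow_domain U V t) (flow U V t))"

subsection \<open>Para-holomorphic vector fields\<close>

text \<open>The vector field \<open>\<alpha> \<partial>\<^sub>a + \<beta> \<partial>\<^sub>b + \<xi> \<partial>\<^sub>x + \<eta> \<partial>\<^sub>y\<close> is the map with value
  \<open>((\<xi>, \<eta>), (\<alpha>, \<beta>))\<close>, so that \<open>fst \<circ> W\<close> is \<open>(\<xi>, \<eta>)\<close> and \<open>snd \<circ> W\<close> is \<open>(\<alpha>, \<beta>)\<close>.\<close>

definition para_holomorphic_on :: "R4 set \<Rightarrow> (R4 \<Rightarrow> R4) \<Rightarrow> bool" where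
  "para_holomorphic_on D W \<longleftrightarrow>
     open D \<and> smooth_on D W \<and>
     (\<forall>p\<in>D.
        frechet_derivative (snd \<circ> W) (at p) ((1, 0), (0, 0)) = 0 \<and>
        frechet_derivative (snd \<circ> W) (at p) ((0, 1), (0, 0)) = 0 \<and>
        frechet_derivative (fst \<circ> W) (at p) ((0, 0), (1, 0)) = 0 \<and>
        frechet_derivative (fst \<circ> W) (at p) ((0, 0), (0, 1)) = 0)"

end

theory Submission
  imports Defs
begin

text \<open>The tangent vectors proportional to \<open>X\<close> (to \<open>Y\<close>) are those with vanishing \<open>(a, b)\<close>-component
  (\<open>(x, y)\<close>-component), so the leaves of \<open>X\<close> and \<open>Y\<close> are the fibres of the projections of \<open>M\<close> to the two
  planes.

  If the flow \<open>F\<^sub>t\<close> of \<open>V\<close> preserves both line fields, the \<open>(a, b)\<close>-component of \<open>F\<^sub>t\<close> is constant along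
  curves in the leaves of \<open>X\<close>; differentiating at \<open>t = 0\<close>, so is that of \<open>V\<close>, and it extends to the ambient
  space independently of \<open>y\<close>. In the same way the \<open>(x, y)\<close>-component of \<open>V\<close> is constant along the leaves of
  \<open>Y\<close>, and extends by moving a point in the direction of \<open>\<partial>\<^sub>a\<close> to \<open>M\<close>.

  Conversely, if the \<open>(a, b)\<close>-component of the field depends locally on \<open>(a, b)\<close> only, two integral curves
  starting on a common leaf of \<open>X\<close> have \<open>(a, b)\<close>-components that solve the same differential equation
  in the plane, so they stay on common leaves. That the flow is smooth is proved by regarding its derivative
  as the solution of the variational equation.\<close>

subsection \<open>Calculus of smooth functions\<close>

text \<open>The condition on \<open>V\<close> is stated through its flow, and
  \<open>smooth_on\<close> through iterated Frechet derivatives, so existence, uniqueness and smooth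
  dependence of flows are built up first. Estimates are made over times with
  \<open>L * T \<le> 1 / 2\<close>; there a fixed point argument and the mean value inequality are
  enough, and longer times are reached by composition. Line fields are compared through curves in
  the leaves rather than through Lie brackets: a direction is tangent to a leaf exactly when a
  projection kills it, so preservation reduces to a projected curve being constant. The obstacle in
  the extension is that \<open>U\<close> is arbitrary: a leaf may meet it in several pieces on which
  a component of \<open>V\<close> takes different values. Para-holomorphy asks only for vanishing
  derivatives, so local independence suffices, but the (x,y)-component must still be assigned
  consistently off \<open>M\<close>. This is done by moving in the a-direction, without leaving
  \<open>U'\<close>, until the hypersurface has the required y: there y is strictly monotone in a,
  because 1 + \<phi>_a has no zero, and the target is unique.\<close>

lemma k_differentiable_on_cong:
  assumes "open S" "\<And>x. x \<in> S \<Longrightarrow> f x = g x" "k_differentiable_on k S f"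
  shows "k_differentiable_on k S g"
  using assms(2,3)
proof (induction k arbitrary: f g)
  case 0
  then show ?case by (simp cong: continuous_on_cong)
next
  case (Suc k)
  have der: "(g has_derivative frechet_derivative f (at x)) (at x)" if "x \<in> S" for x
  proof (rule has_derivative_transform_within_open)
    show "(f has_derivative frechet_derivative f (at x)) (at x)"
      using Suc.prems(2) that by (simp add: frechet_derivative_works)
  qed (use that Suc.prems \<open>open S\<close> in auto)
  then have eq: "frechet_derivative f (at x) = frechet_derivative g (at x)" if "x \<in> S" for x
    using that frechet_derivative_at by blast
  show ?case
    unfolding k_differentiable_on.simps
  proof (intro conjI ballI allI)
    fix x assume "x \<in> S" then show "g differentiable at x"
      using der differentiable_def by blast
  next
    fix v
    show "k_differentiable_on k S (\<lambda>x. frechet_derivative g (at x) v)"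
      by (rule Suc.IH[of "\<lambda>x. frechet_derivative f (at x) v"]) (use eq Suc.prems in auto)
  qed
qed

text \<open>Admits any explicit formula for the derivative, so that each closure property below is
  an induction on its own sum, product or chain rule.\<close>

lemma k_differentiable_on_SucI:
  assumes "open S" "\<And>x. x \<in> S \<Longrightarrow> (f has_derivative f' x) (at x)"
    and "\<And>v. k_differentiable_on k S (\<lambda>x. f' x v)"
  shows "k_differentiable_on (Suc k) S f"
proof -
  have eq: "f' x = frechet_derivative f (at x)" if "x \<in> S" for x
    using that assms(2) frechet_derivative_at by blast
  show ?thesis
    unfolding k_differentiable_on.simps
  proof (intro conjI ballI allI)
    fix x assume "x \<in> S" then show "f differentiable at x"
      using assms(2) differentiable_def by blast
  next
    fix v
    show "k_differentiable_on k S (\<lambda>x. frechet_derivative f (at x) v)"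
      by (rule k_differentiable_on_cong[OF \<open>open S\<close> _ assms(3)[of v]]) (simp add: eq)
  qed
qed

lemma k_differentiable_on_SucD:
  assumes "k_differentiable_on (Suc k) S f"
  shows "x \<in> S \<Longrightarrow> (f has_derivative frechet_derivative f (at x)) (at x)"
    and "k_differentiable_on k S (\<lambda>x. frechet_derivative f (at x) v)"
  using assms by (auto simp: frechet_derivative_works)

lemma k_differentiable_on_Suc_imp:
  "k_differentiable_on (Suc k) S f \<Longrightarrow> k_differentiable_on k S f"
proof (induction k arbitrary: f)
  case 0
  then show ?case
    by (auto intro!: continuous_at_imp_continuous_on differentiable_imp_continuous_within)
next
  case (Suc k)
  then show ?case
    by (metis k_differentiable_on.simps(2))
qed

lemma k_differentiable_on_subset:
  "k_differentiable_on k S f \<Longrightarrow> T \<subseteq> S \<Longrightarrow> k_differentiable_on k T f"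
  by (induction k arbitrary: f) (auto intro: continuous_on_subset)

lemma k_differentiable_on_local:
  assumes "\<And>x. x \<in> S \<Longrightarrow> \<exists>T. open T \<and> x \<in> T \<and> k_differentiable_on k T f"
  shows "k_differentiable_on k S f"
  using assms
proof (induction k arbitrary: f)
  case 0
  show ?case
    unfolding k_differentiable_on.simps
  proof (rule continuous_at_imp_continuous_on, rule ballI)
    fix x assume "x \<in> S"
    then obtain T where "open T" "x \<in> T" "continuous_on T f"
      using 0 by (auto simp del: split_paired_Ex)
    then show "isCont f x"
      by (simp add: continuous_on_eq_continuous_at)
  qed
next
  case (Suc k)
  show ?case
    unfolding k_differentiable_on.simps
  proof (intro conjI ballI allI)
    fix x assume "x \<in> S"
    then show "f differentiable at x" using Suc.prems[of x] by auto
  next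
    fix v
    show "k_differentiable_on k S (\<lambda>x. frechet_derivative f (at x) v)"
      by (rule Suc.IH) (use Suc.prems in fastforce)
  qed
qed

lemma k_differentiable_on_const: "k_differentiable_on k S (\<lambda>x. c)"
  by (induction k arbitrary: c) auto

lemma k_differentiable_on_linear:
  assumes "open S" "bounded_linear f"
  shows "k_differentiable_on k S f"
proof (cases k)
  case 0
  then show ?thesis using assms(2) by (simp add: linear_continuous_on)
next
  case (Suc j)
  show ?thesis
    unfolding Suc
    by (rule k_differentiable_on_SucI[where f' = "\<lambda>_. f"])
      (use assms k_differentiable_on_const in \<open>auto intro: bounded_linear_imp_has_derivative\<close>)
qed

lemma k_differentiable_on_compose_linear:
  assumes "open S" "bounded_linear h" "k_differentiable_on k S f"
  shows "k_differentiable_on k S (\<lambda>x. h (f x))"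
  using assms(3)
proof (induction k arbitrary: f)
  case 0
  then show ?case
    by (auto intro: bounded_linear.continuous_on[OF assms(2)])
next
  case (Suc k)
  show ?case
    by (rule k_differentiable_on_SucI[where f' = "\<lambda>x v. h (frechet_derivative f (at x) v)"])
      (use assms k_differentiable_on_SucD[OF Suc.prems] Suc.IH
        in \<open>auto intro: bounded_linear.has_derivative\<close>)
qed

lemma k_differentiable_on_add:
  assumes "open S" "k_differentiable_on k S f" "k_differentiable_on k S g"
  shows "k_differentiable_on k S (\<lambda>x. f x + g x)"
  using assms(2,3)
proof (induction k arbitrary: f g)
  case 0
  then show ?case by (auto intro: continuous_intros)
next
  case (Suc k)
  show ?case
    by (rule k_differentiable_on_SucI[where
          f' = "\<lambda>x v. frechet_derivative f (at x) v + frechet_derivative g (at x) v"])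
      (use assms k_differentiable_on_SucD[OF Suc.prems(1)] k_differentiable_on_SucD[OF Suc.prems(2)]
          Suc.IH in \<open>auto intro: has_derivative_add\<close>)
qed

lemma k_differentiable_on_sum:
  assumes "open S" "\<And>i. i \<in> I \<Longrightarrow> k_differentiable_on k S (f i)"
  shows "k_differentiable_on k S (\<lambda>x. \<Sum>i\<in>I. f i x)"
  using assms(2)
  by (induction I rule: infinite_finite_induct)
    (auto intro: k_differentiable_on_const k_differentiable_on_add[OF \<open>open S\<close>])

lemma k_differentiable_on_bilinear:
  assumes "open S" "bounded_bilinear h" "k_differentiable_on k S f" "k_differentiable_on k S g"
  shows "k_differentiable_on k S (\<lambda>x. h (f x) (g x))"
  using assms(3,4)
proof (induction k arbitrary: f g)
  case 0
  then show ?case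
    by (auto intro: bounded_bilinear.continuous_on[OF assms(2)])
next
  case (Suc k)
  have "k_differentiable_on k S f" "k_differentiable_on k S g"
    using Suc.prems by (auto intro: k_differentiable_on_Suc_imp simp del: k_differentiable_on.simps)
  note IH = Suc.IH[OF this(1)] Suc.IH[OF _ this(2)]
  show ?case
    by (rule k_differentiable_on_SucI[where f' = "\<lambda>x v. h (f x) (frechet_derivative g (at x) v) +
          h (frechet_derivative f (at x) v) (g x)"])
      (use assms k_differentiable_on_SucD[OF Suc.prems(1)] k_differentiable_on_SucD[OF Suc.prems(2)]
          IH in \<open>auto intro!: bounded_bilinear.FDERIV k_differentiable_on_add
            simp del: k_differentiable_on.simps\<close>)
qed

text \<open>The directions in \<open>k_differentiable_on\<close> are constant, whereas the chain
  rule differentiates \<open>g\<close> in the varying direction given by the derivative of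
  \<open>f\<close>. Expanding this direction in \<open>Basis\<close> leaves scalar coefficients
  times derivatives of \<open>g\<close> in constant directions, to which the induction hypothesis
  applies; hence the Euclidean intermediate space.\<close>

lemma k_differentiable_on_compose:
  fixes f :: "'a::real_normed_vector \<Rightarrow> 'b::euclidean_space"
  assumes "open S" "open T" "f ` S \<subseteq> T" "k_differentiable_on k T g" "k_differentiable_on k S f"
  shows "k_differentiable_on k S (\<lambda>x. g (f x))"
  using assms(4,5)
proof (induction k arbitrary: g)
  case 0
  then show ?case
    using assms(3) by (auto intro: continuous_on_compose2)
next
  case (Suc k)
  note g = k_differentiable_on_SucD[OF Suc.prems(1)] and f = k_differentiable_on_SucD[OF Suc.prems(2)]
  let ?F = "\<lambda>x v. \<Sum>i\<in>Basis. (frechet_derivative f (at x) v \<bullet> i) *\<^sub>R frechet_derivative g (at (f x)) i"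
  show ?case
  proof (rule k_differentiable_on_SucI[where f' = ?F])
    fix x assume x: "x \<in> S"
    then have fx: "f x \<in> T" using assms(3) by auto
    interpret bounded_linear "frechet_derivative g (at (f x))"
      using g(1)[OF fx] by (rule has_derivative_bounded_linear)
    have "?F x v = frechet_derivative g (at (f x)) (frechet_derivative f (at x) v)" for v
      by (subst (3) euclidean_representation[symmetric]) (simp add: sum scaleR)
    then show "((\<lambda>x. g (f x)) has_derivative ?F x) (at x)"
      using diff_chain_at[OF f(1)[OF x] g(1)[OF fx]] by (simp add: o_def)
  next
    fix v
    have "k_differentiable_on k S f" using Suc.prems(2) by (rule k_differentiable_on_Suc_imp)
    then show "k_differentiable_on k S (\<lambda>x. ?F x v)"
      by (intro k_differentiable_on_sum \<open>open S\<close> Suc.IH[OF g(2)] f(2)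
          k_differentiable_on_bilinear[OF \<open>open S\<close> bounded_bilinear_scaleR]
          k_differentiable_on_compose_linear[OF \<open>open S\<close> bounded_linear_inner_left])
  qed (rule assms)
qed

lemma k_differentiable_on_Pair:
  assumes "open S" "k_differentiable_on k S f" "k_differentiable_on k S g"
  shows "k_differentiable_on k S (\<lambda>x. (f x, g x))"
proof -
  have l: "bounded_linear (\<lambda>y. (y, 0))" "bounded_linear (\<lambda>y. (0, y))"
    by (auto intro!: bounded_linear_intros)
  have "k_differentiable_on k S (\<lambda>x. (f x, 0) + (0, g x))"
    by (rule k_differentiable_on_add[OF assms(1)
          k_differentiable_on_compose_linear[OF assms(1) l(1) assms(2)]
          k_differentiable_on_compose_linear[OF assms(1) l(2) assms(3)]])
  then show ?thesis by simp
qed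

lemma k_differentiable_on_inverse:
  fixes f :: "'a::real_normed_vector \<Rightarrow> real"
  assumes "open S" "k_differentiable_on k S f" "\<And>x. x \<in> S \<Longrightarrow> f x \<noteq> 0"
  shows "k_differentiable_on k S (\<lambda>x. inverse (f x))"
  using assms(2)
proof (induction k)
  case 0
  then show ?case using assms(3) by (auto intro: continuous_intros)
next
  case (Suc k)
  note f = k_differentiable_on_SucD[OF Suc.prems]
  have IH: "k_differentiable_on k S (\<lambda>x. inverse (f x))"
    using Suc.IH[OF k_differentiable_on_Suc_imp[OF Suc.prems]] .
  have "bounded_linear (\<lambda>x::real. - x)" by (rule bounded_linear_minus[OF bounded_linear_ident])
  note intros = k_differentiable_on_compose_linear[OF \<open>open S\<close> this]
    k_differentiable_on_bilinear[OF \<open>open S\<close> bounded_bilinear_mult]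
  show ?case
  proof (rule k_differentiable_on_SucI[where
          f' = "\<lambda>x v. - (inverse (f x) * frechet_derivative f (at x) v * inverse (f x))"])
    fix x assume x: "x \<in> S"
    show "((\<lambda>x. inverse (f x)) has_derivative
        (\<lambda>v. - (inverse (f x) * frechet_derivative f (at x) v * inverse (f x)))) (at x)"
      by (rule Deriv.has_derivative_inverse[OF assms(3)[OF x] f(1)[OF x]])
  next
    fix v
    show "k_differentiable_on k S
        (\<lambda>x. - (inverse (f x) * frechet_derivative f (at x) v * inverse (f x)))"
      by (intro intros IH f(2))
  qed (rule \<open>open S\<close>)
qed

lemma smooth_on_subset: "smooth_on S f \<Longrightarrow> T \<subseteq> S \<Longrightarrow> smooth_on T f"
  unfolding smooth_on_def by (blast intro: k_differentiable_on_subset)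

lemma smooth_on_cong:
  "open S \<Longrightarrow> (\<And>x. x \<in> S \<Longrightarrow> f x = g x) \<Longrightarrow> smooth_on S f \<Longrightarrow> smooth_on S g"
  unfolding smooth_on_def using k_differentiable_on_cong by blast

lemma smooth_on_local:
  assumes "\<And>x. x \<in> S \<Longrightarrow> \<exists>T. open T \<and> x \<in> T \<and> smooth_on T f"
  shows "smooth_on S f"
  unfolding smooth_on_def
proof
  fix k
  show "k_differentiable_on k S f"
    using assms by (intro k_differentiable_on_local) (auto simp: smooth_on_def)
qed

lemma smooth_on_const: "smooth_on S (\<lambda>x. c)"
  unfolding smooth_on_def by (simp add: k_differentiable_on_const)

lemma smooth_on_linear: "open S \<Longrightarrow> bounded_linear f \<Longrightarrow> smooth_on S f"
  unfolding smooth_on_def by (simp add: k_differentiable_on_linear)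

lemma smooth_on_compose_linear:
  "open S \<Longrightarrow> bounded_linear h \<Longrightarrow> smooth_on S f \<Longrightarrow> smooth_on S (\<lambda>x. h (f x))"
  unfolding smooth_on_def by (simp add: k_differentiable_on_compose_linear)

lemma smooth_on_add:
  "open S \<Longrightarrow> smooth_on S f \<Longrightarrow> smooth_on S g \<Longrightarrow> smooth_on S (\<lambda>x. f x + g x)"
  unfolding smooth_on_def by (simp add: k_differentiable_on_add)

lemma smooth_on_scaleR:
  "open S \<Longrightarrow> smooth_on S f \<Longrightarrow> smooth_on S g \<Longrightarrow> smooth_on S (\<lambda>x. f x *\<^sub>R g x)"
  unfolding smooth_on_def by (simp add: k_differentiable_on_bilinear[OF _ bounded_bilinear_scaleR])

lemma smooth_on_mult:
  fixes f g :: "'a::real_normed_vector \<Rightarrow> real"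
  shows "open S \<Longrightarrow> smooth_on S f \<Longrightarrow> smooth_on S g \<Longrightarrow> smooth_on S (\<lambda>x. f x * g x)"
  using smooth_on_scaleR[of S f g] by simp

lemma smooth_on_Pair:
  "open S \<Longrightarrow> smooth_on S f \<Longrightarrow> smooth_on S g \<Longrightarrow> smooth_on S (\<lambda>x. (f x, g x))"
  unfolding smooth_on_def by (simp add: k_differentiable_on_Pair)

lemma smooth_on_inverse:
  fixes f :: "'a::real_normed_vector \<Rightarrow> real"
  shows "open S \<Longrightarrow> smooth_on S f \<Longrightarrow> (\<And>x. x \<in> S \<Longrightarrow> f x \<noteq> 0) \<Longrightarrow> smooth_on S (\<lambda>x. inverse (f x))"
  unfolding smooth_on_def by (simp add: k_differentiable_on_inverse)

lemma smooth_on_compose: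
  fixes f :: "'a::real_normed_vector \<Rightarrow> 'b::euclidean_space"
  assumes "open S" "open T" "smooth_on T g" "smooth_on S f" "f ` S \<subseteq> T"
  shows "smooth_on S (\<lambda>x. g (f x))"
  using assms unfolding smooth_on_def by (auto intro: k_differentiable_on_compose)

lemma smooth_on_imp_has_derivative:
  assumes "smooth_on S f" "x \<in> S"
  shows "(f has_derivative frechet_derivative f (at x)) (at x)"
  using assms k_differentiable_on_SucD(1)[of 0 S f] unfolding smooth_on_def by blast

lemma smooth_on_frechet_derivative:
  assumes "smooth_on S f"
  shows "smooth_on S (\<lambda>x. frechet_derivative f (at x) v)"
  using assms k_differentiable_on_SucD(2) unfolding smooth_on_def by blast

lemma smooth_on_imp_continuous_on: "smooth_on S f \<Longrightarrow> continuous_on S f"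
  unfolding smooth_on_def by (metis k_differentiable_on.simps(1))

subsection \<open>Ordinary differential equations over short time intervals\<close>

lemma vector_derivative_bound:
  fixes f :: "real \<Rightarrow> 'a::real_normed_vector"
  assumes "convex I" "\<And>t. t \<in> I \<Longrightarrow> (f has_vector_derivative f' t) (at t within I)"
    and "\<And>t. t \<in> I \<Longrightarrow> norm (f' t) \<le> B" "s \<in> I" "t \<in> I"
  shows "norm (f t - f s) \<le> B * \<bar>t - s\<bar>"
proof -
  have "onorm (\<lambda>h. h *\<^sub>R f' u) \<le> B" if "u \<in> I" for u
  proof (rule onorm_le)
    fix h :: real
    show "norm (h *\<^sub>R f' u) \<le> B * norm h"
      using mult_right_mono[OF assms(3)[OF that], of "\<bar>h\<bar>"] by (simp add: mult.commute)
  qed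
  then show ?thesis
    using differentiable_bound[of I f "\<lambda>t h. h *\<^sub>R f' t" B t s] assms
    by (auto simp: has_vector_derivative_def)
qed

text \<open>A substitute for Gronwall's inequality: on an interval short enough that \<open>L * \<tau> \<le> 1 / 2\<close> the
  mean value theorem suffices.\<close>

lemma short_time_bound:
  fixes f :: "real \<Rightarrow> 'a::real_normed_vector"
  assumes "convex I" "\<And>t. t \<in> I \<Longrightarrow> (f has_vector_derivative f' t) (at t within I)"
    and bound: "\<And>t. t \<in> I \<Longrightarrow> norm (f' t) \<le> L * norm (f t) + d"
    and "s \<in> I" "f s = 0" "\<And>t. t \<in> I \<Longrightarrow> \<bar>t - s\<bar> \<le> \<tau>" "L * \<tau> \<le> 1 / 2" "0 \<le> L" "t \<in> I"
  shows "norm (f t) \<le> 2 * \<tau> * d"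
proof -
  let ?J = "closed_segment s t"
  have J: "?J \<subseteq> I" using assms by (intro closed_segment_subset)
  have der: "(f has_vector_derivative f' u) (at u within ?J)" if "u \<in> ?J" for u
    using that J assms(2) has_vector_derivative_within_subset by blast
  then have "continuous_on ?J (\<lambda>u. norm (f u))"
    by (intro continuous_on_norm continuous_on_vector_derivative)
  \<comment> \<open>At a maximum \<open>u\<close> of \<open>norm (f u)\<close>, the term
    \<open>L * norm (f u)\<close> of the bound contributes at most half of \<open>norm (f u)\<close>
    over time \<open>\<tau>\<close> and is absorbed on the left.\<close>
  then obtain u where u: "u \<in> ?J" "\<And>v. v \<in> ?J \<Longrightarrow> norm (f v) \<le> norm (f u)"
    using continuous_attains_sup[OF compact_segment, of s t] by fastforce
  define B where "B = L * norm (f u) + d"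
  have B: "norm (f' v) \<le> B" if "v \<in> ?J" for v
    using bound[of v] mult_left_mono[OF u(2)[OF that] \<open>0 \<le> L\<close>] J that by (force simp: B_def)
  have "norm (f u - f s) \<le> B * \<bar>u - s\<bar>"
    by (rule vector_derivative_bound[where I = ?J and f' = f']) (use der B u in auto)
  also have "\<dots> \<le> B * \<tau>"
    using assms(6)[of u] J u(1) order_trans[OF norm_ge_zero B[OF u(1)]]
    by (intro mult_left_mono) auto
  also have "\<dots> = (L * \<tau>) * norm (f u) + d * \<tau>" by (simp add: B_def algebra_simps)
  also have "\<dots> \<le> (1 / 2) * norm (f u) + d * \<tau>"
    using assms(7) by (intro add_right_mono mult_right_mono) auto
  finally have "norm (f u) \<le> 2 * \<tau> * d" using \<open>f s = 0\<close> by (simp add: algebra_simps)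
  then show ?thesis using u(2)[of t] by auto
qed

text \<open>Picard iteration: in the supremum norm the integral operator contracts with factor
  \<open>L * T\<close>, which is at most 1/2. Since \<open>g\<close> is defined and Lipschitz on the
  whole space, no solution can leave the domain before time \<open>T\<close>.\<close>

lemma ode_short_time_exists:
  fixes g :: "real \<Rightarrow> 'e::banach \<Rightarrow> 'e"
  assumes "0 < T" "0 \<le> L" "L * T \<le> 1 / 2"
    and cont: "continuous_on ({-T..T} \<times> UNIV) (\<lambda>(t, z). g t z)"
    and lip: "\<And>t u v. t \<in> {-T..T} \<Longrightarrow> norm (g t u - g t v) \<le> L * norm (u - v)"
  shows "\<exists>w. w 0 = 0 \<and>
    (\<forall>t\<in>{-T..T}. (w has_vector_derivative g t (w t)) (at t within {-T..T}))"
proof -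
  \<comment> \<open>The difference of two integrals from \<open>-T\<close> is the oriented integral
    from 0 to \<open>t\<close>, for \<open>t\<close> of either sign.\<close>
  define J where "J z t = integral {-T..t} (\<lambda>s. g s (apply_bcontfun z s)) -
    integral {-T..0} (\<lambda>s. g s (apply_bcontfun z s))" for z t
  have contg: "continuous_on {-T..T} (\<lambda>s. g s (apply_bcontfun z s))" for z
    using continuous_on_compose2[OF cont
        continuous_on_Pair[OF continuous_on_id continuous_on_apply_bcontfun[of _ z]]]
    by auto
  have derJ: "(J z has_vector_derivative g t (apply_bcontfun z t)) (at t within {-T..T})"
    if "t \<in> {-T..T}" for t z
    unfolding J_def
    using integral_has_vector_derivative[OF contg that] by (auto intro!: derivative_eq_intros)
  have contJ: "continuous_on (cbox (-T) T) (J z)" for z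
    using derJ by (intro continuous_on_vector_derivative) auto
  \<comment> \<open>Clamping the argument to the interval turns \<open>J z\<close> into a bounded
    continuous function on the line, a point of the complete space in which the fixed point is
    sought.\<close>
  have "\<exists>h. (\<forall>x\<in>cbox (-T) T. apply_bcontfun h x = J z x) \<and>
      (\<forall>x. apply_bcontfun h x = J z (clamp (-T) T x))" for z
    using continuous_on_cbox_bcontfunE[OF contJ[of z]] by metis
  then obtain P where P: "\<And>z x. x \<in> cbox (-T) T \<Longrightarrow> apply_bcontfun (P z) x = J z x"
      "\<And>z x. apply_bcontfun (P z) x = J z (clamp (-T) T x)"
    by metis
  have "dist (P y) (P z) \<le> (1 / 2) * dist y z" for y z
  proof (rule dist_bound)
    fix x
    define t where "t = clamp (-T) T x"
    have t: "t \<in> {-T..T}" unfolding t_def using \<open>0 < T\<close> clamp_in_interval[of "-T" T x] by auto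
    have "norm ((J y t - J z t) - (J y 0 - J z 0)) \<le> (L * dist y z) * \<bar>t - 0\<bar>"
    proof (rule vector_derivative_bound[where I = "{-T..T}"])
      fix s assume s: "s \<in> {-T..T}"
      show "((\<lambda>t. J y t - J z t) has_vector_derivative g s (apply_bcontfun y s) - g s (apply_bcontfun z s)) (at s within {-T..T})"
        using derJ[OF s] by (intro has_vector_derivative_diff)
      have "norm (g s (apply_bcontfun y s) - g s (apply_bcontfun z s)) \<le>
          L * dist (apply_bcontfun y s) (apply_bcontfun z s)"
        using lip[OF s] by (simp add: dist_norm)
      also have "\<dots> \<le> L * dist y z" using \<open>0 \<le> L\<close> by (intro mult_left_mono dist_bounded)
      finally show "norm (g s (apply_bcontfun y s) - g s (apply_bcontfun z s)) \<le> L * dist y z" .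
    qed (use t \<open>0 < T\<close> in auto)
    also have "\<dots> \<le> (L * dist y z) * T"
      using t \<open>0 \<le> L\<close> by (intro mult_left_mono) auto
    also have "\<dots> = (L * T) * dist y z" by simp
    also have "\<dots> \<le> (1 / 2) * dist y z"
      using assms(3) by (intro mult_right_mono) auto
    finally show "dist (apply_bcontfun (P y) x) (apply_bcontfun (P z) x) \<le> (1 / 2) * dist y z"
      by (simp add: P(2) t_def dist_norm J_def)
  qed
  then have "\<exists>!z. P z = z" by (intro banach_fix_type[of "1/2"]) auto
  then obtain z where z: "P z = z" by auto
  have eq: "apply_bcontfun z x = J z x" if "x \<in> {-T..T}" for x
    using P(1)[of x z] z that by auto
  show ?thesis
  proof (intro exI[of _ "J z"] conjI ballI)
    show "J z 0 = 0" by (simp add: J_def)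
    fix t assume t: "t \<in> {-T..T}"
    show "(J z has_vector_derivative g t (J z t)) (at t within {-T..T})"
      using derJ[OF t, of z] eq[OF t] by simp
  qed
qed

section \<open>Dependence of solutions on parameters\<close>

lemma k_differentiable_on_uniform_linearization:
  fixes g :: "'a::euclidean_space \<Rightarrow> 'b::real_normed_vector"
  assumes "open \<Omega>" "compact K" "K \<subseteq> \<Omega>" "k_differentiable_on (Suc 0) \<Omega> g" "0 < e"
  obtains d where "0 < d" "\<And>p q. p \<in> K \<Longrightarrow> norm (q - p) < d \<Longrightarrow>
    norm (g q - g p - frechet_derivative g (at p) (q - p)) \<le> e * norm (q - p)"
proof -
  let ?D = "\<lambda>p. frechet_derivative g (at p)"
  have D: "(g has_derivative ?D p) (at p)" if "p \<in> \<Omega>" for p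
    using k_differentiable_on_SucD(1)[OF assms(4) that] .
  have contD: "continuous_on \<Omega> (\<lambda>p. ?D p v)" for v
    using k_differentiable_on_SucD(2)[OF assms(4)] by simp
  \<comment> \<open>\<open>s p q\<close> dominates the operator norm of the difference of the two
    derivatives, and its continuity follows from that of the derivatives in the finitely many basis
    directions.\<close>
  define s where "s p q = (\<Sum>i\<in>Basis. norm (?D q i - ?D p i))" for p q
  have s: "norm (?D q v - ?D p v) \<le> s p q * norm v" if "p \<in> \<Omega>" "q \<in> \<Omega>" for p q v
  proof -
    interpret p: bounded_linear "?D p" using D[OF that(1)] by (rule has_derivative_bounded_linear)
    interpret q: bounded_linear "?D q" using D[OF that(2)] by (rule has_derivative_bounded_linear)
    have "?D q v - ?D p v = (\<Sum>i\<in>Basis. (v \<bullet> i) *\<^sub>R (?D q i - ?D p i))"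
      by (subst (1 2) euclidean_representation[symmetric, of v])
        (simp add: p.sum q.sum p.scaleR q.scaleR sum_subtractf scaleR_diff_right)
    also have "norm \<dots> \<le> (\<Sum>i\<in>Basis. norm (?D q i - ?D p i) * norm v)"
    proof (rule sum_norm_le)
      fix i :: 'a assume "i \<in> Basis"
      then show "norm ((v \<bullet> i) *\<^sub>R (?D q i - ?D p i)) \<le> norm (?D q i - ?D p i) * norm v"
        using mult_left_mono[OF Basis_le_norm[of i v], of "norm (?D q i - ?D p i)"]
        by (simp add: mult.commute)
    qed
    finally show ?thesis by (simp add: s_def sum_distrib_right)
  qed
  have "\<exists>r>0. ball p r \<subseteq> \<Omega> \<and> (\<forall>q\<in>ball p r. s p q < e / 2)" if "p \<in> \<Omega>" for p
  proof -
    have "continuous_on \<Omega> (s p)" unfolding s_def by (intro continuous_intros contD)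
    then have "open {q \<in> \<Omega>. s p q < e / 2}"
      using continuous_openin_preimage_gen[OF _ open_lessThan[of "e / 2"], of \<Omega> "s p"] \<open>open \<Omega>\<close>
      by (simp add: openin_open_eq vimage_def Int_def lessThan_def)
    moreover have "p \<in> {q \<in> \<Omega>. s p q < e / 2}" using that \<open>0 < e\<close> by (simp add: s_def)
    ultimately obtain r where "r > 0" "ball p r \<subseteq> {q \<in> \<Omega>. s p q < e / 2}"
      using openE by blast
    then show ?thesis by (intro exI[of _ r]) auto
  qed
  then obtain r where r: "\<And>p. p \<in> \<Omega> \<Longrightarrow> r p > 0" "\<And>p. p \<in> \<Omega> \<Longrightarrow> ball p (r p) \<subseteq> \<Omega>"
      "\<And>p q. p \<in> \<Omega> \<Longrightarrow> q \<in> ball p (r p) \<Longrightarrow> s p q < e / 2"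
    by metis
  have "K \<subseteq> \<Union>((\<lambda>p. ball p (r p)) ` K)" using r(1) \<open>K \<subseteq> \<Omega>\<close> by force
  \<comment> \<open>\<open>d\<close> is a Lebesgue number of the cover, hence one radius for all
    base points in \<open>K\<close>: \<open>p\<close> and \<open>q\<close> then lie in one ball, on
    which the derivative differs from that at the centre by less than \<open>e / 2\<close>.\<close>
  then obtain d where d: "0 < d" "\<And>p. p \<in> K \<Longrightarrow> \<exists>B\<in>(\<lambda>p. ball p (r p)) ` K. ball p d \<subseteq> B"
    by (rule Heine_Borel_lemma[OF \<open>compact K\<close>]) auto
  show thesis
  proof (rule that[OF d(1)])
    fix p q assume p: "p \<in> K" and q: "norm (q - p) < d"
    obtain p0 where p0: "p0 \<in> K" "ball p d \<subseteq> ball p0 (r p0)" using d(2)[OF p] by auto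
    then have in\<Omega>: "p0 \<in> \<Omega>" using \<open>K \<subseteq> \<Omega>\<close> by auto
    have pB: "p \<in> ball p0 (r p0)" using p0(2) centre_in_ball[of p d] d(1) by blast
    have qB: "q \<in> ball p0 (r p0)" using p0 q by (auto simp: dist_norm norm_minus_commute)
    have "norm (g q - g p - ?D p (q - p)) \<le> norm (q - p) * e"
    proof (rule differentiable_bound_linearization[where S = "ball p0 (r p0)"])
      fix t :: real assume t: "t \<in> {0..1}"
      have "(1 - t) *\<^sub>R p + t *\<^sub>R q \<in> ball p0 (r p0)"
        using pB qB t by (intro convexD[OF convex_ball]) auto
      then show "p + t *\<^sub>R (q - p) \<in> ball p0 (r p0)" by (simp add: algebra_simps)
    next
      fix x assume x: "x \<in> ball p0 (r p0)"
      then have x\<Omega>: "x \<in> \<Omega>" "p \<in> \<Omega>" using r(2)[OF in\<Omega>] pB by auto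
      show "(g has_derivative ?D x) (at x within ball p0 (r p0))"
        using D[OF x\<Omega>(1)] has_derivative_at_withinI by blast
      show "onorm (?D x - ?D p) \<le> e"
      proof (rule onorm_le)
        fix v
        have "norm (?D x v - ?D p v) \<le> norm (?D x v - ?D p0 v) + norm (?D p v - ?D p0 v)"
          using norm_triangle_ineq4[of "?D x v - ?D p0 v" "?D p v - ?D p0 v"] by simp
        also have "\<dots> \<le> s p0 x * norm v + s p0 p * norm v"
          by (intro add_mono s in\<Omega> x\<Omega>)
        also have "\<dots> \<le> e / 2 * norm v + e / 2 * norm v"
          using r(3)[OF in\<Omega> x] r(3)[OF in\<Omega> pB] by (intro add_mono mult_right_mono) auto
        finally show "norm ((?D x - ?D p) v) \<le> e * norm v" by simp
      qed
    qed (use pB in auto)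
    then show "norm (g q - g p - ?D p (q - p)) \<le> e * norm (q - p)" by (simp add: mult.commute)
  qed
qed

text \<open>\<open>z (x, t)\<close> is the value at time \<open>t\<close> of the solution with parameter \<open>x\<close>; all solutions start
  at \<open>0\<close>. Initial values become parameters by translation.\<close>

locale ode_family =
  fixes X :: "'x::euclidean_space set" and T L :: real and Z :: "'e::euclidean_space set"
    and G :: "('x \<times> real) \<times> 'e \<Rightarrow> 'e" and z :: "'x \<times> real \<Rightarrow> 'e"
  assumes openX: "open X" and openZ: "open Z" and L_nonneg: "0 \<le> L"
    and short: "L * T \<le> 1 / 2"
    and lip: "\<And>x t u v. x \<in> X \<Longrightarrow> t \<in> {-T<..<T} \<Longrightarrow> u \<in> Z \<Longrightarrow> v \<in> Z \<Longrightarrow>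
      norm (G ((x, t), u) - G ((x, t), v)) \<le> L * norm (u - v)"
    and z_init: "\<And>x. x \<in> X \<Longrightarrow> z (x, 0) = 0"
    and z_in: "\<And>x t. x \<in> X \<Longrightarrow> t \<in> {-T<..<T} \<Longrightarrow> z (x, t) \<in> Z"
    and z_ode: "\<And>x t. x \<in> X \<Longrightarrow> t \<in> {-T<..<T} \<Longrightarrow>
      ((\<lambda>s. z (x, s)) has_vector_derivative G ((x, t), z (x, t))) (at t)"
begin

abbreviation "Base \<equiv> X \<times> {-T<..<T}"

lemma open_Base: "open Base" and open_Base_Z: "open (Base \<times> Z)"
  using openX openZ by (auto intro!: open_Times)

lemma z_ode_within:
  assumes "x \<in> X" "t \<in> {-T<..<T}"
  shows "((\<lambda>s. z (x, s)) has_vector_derivative G ((x, t), z (x, t))) (at t within I)"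
  using z_ode[OF assms] has_vector_derivative_at_within by blast

lemma continuous_z_time: "x \<in> X \<Longrightarrow> I \<subseteq> {-T<..<T} \<Longrightarrow> continuous_on I (\<lambda>t. z (x, t))"
  using z_ode_within by (intro continuous_on_vector_derivative) blast

text \<open>The difference of the two solutions vanishes at time 0, and its derivative splits into a
  change of the fibre point, controlled by \<open>L\<close>, and a change of the parameter at the
  fixed point \<open>z (x, t)\<close>. An estimate along the one known trajectory is therefore
  enough.\<close>

lemma compare:
  assumes "x \<in> X" "y \<in> X" "0 \<le> S" "S < T" "t \<in> {-S..S}"
    and close: "\<And>t. t \<in> {-S..S} \<Longrightarrow> norm (G ((y, t), z (x, t)) - G ((x, t), z (x, t))) \<le> e"
  shows "norm (z (y, t) - z (x, t)) \<le> 2 * S * e"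
proof (rule short_time_bound[where I = "{-S..S}" and L = L and s = 0 and \<tau> = S])
  fix t assume t: "t \<in> {-S..S}"
  then have tT: "t \<in> {-T<..<T}" using \<open>S < T\<close> by auto
  show "((\<lambda>t. z (y, t) - z (x, t)) has_vector_derivative
      G ((y, t), z (y, t)) - G ((x, t), z (x, t))) (at t within {-S..S})"
    using assms(1,2) tT by (intro has_vector_derivative_diff z_ode_within)
  have "norm (G ((y, t), z (y, t)) - G ((x, t), z (x, t))) \<le>
      norm (G ((y, t), z (y, t)) - G ((y, t), z (x, t))) + norm (G ((y, t), z (x, t)) - G ((x, t), z (x, t)))"
    using norm_triangle_ineq[of "G ((y, t), z (y, t)) - G ((y, t), z (x, t))"
        "G ((y, t), z (x, t)) - G ((x, t), z (x, t))"] by simp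
  also have "\<dots> \<le> L * norm (z (y, t) - z (x, t)) + e"
    using assms(1,2) tT t by (intro add_mono lip z_in close)
  finally show "norm (G ((y, t), z (y, t)) - G ((x, t), z (x, t))) \<le> L * norm (z (y, t) - z (x, t)) + e" .
next
  show "L * S \<le> 1 / 2"
    using short mult_left_mono[of S T L] L_nonneg \<open>S < T\<close> by linarith
qed (use assms z_init L_nonneg in auto)

lemma continuous_z:
  assumes "continuous_on (Base \<times> Z) G"
  shows "continuous_on Base z"
proof -
  have "isCont z (x0, t0)" if x0: "x0 \<in> X" and t0: "t0 \<in> {-T<..<T}" for x0 t0
  proof -
    obtain S where S: "\<bar>t0\<bar> < S" "S < T" using dense[of "\<bar>t0\<bar>" T] t0 by (auto simp: abs_less_iff)
    then have I: "{-S..S} \<subseteq> {-T<..<T}" "0 < S" by auto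
    have "\<forall>\<^sub>F p in nhds (x0, t0). dist (z p) (z (x0, t0)) < e" if "0 < e" for e
    proof -
      define e' where "e' = e / (4 * S)"
      have e': "0 < e'" "2 * S * e' = e / 2" using that I by (auto simp: e'_def)
      have "continuous_on (X \<times> {-S..S}) (\<lambda>p. G (p, z (x0, snd p)))"
        using I x0 z_in[OF x0]
        by (intro continuous_on_compose2[OF assms] continuous_intros
            continuous_on_compose2[OF continuous_z_time[OF x0 I(1)]]) auto
      \<comment> \<open>Compactness of the time interval makes the neighbourhood of
        \<open>x0\<close> independent of \<open>t\<close>, as \<open>compare\<close>
        requires.\<close>
      then obtain X0 where X0: "x0 \<in> X0" "open X0"
        "\<forall>x\<in>X0 \<inter> X. \<forall>t\<in>{-S..S}. dist (G ((x, t), z (x0, t))) (G ((x0, t), z (x0, t))) \<le> e'"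
        by (rule continuous_on_prod_compactE[OF _ compact_Icc x0 e'(1)]) (simp add: split_beta)
      have "continuous_on {-T<..<T} (\<lambda>t. z (x0, t))" by (rule continuous_z_time[OF x0 order_refl])
      then have "isCont (\<lambda>t. z (x0, t)) t0" using t0 by (simp add: continuous_on_eq_continuous_at)
      then have "((\<lambda>t. z (x0, t)) \<longlongrightarrow> z (x0, t0)) (nhds t0)"
        unfolding isCont_def by (rule tendsto_at_iff_tendsto_nhds[THEN iffD1])
      then have "\<forall>\<^sub>F t in nhds t0. dist (z (x0, t)) (z (x0, t0)) < e / 2"
        using \<open>0 < e\<close> by (intro tendstoD) auto
      then obtain A where A: "open A" "t0 \<in> A" "\<And>t. t \<in> A \<Longrightarrow> dist (z (x0, t)) (z (x0, t0)) < e / 2"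
        by (auto simp: eventually_nhds)
      let ?N = "(X0 \<inter> X) \<times> (A \<inter> {-S<..<S})"
      have "dist (z (x, t)) (z (x0, t0)) < e" if "(x, t) \<in> ?N" for x t
      proof -
        have "norm (z (x, t) - z (x0, t)) \<le> 2 * S * e'"
          by (rule compare) (use that X0 S I x0 in \<open>auto simp: dist_norm\<close>)
        then show ?thesis
          using A(3)[of t] that e'(2) dist_triangle[of "z (x, t)" "z (x0, t0)" "z (x0, t)"]
          by (auto simp: dist_norm)
      qed
      moreover have "open ?N" "(x0, t0) \<in> ?N"
        using X0 A openX S x0 by (auto intro!: open_Times)
      ultimately show ?thesis unfolding eventually_nhds by (intro exI[of _ ?N]) auto
    qed
    then show ?thesis
      by (auto simp: isCont_def tendsto_at_iff_tendsto_nhds intro!: tendstoI)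
  qed
  then show ?thesis by (auto intro!: continuous_at_imp_continuous_on)
qed

text \<open>The limit of the Lipschitz estimate along the fibre. It lets the variational equation
  inherit the constant \<open>L\<close>, and so be treated over the same time intervals without
  shrinking them.\<close>

lemma frechet_derivative_fibre_bound:
  assumes "G differentiable (at ((x, t), u))" "x \<in> X" "t \<in> {-T<..<T}" "u \<in> Z"
  shows "norm (frechet_derivative G (at ((x, t), u)) (0, y)) \<le> L * norm y"
proof (rule field_le_epsilon)
  let ?p = "((x, t), u)" and ?D = "frechet_derivative G (at ((x, t), u))"
  have D: "(G has_derivative ?D) (at ?p)" using assms(1) by (simp add: frechet_derivative_works)
  interpret bounded_linear ?D using D by (rule has_derivative_bounded_linear)
  fix e :: real assume "0 < e"
  define e' where "e' = e / (norm y + 1)"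
  have e': "0 < e'" "e' * norm y \<le> e"
    using \<open>0 < e\<close> by (auto simp: e'_def field_simps add_pos_nonneg)
  obtain d where d: "0 < d" "\<And>q. norm (q - ?p) < d \<Longrightarrow> norm (G q - G ?p - ?D (q - ?p)) \<le> e' * norm (q - ?p)"
    using D e'(1) unfolding has_derivative_at_alt by blast
  obtain r where r: "0 < r" "ball u r \<subseteq> Z" using openZ assms(4) openE by blast
  \<comment> \<open>The step keeps \<open>u + s *\<^sub>R y\<close> in \<open>Z\<close> and within
    the linearization radius; adding 1 covers \<open>y = 0\<close>.\<close>
  define s where "s = min d r / (2 * (norm y + 1))"
  have s: "0 < s" "s * norm y < d" "s * norm y < r"
  proof -
    show "0 < s" using d r by (simp add: s_def add_nonneg_pos)
    have "s * norm y \<le> s * (norm y + 1)" using \<open>0 < s\<close> by simp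
    also have "\<dots> = min d r / 2"
      using add_nonneg_pos[OF norm_ge_zero[of y] zero_less_one] by (simp add: s_def field_simps)
    finally show "s * norm y < d" "s * norm y < r" using d r by auto
  qed
  let ?q = "((x, t), u + s *\<^sub>R y)"
  have diff: "?q - ?p = s *\<^sub>R (0, y)" by simp
  have "norm (G ?q - G ?p - ?D (?q - ?p)) \<le> e' * norm (?q - ?p)"
    using s by (intro d(2)) (simp add: norm_Pair)
  then have 1: "norm (G ?q - G ?p - s *\<^sub>R ?D (0, y)) \<le> e' * (s * norm y)"
    unfolding diff scaleR using s by (simp add: norm_Pair)
  have 2: "norm (G ?q - G ?p) \<le> L * (s * norm y)"
  proof -
    have "u + s *\<^sub>R y \<in> Z" using r(2) s by (auto simp: dist_norm)
    then show ?thesis using lip[OF assms(2,3), of "u + s *\<^sub>R y" u] s assms(4) by simp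
  qed
  have "s * norm (?D (0, y)) = norm (s *\<^sub>R ?D (0, y))" using s by simp
  also have "\<dots> \<le> norm (G ?q - G ?p) + norm (G ?q - G ?p - s *\<^sub>R ?D (0, y))"
    using norm_triangle_ineq4[of "G ?q - G ?p" "G ?q - G ?p - s *\<^sub>R ?D (0, y)"] by simp
  also have "\<dots> \<le> s * (L * norm y + e' * norm y)" using 1 2 by (simp add: algebra_simps)
  finally have "norm (?D (0, y)) \<le> L * norm y + e' * norm y" using s by simp
  then show "norm (?D (0, y)) \<le> L * norm y + e" using e' by simp
qed

text \<open>The equation is affine in \<open>w\<close> with Lipschitz constant \<open>L\<close>,
  hence solvable on every compact interval \<open>{-S..S}\<close> inside the open interval on which
  the trajectory is given.\<close>

lemma variational_equation_solvable:
  assumes G: "k_differentiable_on (Suc 0) (Base \<times> Z) G" and "x \<in> X" "0 < S" "S < T"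
  shows "\<exists>w. w 0 = 0 \<and> (\<forall>t\<in>{-S..S}. (w has_vector_derivative
    frechet_derivative G (at ((x, t), z (x, t))) ((j, 0), w t)) (at t within {-S..S}))"
proof (rule ode_short_time_exists[where L = L])
  let ?D = "\<lambda>t. frechet_derivative G (at ((x, t), z (x, t)))"
  have I: "{-S..S} \<subseteq> {-T<..<T}" using assms by auto
  have in\<Omega>: "((x, t), z (x, t)) \<in> Base \<times> Z" if "t \<in> {-S..S}" for t
    using that I assms(2) z_in by auto
  note D = k_differentiable_on_SucD(1)[OF G in\<Omega>]
  have lin: "linear (?D t)" if "t \<in> {-S..S}" for t
    using D[OF that] has_derivative_linear by blast
  have contD: "continuous_on {-S..S} (\<lambda>t. ?D t v)" for v
  proof (rule continuous_on_compose2[where g = "\<lambda>p. frechet_derivative G (at p) v" and f = "\<lambda>t. ((x, t), z (x, t))"])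
    show "continuous_on (Base \<times> Z) (\<lambda>p. frechet_derivative G (at p) v)"
      using k_differentiable_on_SucD(2)[OF G, of v] by simp
    show "continuous_on {-S..S} (\<lambda>t. ((x, t), z (x, t)))"
      by (intro continuous_intros continuous_z_time[OF assms(2) I])
  qed (use in\<Omega> in blast)
  \<comment> \<open>Writing the derivative as affine in \<open>y\<close> reduces joint continuity in
    \<open>(t, y)\<close> to continuity in \<open>t\<close> for constant directions.\<close>
  have expand: "?D t ((j, 0), y) = ?D t ((j, 0), 0) + (\<Sum>i\<in>Basis. (y \<bullet> i) *\<^sub>R ?D t (0, i))"
    if "t \<in> {-S..S}" for t y
  proof -
    have "((j, 0), y) = ((j, 0), 0) + (\<Sum>i\<in>Basis. (y \<bullet> i) *\<^sub>R ((0, 0), i))"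
      by (intro prod_eqI) (simp_all add: fst_sum snd_sum euclidean_representation zero_prod_def)
    then have "?D t ((j, 0), y) = ?D t (((j, 0), 0) + (\<Sum>i\<in>Basis. (y \<bullet> i) *\<^sub>R ((0, 0), i)))"
      by (rule arg_cong)
    also have "\<dots> = ?D t ((j, 0), 0) + (\<Sum>i\<in>Basis. (y \<bullet> i) *\<^sub>R ?D t ((0, 0), i))"
      by (simp only: linear_add[OF lin[OF that]] linear_sum[OF lin[OF that]] linear_scale[OF lin[OF that]])
    finally show ?thesis by (simp only: zero_prod_def)
  qed
  show "continuous_on ({-S..S} \<times> UNIV) (\<lambda>(t, y). ?D t ((j, 0), y))"
  proof -
    have "continuous_on ({-S..S} \<times> UNIV)
        (\<lambda>p. ?D (fst p) ((j, 0), 0) + (\<Sum>i\<in>Basis. (snd p \<bullet> i) *\<^sub>R ?D (fst p) (0, i)))"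
    proof -
      have "continuous_on ({-S..S} \<times> UNIV) (\<lambda>p. ?D (fst p) v)" for v
        by (rule continuous_on_compose2[OF contD continuous_on_fst[OF continuous_on_id]]) auto
      then show ?thesis by (intro continuous_intros)
    qed
    then show ?thesis
    proof (rule continuous_on_eq)
      fix p :: "real \<times> 'e" assume "p \<in> {-S..S} \<times> UNIV"
      then have "fst p \<in> {-S..S}" by auto
      from expand[OF this, of "snd p"]
      show "?D (fst p) ((j, 0), 0) + (\<Sum>i\<in>Basis. (snd p \<bullet> i) *\<^sub>R ?D (fst p) (0, i)) =
          (case p of (t, y) \<Rightarrow> ?D t ((j, 0), y))"
        by (simp only: split_beta)
    qed
  qed
  show "norm (?D t ((j, 0), u) - ?D t ((j, 0), v)) \<le> L * norm (u - v)" if "t \<in> {-S..S}" for t u v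
  proof -
    have "?D t ((j, 0), u) - ?D t ((j, 0), v) = ?D t (0, u - v)"
      using linear_diff[OF lin[OF that], of "((j, 0), u)" "((j, 0), v)"]
      by (simp add: zero_prod_def)
    moreover have "G differentiable (at ((x, t), z (x, t)))"
      using D[OF that] differentiable_def by blast
    ultimately show ?thesis
      using frechet_derivative_fibre_bound[of x t "z (x, t)" "u - v"] that I assms(2) z_in by auto
  qed
  show "L * S \<le> 1 / 2"
    using short mult_left_mono[of S T L] L_nonneg \<open>S < T\<close> by linarith
qed (use assms L_nonneg in auto)

text \<open>The candidate derivative combines the solutions \<open>w j\<close> of the variational
  equation. Subtracting it from \<open>z (y, t) - z (x, t)\<close> leaves a remainder that starts at
  0 and whose derivative is bounded by \<open>L\<close> times the remainder plus the linearization
  error of \<open>G\<close>. That error is small relative to \<open>norm (y - x)\<close> once the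
  solutions are known to be Lipschitz in the parameter.\<close>

lemma has_derivative_parameter:
  assumes G: "k_differentiable_on (Suc 0) (Base \<times> Z) G" and x: "x \<in> X" and "0 < S" "S < T"
    and w0: "\<And>j. j \<in> Basis \<Longrightarrow> w j 0 = 0"
    and w: "\<And>j t. j \<in> Basis \<Longrightarrow> t \<in> {-S..S} \<Longrightarrow> (w j has_vector_derivative
      frechet_derivative G (at ((x, t), z (x, t))) ((j, 0), w j t)) (at t within {-S..S})"
    and t: "t \<in> {-S..S}"
  shows "((\<lambda>y. z (y, t)) has_derivative (\<lambda>h. \<Sum>j\<in>Basis. (h \<bullet> j) *\<^sub>R w j t)) (at x)"
proof -
  let ?p = "\<lambda>t. ((x, t), z (x, t))"
  let ?D = "\<lambda>p. frechet_derivative G (at p)"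
  have I: "{-S..S} \<subseteq> {-T<..<T}" using assms by auto
  have in\<Omega>: "?p t \<in> Base \<times> Z" if "t \<in> {-S..S}" for t
    using that I x z_in by auto
  note D = k_differentiable_on_SucD(1)[OF G in\<Omega>]
  have lin: "linear (?D (?p t))" if "t \<in> {-S..S}" for t
    using D[OF that] has_derivative_linear by blast
  define K where "K = ?p ` {-S..S}"
  have K: "compact K" "K \<subseteq> Base \<times> Z"
    unfolding K_def using in\<Omega>
    by (auto intro!: compact_continuous_image continuous_intros continuous_z_time[OF x I])
  have LS: "L * S \<le> 1 / 2"
    using short mult_left_mono[of S T L] L_nonneg \<open>S < T\<close> by linarith
  obtain M where M: "\<And>p. p \<in> K \<Longrightarrow> (\<Sum>j\<in>Basis. norm (?D p ((j, 0), 0))) \<le> M"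
  proof -
    have "continuous_on K (\<lambda>p. \<Sum>j\<in>(Basis :: 'x set). norm (?D p ((j, 0), 0)))"
      using k_differentiable_on_SucD(2)[OF G] K(2)
      by (intro continuous_intros) (auto intro: continuous_on_subset)
    then have "compact ((\<lambda>p. \<Sum>j\<in>(Basis :: 'x set). norm (?D p ((j, 0), 0))) ` K)"
      using K(1) by (rule compact_continuous_image)
    then obtain M where "\<forall>y\<in>(\<lambda>p. \<Sum>j\<in>(Basis :: 'x set). norm (?D p ((j, 0), 0))) ` K. norm y \<le> M"
      using compact_imp_bounded bounded_iff by metis
    then show thesis by (intro that[of M]) (auto dest: abs_le_D1)
  qed
  have "?p t \<in> K" using t by (auto simp: K_def)
  from M[OF this] have "0 \<le> M" by (rule order_trans[rotated]) (simp add: sum_nonneg)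
  have DM: "norm (?D (?p t) ((h, 0), 0)) \<le> M * norm h" if "t \<in> {-S..S}" for t h
  proof -
    have "((h, 0), 0) = (\<Sum>j\<in>Basis. (h \<bullet> j) *\<^sub>R ((j, 0), 0))"
      by (intro prod_eqI) (simp_all add: fst_sum snd_sum euclidean_representation)
    then have "?D (?p t) ((h, 0), 0) = ?D (?p t) (\<Sum>j\<in>Basis. (h \<bullet> j) *\<^sub>R ((j, 0), 0))"
      by (rule arg_cong)
    then have "norm (?D (?p t) ((h, 0), 0)) = norm (\<Sum>j\<in>Basis. (h \<bullet> j) *\<^sub>R ?D (?p t) ((j, 0), 0))"
      by (simp only: linear_sum[OF lin[OF that]] linear_scale[OF lin[OF that]])
    also have "\<dots> \<le> (\<Sum>j\<in>Basis. norm (?D (?p t) ((j, 0), 0)) * norm h)"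
    proof (rule sum_norm_le)
      fix j :: 'x assume "j \<in> Basis"
      then show "norm ((h \<bullet> j) *\<^sub>R ?D (?p t) ((j, 0), 0)) \<le> norm (?D (?p t) ((j, 0), 0)) * norm h"
        using mult_left_mono[OF Basis_le_norm[of j h], of "norm (?D (?p t) ((j, 0), 0))"]
        by (simp add: mult.commute)
    qed
    also have "\<dots> \<le> M * norm h"
      using M[of "?p t"] that by (auto simp: K_def sum_distrib_right[symmetric] intro!: mult_right_mono)
    finally show ?thesis .
  qed
  obtain r where r: "0 < r" "ball x r \<subseteq> X" using openX x openE by blast
  obtain d1 where d1: "0 < d1" "\<And>p q. p \<in> K \<Longrightarrow> norm (q - p) < d1 \<Longrightarrow>
      norm (G q - G p - ?D p (q - p)) \<le> 1 * norm (q - p)"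
    using k_differentiable_on_uniform_linearization[OF open_Base_Z K G zero_less_one] by metis
  \<comment> \<open>This will be a Lipschitz constant of the solutions in the parameter:
    \<open>M\<close> bounds the parameter derivative of \<open>G\<close> along the trajectory, and
    the summand 1 is the tolerance of the linearization with radius \<open>d1\<close>.\<close>
  define C where "C = 2 * S * (M + 1)"
  have "0 \<le> C" using \<open>0 < S\<close> \<open>0 \<le> M\<close> by (simp add: C_def)
  have lipx: "norm (z (y, t) - z (x, t)) \<le> C * norm (y - x)"
    if y: "norm (y - x) < min r d1" and t: "t \<in> {-S..S}" for y t
  proof -
    have "norm (z (y, t) - z (x, t)) \<le> 2 * S * ((M + 1) * norm (y - x))"
    proof (rule compare)
      show "y \<in> X" using y r by (auto simp: dist_norm norm_minus_commute)
      fix t assume t: "t \<in> {-S..S}"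
      have q: "((y, t), z (x, t)) - ?p t = ((y - x, 0), 0)" by simp
      have "norm (G ((y, t), z (x, t)) - G (?p t) - ?D (?p t) ((y - x, 0), 0)) \<le> norm (y - x)"
        using d1(2)[of "?p t" "((y, t), z (x, t))"] t y unfolding q by (simp add: K_def)
      then show "norm (G ((y, t), z (x, t)) - G (?p t)) \<le> (M + 1) * norm (y - x)"
        using DM[OF t, of "y - x"] norm_triangle_ineq[of
          "G ((y, t), z (x, t)) - G (?p t) - ?D (?p t) ((y - x, 0), 0)" "?D (?p t) ((y - x, 0), 0)"]
        by (simp add: algebra_simps)
    qed (use assms t in auto)
    then show ?thesis by (simp add: C_def algebra_simps)
  qed
  let ?W = "\<lambda>h t. \<Sum>j\<in>Basis. (h \<bullet> j) *\<^sub>R w j t"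
  have W: "(?W h has_vector_derivative ?D (?p t) ((h, 0), ?W h t)) (at t within {-S..S})"
    if t: "t \<in> {-S..S}" for t h
  proof -
    have "((h, 0), ?W h t) = (\<Sum>j\<in>Basis. (h \<bullet> j) *\<^sub>R ((j, 0), w j t))"
      by (intro prod_eqI) (simp_all add: fst_sum snd_sum euclidean_representation)
    then have "?D (?p t) ((h, 0), ?W h t) = ?D (?p t) (\<Sum>j\<in>Basis. (h \<bullet> j) *\<^sub>R ((j, 0), w j t))"
      by (rule arg_cong)
    then have "?D (?p t) ((h, 0), ?W h t) = (\<Sum>j\<in>Basis. (h \<bullet> j) *\<^sub>R ?D (?p t) ((j, 0), w j t))"
      by (simp only: linear_sum[OF lin[OF t]] linear_scale[OF lin[OF t]])
    moreover have "(?W h has_vector_derivative (\<Sum>j\<in>Basis. (h \<bullet> j) *\<^sub>R ?D (?p t) ((j, 0), w j t)))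
        (at t within {-S..S})"
      using w t
      by (intro has_vector_derivative_sum
          bounded_linear.has_vector_derivative[OF bounded_linear_scaleR_right]) auto
    ultimately show ?thesis by simp
  qed
  show ?thesis
    unfolding has_derivative_at_alt
  proof (intro conjI allI impI)
    show "bounded_linear (\<lambda>h. ?W h t)" by (auto intro!: bounded_linear_intros)
    fix e :: real assume "0 < e"
    \<comment> \<open>\<open>1 + C\<close> bounds the displacement of the point
      \<open>((y, t), z (y, t))\<close> relative to \<open>norm (y - x)\<close>, and
      \<open>2 * S\<close> is the factor lost in \<open>short_time_bound\<close>.\<close>
    define e' where "e' = e / (2 * S * (1 + C))"
    have e': "0 < e'" "2 * S * (e' * (1 + C)) = e"
      using \<open>0 < e\<close> \<open>0 < S\<close> \<open>0 \<le> C\<close> by (auto simp: e'_def)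
    obtain d where d: "0 < d" "\<And>p q. p \<in> K \<Longrightarrow> norm (q - p) < d \<Longrightarrow>
        norm (G q - G p - ?D p (q - p)) \<le> e' * norm (q - p)"
      using k_differentiable_on_uniform_linearization[OF open_Base_Z K G e'(1)] by metis
    define d' where "d' = min (min r d1) (d / (1 + C))"
    show "\<exists>d>0. \<forall>y. norm (y - x) < d \<longrightarrow>
        norm (z (y, t) - z (x, t) - ?W (y - x) t) \<le> e * norm (y - x)"
    proof (intro exI[of _ d'] conjI allI impI)
      show "0 < d'" using r d1 d \<open>0 \<le> C\<close> by (simp add: d'_def)
      fix y assume y: "norm (y - x) < d'"
      let ?h = "y - x"
      have yX: "y \<in> X" using y r by (auto simp: d'_def dist_norm norm_minus_commute)
      have "norm (z (y, t) - z (x, t) - ?W ?h t) \<le> 2 * S * (e' * ((1 + C) * norm ?h))"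
      proof (rule short_time_bound[where I = "{-S..S}" and L = L and s = 0 and
            f' = "\<lambda>t. G ((y, t), z (y, t)) - G (?p t) - ?D (?p t) ((?h, 0), ?W ?h t)"])
        fix t assume t: "t \<in> {-S..S}"
        then have tT: "t \<in> {-T<..<T}" using I by auto
        show "((\<lambda>t. z (y, t) - z (x, t) - ?W ?h t) has_vector_derivative
            G ((y, t), z (y, t)) - G (?p t) - ?D (?p t) ((?h, 0), ?W ?h t)) (at t within {-S..S})"
          by (intro has_vector_derivative_diff z_ode_within W x yX t tT)
        let ?q = "((y, t), z (y, t))"
        have q: "?q - ?p t = ((?h, 0), z (y, t) - z (x, t))" by simp
        have "norm (?q - ?p t) \<le> norm ?h + norm (z (y, t) - z (x, t))"
          unfolding q using norm_Pair_le[of "(?h, 0::real)" "z (y, t) - z (x, t)"] by (simp add: norm_Pair)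
        also have "\<dots> \<le> (1 + C) * norm ?h"
          using lipx[of y t] y t by (simp add: d'_def algebra_simps)
        finally have nq: "norm (?q - ?p t) \<le> (1 + C) * norm ?h" .
        also have "\<dots> < d" using y \<open>0 \<le> C\<close> by (simp add: d'_def field_simps)
        finally have "norm (G ?q - G (?p t) - ?D (?p t) (?q - ?p t)) \<le> e' * norm (?q - ?p t)"
          using d(2)[of "?p t" ?q] t by (simp add: K_def)
        also have "\<dots> \<le> e' * ((1 + C) * norm ?h)" using nq e' by (intro mult_left_mono) auto
        finally have R: "norm (G ?q - G (?p t) - ?D (?p t) (?q - ?p t)) \<le> e' * ((1 + C) * norm ?h)" .
        let ?f = "z (y, t) - z (x, t) - ?W ?h t"
        have "?D (?p t) (?q - ?p t) = ?D (?p t) ((?h, 0), ?W ?h t) + ?D (?p t) (0, ?f)"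
          unfolding q by (simp add: linear_add[OF lin[OF t], symmetric] zero_prod_def)
        then have eq: "G ?q - G (?p t) - ?D (?p t) ((?h, 0), ?W ?h t) =
            (G ?q - G (?p t) - ?D (?p t) (?q - ?p t)) + ?D (?p t) (0, ?f)" by simp
        have b: "norm (?D (?p t) (0, ?f)) \<le> L * norm ?f"
          using D[OF t] tT x z_in
          by (intro frechet_derivative_fibre_bound) (auto simp: differentiable_def)
        show "norm (G ?q - G (?p t) - ?D (?p t) ((?h, 0), ?W ?h t)) \<le>
            L * norm ?f + e' * ((1 + C) * norm ?h)"
          by (subst eq) (use norm_triangle_mono[OF R b] in linarith)
      next
        show "z (y, 0) - z (x, 0) - ?W ?h 0 = 0"
          using w0 z_init x yX by (simp add: sum.neutral)
      qed (use \<open>0 < S\<close> LS L_nonneg t in auto)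
      also have "\<dots> = e * norm ?h" using e'(2) by (metis mult.assoc)
      finally show "norm (z (y, t) - z (x, t) - ?W ?h t) \<le> e * norm ?h" .
    qed
  qed
qed

text \<open>Joint differentiability follows from the two partial derivatives once one of them is
  continuous; the time derivative is, being \<open>G (p, z p)\<close> with \<open>z\<close> already
  continuous.\<close>

lemma has_derivative_z:
  assumes G: "k_differentiable_on (Suc 0) (Base \<times> Z) G" and "0 < S" "S < T"
    and w0: "\<And>x j. x \<in> X \<Longrightarrow> j \<in> Basis \<Longrightarrow> w x j 0 = 0"
    and w: "\<And>x j t. x \<in> X \<Longrightarrow> j \<in> Basis \<Longrightarrow> t \<in> {-S..S} \<Longrightarrow> (w x j has_vector_derivative
      frechet_derivative G (at ((x, t), z (x, t))) ((j, 0), w x j t)) (at t within {-S..S})"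
    and x: "x \<in> X" and t: "t \<in> {-S<..<S}"
  shows "(z has_derivative (\<lambda>(h, \<tau>). (\<Sum>j\<in>Basis. (h \<bullet> j) *\<^sub>R w x j t) + \<tau> *\<^sub>R G ((x, t), z (x, t))))
    (at (x, t))"
proof -
  have contG: "continuous_on (Base \<times> Z) G"
    using k_differentiable_on_Suc_imp[OF G] by simp
  have "continuous_on Base (\<lambda>p. G (p, z p))"
    using z_in by (intro continuous_on_compose2[OF contG] continuous_intros continuous_z[OF contG]) auto
  then have c: "continuous_on Base (\<lambda>p. blinfun_scaleR_left (G (p, z p)))"
    by (intro bounded_linear.continuous_on[OF bounded_linear_blinfun_scaleR_left])
  have "((\<lambda>(x, t). z (x, t)) has_derivative
      (\<lambda>(h, \<tau>). (\<Sum>j\<in>Basis. (h \<bullet> j) *\<^sub>R w x j t) + blinfun_apply (blinfun_scaleR_left (G ((x, t), z (x, t)))) \<tau>))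
      (at (x, t) within X \<times> {-S<..<S})"
  proof (rule has_derivative_partialsI[where f = "\<lambda>x t. z (x, t)" and
        fy = "\<lambda>x t. blinfun_scaleR_left (G ((x, t), z (x, t)))"])
    have "t \<in> {-S..S}" using t by auto
    then show "((\<lambda>x. z (x, t)) has_derivative (\<lambda>h. \<Sum>j\<in>Basis. (h \<bullet> j) *\<^sub>R w x j t)) (at x within X)"
      using has_derivative_parameter[OF G x \<open>0 < S\<close> \<open>S < T\<close> w0[OF x] w[OF x]]
      by (blast intro: has_derivative_at_withinI)
    show "((\<lambda>t. z (y, t)) has_derivative blinfun_apply (blinfun_scaleR_left (G ((y, s), z (y, s)))))
        (at s within {-S<..<S})" if "y \<in> X" "s \<in> {-S<..<S}" for y s
      using z_ode_within[OF that(1), of s "{-S<..<S}"] that(2) \<open>S < T\<close>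
      by (simp add: has_vector_derivative_def)
    have "continuous_on (X \<times> {-S<..<S}) (\<lambda>p. blinfun_scaleR_left (G (p, z p)))"
      using c \<open>S < T\<close> by (elim continuous_on_subset) auto
    then show "continuous (at (x, t) within X \<times> {-S<..<S})
        (\<lambda>(x, t). blinfun_scaleR_left (G ((x, t), z (x, t))))"
      using x t unfolding continuous_on_eq_continuous_within by (simp add: case_prod_unfold)
  qed (use t in auto)
  moreover have "at (x, t) within X \<times> {-S<..<S} = at (x, t)"
    using x t openX by (intro at_within_open) (auto intro!: open_Times)
  ultimately show ?thesis by (simp add: split_beta)
qed

end

text \<open>A derivative of \<open>z\<close> with respect to the parameter solves the variational equation, which is again
  a family over the same spaces; the vector field of that family is one degree less smooth.\<close>

lemma ode_family_k_differentiable: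
  assumes "ode_family X T L Z G z" "k_differentiable_on k ((X \<times> {-T<..<T}) \<times> Z) G"
  shows "k_differentiable_on k (X \<times> {-T<..<T}) z"
  using assms
proof (induction k arbitrary: T Z G z)
  case 0
  interpret ode_family X T L Z G z by (rule 0)
  show ?case using continuous_z 0(2) by simp
next
  case (Suc k)
  interpret ode_family X T L Z G z by (rule Suc.prems)
  have Gk: "k_differentiable_on k (Base \<times> Z) G"
    using Suc.prems(2) by (rule k_differentiable_on_Suc_imp)
  \<comment> \<open>First use of the induction hypothesis: the coefficients of the variational
    equation are evaluated at \<open>z\<close>, so \<open>z\<close> itself must already be
    \<open>k\<close> times differentiable.\<close>
  have zk: "k_differentiable_on k Base z"
    by (rule Suc.IH[OF Suc.prems(1) Gk])
  have G1: "k_differentiable_on (Suc 0) (Base \<times> Z) G"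
  proof -
    have "k_differentiable_on j (Base \<times> Z) f" if "k_differentiable_on m (Base \<times> Z) f" "j \<le> m"
      for j m and f :: "('a \<times> real) \<times> 'b \<Rightarrow> 'b"
      using that(2,1) by (induction rule: inc_induct) (auto intro: k_differentiable_on_Suc_imp)
    then show ?thesis using Suc.prems(2) by blast
  qed
  show ?case
  proof (rule k_differentiable_on_local)
    fix p assume p: "p \<in> Base"
    obtain x0 t0 where p_eq: "p = (x0, t0)" "x0 \<in> X" "\<bar>t0\<bar> < T" using p by (cases p) (auto simp: abs_less_iff)
    obtain S where S: "\<bar>t0\<bar> < S" "S < T" using dense[OF p_eq(3)] by auto
    then have "0 < S" by auto
    let ?D = "\<lambda>p. frechet_derivative G (at p)"
    have "\<forall>x j. \<exists>w. x \<in> X \<longrightarrow> w 0 = 0 \<and> (\<forall>t\<in>{-S..S}. (w has_vector_derivative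
        ?D ((x, t), z (x, t)) ((j, 0), w t)) (at t within {-S..S}))"
      using variational_equation_solvable[OF G1 _ \<open>0 < S\<close> \<open>S < T\<close>] by blast
    then obtain w where w0: "\<And>x j. x \<in> X \<Longrightarrow> w x j 0 = 0"
      and w: "\<And>x j t. x \<in> X \<Longrightarrow> t \<in> {-S..S} \<Longrightarrow> (w x j has_vector_derivative
        ?D ((x, t), z (x, t)) ((j, 0), w x j t)) (at t within {-S..S})"
      by metis
    let ?B = "X \<times> {-S<..<S}"
    have B: "open ?B" "?B \<subseteq> Base" using openX \<open>S < T\<close> by (auto intro!: open_Times)
    have zB: "k_differentiable_on k ?B z" using zk B(2) by (rule k_differentiable_on_subset)
    have in\<Omega>: "((x, t), z (x, t)) \<in> Base \<times> Z" if "x \<in> X" "t \<in> {-S<..<S}" for x t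
      using that z_in \<open>S < T\<close> by auto
    have D: "(G has_derivative ?D ((x, t), z (x, t))) (at ((x, t), z (x, t)))"
      if "x \<in> X" "t \<in> {-S<..<S}" for x t
      using k_differentiable_on_SucD(1)[OF G1 in\<Omega>[OF that]] .
    have DB: "k_differentiable_on k ?B (\<lambda>p. ?D (p, z p) v)" for v
      by (rule k_differentiable_on_compose[OF B(1) open_Base_Z _
            k_differentiable_on_SucD(2)[OF Suc.prems(2)]
            k_differentiable_on_Pair[OF B(1) k_differentiable_on_linear[OF B(1) bounded_linear_ident] zB]])
        (use in\<Omega> in auto)
    \<comment> \<open>Second use, for the family \<open>w\<close> with fibre \<open>UNIV\<close> and
      time bound \<open>S\<close>; this is why the induction generalises over time, fibre and field.
      The field \<open>?H\<close> contains a derivative of \<open>G\<close>, which costs one degree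
      of differentiability.\<close>
    have wk: "k_differentiable_on k ?B (\<lambda>p. w (fst p) j (snd p))" for j
    proof (rule Suc.IH)
      let ?H = "\<lambda>q. ?D (fst q, z (fst q)) ((j, 0), snd q)"
      show "ode_family X S L UNIV ?H (\<lambda>p. w (fst p) j (snd p))"
      proof
        show "L * S \<le> 1 / 2"
          using short mult_left_mono[of S T L] L_nonneg \<open>S < T\<close> by linarith
        fix x t assume x: "x \<in> X" and t: "t \<in> {-S<..<S}"
        show "norm (?H ((x, t), u) - ?H ((x, t), v)) \<le> L * norm (u - v)" for u v
        proof -
          have lin: "linear (?D ((x, t), z (x, t)))" using D[OF x t] has_derivative_linear by blast
          have "?H ((x, t), u) - ?H ((x, t), v) = ?D ((x, t), z (x, t)) (0, u - v)"
            using linear_diff[OF lin, of "((j, 0), u)" "((j, 0), v)"] by (simp add: zero_prod_def)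
          then show ?thesis
            using frechet_derivative_fibre_bound[of x t "z (x, t)" "u - v"] D[OF x t] in\<Omega>[OF x t]
            by (auto simp: differentiable_def)
        qed
        have "at t within {-S..S} = at t"
          using t by (intro at_within_interior) (simp add: interior_atLeastAtMost_real)
        then show "((\<lambda>s. w (fst (x, s)) j (snd (x, s))) has_vector_derivative
            ?H ((x, t), w (fst (x, t)) j (snd (x, t)))) (at t)"
          using w[OF x, of t j] t by simp
      qed (use openX \<open>0 < S\<close> L_nonneg w0 in auto)
      have \<Omega>: "open (?B \<times> (UNIV :: 'b set))" by (rule open_Times[OF B(1) open_UNIV])
      have fstB: "k_differentiable_on k (?B \<times> (UNIV :: 'b set)) (\<lambda>q. ?D (fst q, z (fst q)) v)" for v
        by (rule k_differentiable_on_compose[OF \<Omega> B(1) _ DB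
              k_differentiable_on_linear[OF \<Omega> bounded_linear_fst]]) auto
      have "k_differentiable_on k (?B \<times> UNIV) (\<lambda>q. ?D (fst q, z (fst q)) ((j, 0), 0) +
          (\<Sum>i\<in>Basis. (snd q \<bullet> i) *\<^sub>R ?D (fst q, z (fst q)) ((0, 0), i)))"
        by (intro k_differentiable_on_add[OF \<Omega>] k_differentiable_on_sum[OF \<Omega>] fstB
            k_differentiable_on_bilinear[OF \<Omega> bounded_bilinear_scaleR]
            k_differentiable_on_linear[OF \<Omega>] bounded_linear_inner_left_comp bounded_linear_snd)
      then show "k_differentiable_on k (?B \<times> UNIV) ?H"
      proof (rule k_differentiable_on_cong[OF \<Omega>, rotated])
        fix q assume q: "q \<in> ?B \<times> (UNIV :: 'b set)"
        obtain x t y where q_eq: "q = ((x, t), y)" by (metis surj_pair)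
        then have lin: "linear (?D ((x, t), z (x, t)))"
          using q D[of x t] has_derivative_linear by blast
        have "((j, 0), y) = ((j, 0), 0) + (\<Sum>i\<in>Basis. (y \<bullet> i) *\<^sub>R ((0, 0), i))"
          by (intro prod_eqI) (simp_all add: fst_sum snd_sum euclidean_representation zero_prod_def)
        then have "?D ((x, t), z (x, t)) ((j, 0), y) =
            ?D ((x, t), z (x, t)) (((j, 0), 0) + (\<Sum>i\<in>Basis. (y \<bullet> i) *\<^sub>R ((0, 0), i)))"
          by (rule arg_cong)
        then show "?D (fst q, z (fst q)) ((j, 0), 0) +
          (\<Sum>i\<in>Basis. (snd q \<bullet> i) *\<^sub>R ?D (fst q, z (fst q)) ((0, 0), i)) = ?H q"
          by (simp only: q_eq fst_conv snd_conv linear_add[OF lin] linear_sum[OF lin] linear_scale[OF lin])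
      qed
    qed
    have GB: "k_differentiable_on k ?B (\<lambda>p. G (p, z p))"
      by (rule k_differentiable_on_compose[OF B(1) open_Base_Z _ Gk
            k_differentiable_on_Pair[OF B(1) k_differentiable_on_linear[OF B(1) bounded_linear_ident] zB]])
        (use in\<Omega> in auto)
    have "k_differentiable_on (Suc k) ?B z"
    proof (rule k_differentiable_on_SucI[OF B(1)])
      fix p assume "p \<in> ?B"
      then show "(z has_derivative (\<lambda>v. (\<Sum>j\<in>Basis. (fst v \<bullet> j) *\<^sub>R w (fst p) j (snd p)) +
          snd v *\<^sub>R G (p, z p))) (at p)"
        using has_derivative_z[OF G1 \<open>0 < S\<close> \<open>S < T\<close> w0 w, of "fst p" "snd p"]
        by (auto simp: case_prod_unfold)
    next
      fix v
      show "k_differentiable_on k ?B (\<lambda>p. (\<Sum>j\<in>Basis. (fst v \<bullet> j) *\<^sub>R w (fst p) j (snd p)) +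
          snd v *\<^sub>R G (p, z p))"
        by (intro k_differentiable_on_add[OF B(1)] k_differentiable_on_sum[OF B(1)]
            k_differentiable_on_compose_linear[OF B(1) bounded_linear_scaleR_right] wk GB)
    qed
    then show "\<exists>T. open T \<and> p \<in> T \<and> k_differentiable_on (Suc k) T z"
      using B(1) p_eq S by (intro exI[of _ ?B]) (auto simp: abs_less_iff)
  qed
qed

subsection \<open>The flow of a smooth vector field\<close>

lemma smooth_on_locally_lipschitz:
  fixes f :: "'a::euclidean_space \<Rightarrow> 'b::real_normed_vector"
  assumes "open U" "smooth_on U f" "p \<in> U"
  obtains r L where "0 < r" "0 \<le> L" "cball p r \<subseteq> U"
    "\<And>x y. x \<in> cball p r \<Longrightarrow> y \<in> cball p r \<Longrightarrow> norm (f x - f y) \<le> L * norm (x - y)"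
proof -
  let ?D = "\<lambda>p. frechet_derivative f (at p)"
  obtain r where r: "0 < r" "cball p r \<subseteq> U" using assms open_contains_cball by blast
  have "continuous_on U (\<lambda>x. \<Sum>i\<in>(Basis :: 'a set). norm (?D x i))"
    by (intro continuous_on_sum continuous_on_norm smooth_on_imp_continuous_on
        smooth_on_frechet_derivative[OF assms(2)])
  then have "continuous_on (cball p r) (\<lambda>x. \<Sum>i\<in>(Basis :: 'a set). norm (?D x i))"
    using r(2) by (rule continuous_on_subset)
  then have "bounded ((\<lambda>x. \<Sum>i\<in>(Basis :: 'a set). norm (?D x i)) ` cball p r)"
    by (intro compact_imp_bounded compact_continuous_image compact_cball)
  then obtain L where L: "\<forall>x\<in>cball p r. norm (\<Sum>i\<in>(Basis :: 'a set). norm (?D x i)) \<le> L"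
    unfolding bounded_iff by blast
  have D: "(f has_derivative ?D x) (at x)" if "x \<in> cball p r" for x
    using smooth_on_imp_has_derivative[OF assms(2)] that r(2) by blast
  have on: "onorm (?D x) \<le> L" if x: "x \<in> cball p r" for x
  proof (rule onorm_le)
    fix h
    have lin: "linear (?D x)" using D[OF x] has_derivative_linear by blast
    have "?D x h = (\<Sum>i\<in>Basis. (h \<bullet> i) *\<^sub>R ?D x i)"
      by (subst euclidean_representation[symmetric, of h])
        (simp only: linear_sum[OF lin] linear_scale[OF lin])
    also have "norm \<dots> \<le> (\<Sum>i\<in>Basis. norm (?D x i) * norm h)"
    proof (rule sum_norm_le)
      fix i :: 'a assume "i \<in> Basis"
      then show "norm ((h \<bullet> i) *\<^sub>R ?D x i) \<le> norm (?D x i) * norm h"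
        using mult_left_mono[OF Basis_le_norm[of i h], of "norm (?D x i)"]
        by (simp add: mult.commute)
    qed
    also have "\<dots> \<le> L * norm h"
    proof -
      have "(\<Sum>i\<in>(Basis :: 'a set). norm (?D x i)) \<le> L"
        using bspec[OF L x] unfolding real_norm_def by (rule abs_le_D1)
      then show ?thesis unfolding sum_distrib_right[symmetric] by (rule mult_right_mono) simp
    qed
    finally show "norm (?D x h) \<le> L * norm h" .
  qed
  have "0 \<le> L" using on[of p] onorm_pos_le[of "?D p"] D[of p] r(1)
    by (auto dest: has_derivative_bounded_linear)
  show thesis
  proof (rule that[OF r(1) \<open>0 \<le> L\<close> r(2)])
    fix x y assume "x \<in> cball p r" "y \<in> cball p r"
    then show "norm (f x - f y) \<le> L * norm (x - y)"
      using differentiable_bound[OF convex_cball, of p r f ?D L x y] D on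
      by (auto intro: has_derivative_at_withinI)
  qed
qed

text \<open>\<open>solution\<close>, \<open>flow_dom\<close> and \<open>flow_map\<close> repeat
  \<open>integral_curve\<close>, \<open>flow_domain\<close> and \<open>flow\<close> for a field on a
  subset of a normed space, so that the flow on \<open>M\<close> can be studied in coordinates by
  ordinary calculus.\<close>

definition solution :: "'a::real_normed_vector set \<Rightarrow> ('a \<Rightarrow> 'a) \<Rightarrow> real set \<Rightarrow> (real \<Rightarrow> 'a) \<Rightarrow> bool" where
  "solution U v I c \<longleftrightarrow> (\<forall>t\<in>I. c t \<in> U \<and> (c has_vector_derivative v (c t)) (at t within I))"

definition flow_dom :: "'a::real_normed_vector set \<Rightarrow> ('a \<Rightarrow> 'a) \<Rightarrow> real \<Rightarrow> 'a set" where
  "flow_dom U v t = {p. \<exists>c. c 0 = p \<and> solution U v (closed_segment 0 t) c}"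

definition flow_map :: "'a::real_normed_vector set \<Rightarrow> ('a \<Rightarrow> 'a) \<Rightarrow> real \<Rightarrow> 'a \<Rightarrow> 'a" where
  "flow_map U v t p = (THE q. \<exists>c. c 0 = p \<and> c t = q \<and> solution U v (closed_segment 0 t) c)"

lemma solution_subset: "solution U v I c \<Longrightarrow> J \<subseteq> I \<Longrightarrow> solution U v J c"
  unfolding solution_def using has_vector_derivative_within_subset by blast

lemma solution_mono: "solution U v I c \<Longrightarrow> U \<subseteq> U' \<Longrightarrow> solution U' v I c"
  unfolding solution_def by blast

lemma solution_cong:
  assumes "solution U v I c" "\<And>t. t \<in> I \<Longrightarrow> d t = c t"
  shows "solution U v I d"
  unfolding solution_def
proof (intro ballI conjI)
  fix t assume t: "t \<in> I"
  then show "d t \<in> U" using assms by (simp add: solution_def)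
  have "(c has_vector_derivative v (d t)) (at t within I)"
    using assms t by (simp add: solution_def)
  then show "(d has_vector_derivative v (d t)) (at t within I)"
    using has_vector_derivative_transform[OF t, of d c] assms(2) by blast
qed

lemma solution_continuous_on: "solution U v I c \<Longrightarrow> continuous_on I c"
  unfolding solution_def by (intro continuous_on_vector_derivative) blast

lemma solution_shift:
  assumes "solution U v I c" "(\<lambda>u. u + a) ` J \<subseteq> I"
  shows "solution U v J (\<lambda>u. c (u + a))"
  unfolding solution_def
proof (intro ballI conjI)
  fix t assume "t \<in> J"
  then have t: "t + a \<in> I" using assms(2) by auto
  then show "c (t + a) \<in> U" using assms(1) by (simp add: solution_def)
  have "(c has_vector_derivative v (c (t + a))) (at (t + a) within (\<lambda>u. u + a) ` J)"
    using assms t unfolding solution_def using has_vector_derivative_within_subset by blast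
  moreover have "((\<lambda>u. u + a) has_vector_derivative 1) (at t within J)"
    by (auto intro!: derivative_eq_intros)
  ultimately show "((\<lambda>u. c (u + a)) has_vector_derivative v (c (t + a))) (at t within J)"
    using vector_diff_chain_within by (fastforce simp: o_def)
qed

text \<open>The sign condition makes both times run in the same direction, so the two segments meet
  only at \<open>s\<close> and together form the segment from 0 to
  \<open>s + \<tau>\<close>.\<close>

lemma solution_glue:
  assumes c1: "solution U v (closed_segment 0 s) c1" and c2: "solution U v (closed_segment 0 \<tau>) c2"
    and "c2 0 = c1 s" "0 \<le> s * \<tau>"
  obtains c where "c 0 = c1 0" "c (s + \<tau>) = c2 \<tau>" "solution U v (closed_segment 0 (s + \<tau>)) c"
proof -
  let ?S = "closed_segment 0 s" and ?T = "closed_segment s (s + \<tau>)"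
  define c where "c u = (if u \<in> ?S then c1 u else c2 (u - s))" for u
  have un: "closed_segment 0 (s + \<tau>) = ?S \<union> ?T" and int: "?S \<inter> ?T = {s}"
    using \<open>0 \<le> s * \<tau>\<close> by (auto simp: closed_segment_eq_real_ivl zero_le_mult_iff split: if_splits)
  have c2': "solution U v ?T (\<lambda>u. c2 (u - s))"
    using solution_shift[OF c2, of "-s" ?T] by (auto simp: closed_segment_eq_real_ivl split: if_splits)
  have clos: "?S \<union> closure ?S \<inter> closure ?T = ?S" "?T \<union> closure ?S \<inter> closure ?T = ?T"
    using int by auto
  have der: "(c has_vector_derivative (if u \<in> ?S then v (c1 u) else v (c2 (u - s)))) (at u within ?S \<union> ?T)"
    if "u \<in> ?S \<union> ?T" for u
    unfolding c_def
  proof (rule has_vector_derivative_If_within_closures[OF that refl])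
    assume "u \<in> ?S \<union> closure ?S \<inter> closure ?T"
    then show "(c1 has_vector_derivative v (c1 u)) (at u within ?S \<union> closure ?S \<inter> closure ?T)"
      using c1 unfolding clos solution_def by blast
  next
    assume "u \<in> ?T \<union> closure ?S \<inter> closure ?T"
    then show "((\<lambda>u. c2 (u - s)) has_vector_derivative v (c2 (u - s)))
        (at u within ?T \<union> closure ?S \<inter> closure ?T)"
      using c2' unfolding clos solution_def by blast
  next
    assume "u \<in> closure ?S" "u \<in> closure ?T"
    then have "u = s" using int by auto
    then show "c1 u = c2 (u - s)" "v (c1 u) = v (c2 (u - s))" using assms(3) by auto
  qed
  have "solution U v (closed_segment 0 (s + \<tau>)) c"
    unfolding un solution_def
  proof (intro ballI conjI)
    fix u assume u: "u \<in> ?S \<union> ?T"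
    then show "c u \<in> U" using c1 c2' by (auto simp: c_def solution_def)
    show "(c has_vector_derivative v (c u)) (at u within ?S \<union> ?T)"
      using der[OF u] by (simp add: c_def split: if_splits)
  qed
  moreover have "c (s + \<tau>) = c2 \<tau>"
  proof (cases "s + \<tau> \<in> ?S")
    case True
    then have "s + \<tau> \<in> ?S \<inter> ?T" by auto
    then have "s + \<tau> = s" unfolding int by simp
    then show ?thesis using assms(3) by (simp add: c_def)
  qed (simp add: c_def)
  moreover have "c 0 = c1 0" by (simp add: c_def)
  ultimately show thesis using that by blast
qed

locale smooth_field =
  fixes U :: "'a::euclidean_space set" and v :: "'a \<Rightarrow> 'a"
  assumes openU: "open U" and smooth: "smooth_on U v"
begin

abbreviation "fldom \<equiv> flow_dom U v"
abbreviation "fl \<equiv> flow_map U v"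

text \<open>The times of agreement form a subset that is open and closed in \<open>I\<close>:
  disagreement persists nearby by continuity, agreement by a local Lipschitz estimate over a short
  interval.\<close>

lemma solution_unique:
  assumes "solution U v I c1" "solution U v I c2" "convex I" "s \<in> I" "t \<in> I" "c1 s = c2 s"
  shows "c1 t = c2 t"
proof (rule connected_induction_simple[where P = "\<lambda>t. c1 t = c2 t", OF _ assms(4,5,6)])
  show "connected I" using assms(3) by (rule convex_connected)
  note c = solution_continuous_on[OF assms(1)] solution_continuous_on[OF assms(2)]
  fix a assume a: "a \<in> I"
  show "\<exists>T. openin (top_of_set I) T \<and> a \<in> T \<and> (\<forall>x\<in>T. \<forall>y\<in>T. c1 x = c2 x \<longrightarrow> c1 y = c2 y)"
  proof (cases "c1 a = c2 a")
    case False
    have "openin (top_of_set I) (I \<inter> (\<lambda>t. c1 t - c2 t) -` (- {0}))"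
      by (intro continuous_openin_preimage_gen continuous_intros c)
    then show ?thesis using a False by (intro exI[of _ "I \<inter> (\<lambda>t. c1 t - c2 t) -` (- {0})"]) auto
  next
    case True
    have "c1 a \<in> U" using assms(1) a by (simp add: solution_def)
    then obtain r L where r: "0 < r" "0 \<le> L" "cball (c1 a) r \<subseteq> U"
      "\<And>x y. x \<in> cball (c1 a) r \<Longrightarrow> y \<in> cball (c1 a) r \<Longrightarrow> norm (v x - v y) \<le> L * norm (x - y)"
      using smooth_on_locally_lipschitz[OF openU smooth] by metis
    obtain d1 where d1: "d1 > 0" "\<And>t. t \<in> I \<Longrightarrow> dist t a < d1 \<Longrightarrow> dist (c1 t) (c1 a) < r"
      using c(1) a r(1) unfolding continuous_on_iff by metis
    obtain d2 where d2: "d2 > 0" "\<And>t. t \<in> I \<Longrightarrow> dist t a < d2 \<Longrightarrow> dist (c2 t) (c2 a) < r"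
      using c(2) a r(1) unfolding continuous_on_iff by metis
    define \<tau> where "\<tau> = min (min d1 d2) (1 / (2 * (L + 1)))"
    have \<tau>: "0 < \<tau>" "L * \<tau> \<le> 1 / 2"
    proof -
      show "0 < \<tau>" using d1 d2 r by (simp add: \<tau>_def)
      have "L * \<tau> \<le> (L + 1) * (1 / (2 * (L + 1)))"
        using \<open>0 < \<tau>\<close> r(2) by (intro mult_mono) (auto simp: \<tau>_def)
      also have "\<dots> = 1 / 2" using r(2) by (simp add: field_simps)
      finally show "L * \<tau> \<le> 1 / 2" .
    qed
    let ?T = "I \<inter> ball a \<tau>"
    have "c1 t = c2 t" if t: "t \<in> ?T" for t
    proof -
      have "norm (c1 t - c2 t) \<le> 2 * \<tau> * 0"
      proof (rule short_time_bound[where I = ?T and f' = "\<lambda>t. v (c1 t) - v (c2 t)" and L = L and s = a])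
        fix u assume u: "u \<in> ?T"
        have "(c1 has_vector_derivative v (c1 u)) (at u within ?T)"
          "(c2 has_vector_derivative v (c2 u)) (at u within ?T)"
          using u assms(1,2) solution_subset[of U v I _ ?T] by (auto simp: solution_def)
        then show "((\<lambda>t. c1 t - c2 t) has_vector_derivative v (c1 u) - v (c2 u)) (at u within ?T)"
          by (rule has_vector_derivative_diff)
        show "norm (v (c1 u) - v (c2 u)) \<le> L * norm (c1 u - c2 u) + 0"
          using r(4)[of "c1 u" "c2 u"] d1(2)[of u] d2(2)[of u] u True
          by (auto simp: \<tau>_def dist_commute less_imp_le)
      qed (use assms(3) a True \<tau> r t in \<open>auto simp: convex_Int dist_real_def\<close>)
      then show ?thesis by simp
    qed
    moreover have "openin (top_of_set I) ?T" by (rule openin_open_Int) simp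
    ultimately show ?thesis using a \<tau> by (intro exI[of _ ?T]) auto
  qed
qed

lemma flow_map_eq:
  assumes "solution U v (closed_segment 0 t) c"
  shows "fl t (c 0) = c t" "c 0 \<in> fldom t"
proof -
  show "c 0 \<in> fldom t" using assms by (auto simp: flow_dom_def)
  show "fl t (c 0) = c t"
    unfolding flow_map_def
  proof (rule the_equality)
    fix q assume "\<exists>c'. c' 0 = c 0 \<and> c' t = q \<and> solution U v (closed_segment 0 t) c'"
    then show "q = c t"
      using solution_unique[OF _ assms convex_closed_segment, of _ 0 t] by auto
  qed (use assms in blast)
qed

lemma flow_domE:
  assumes "p \<in> fldom t"
  obtains c where "solution U v (closed_segment 0 t) c" "c 0 = p" "fl t p = c t"
  using assms flow_map_eq unfolding flow_dom_def by blast

lemma flow_map_in: "p \<in> fldom t \<Longrightarrow> p \<in> U \<and> fl t p \<in> U"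
  by (elim flow_domE) (auto simp: solution_def)

lemma flow_map_inverse:
  assumes "p \<in> fldom t"
  shows "fl t p \<in> fldom (- t)" "fl (- t) (fl t p) = p"
proof -
  obtain c where c: "solution U v (closed_segment 0 t) c" "c 0 = p" "fl t p = c t"
    using assms by (rule flow_domE)
  have "solution U v (closed_segment 0 (- t)) (\<lambda>u. c (u + t))"
    by (rule solution_shift[OF c(1)]) (auto simp: closed_segment_eq_real_ivl split: if_splits)
  from flow_map_eq[OF this] show "fl t p \<in> fldom (- t)" "fl (- t) (fl t p) = p"
    using c by auto
qed

lemma flow_map_add:
  assumes "p \<in> fldom s" "fl s p \<in> fldom \<tau>" "0 \<le> s * \<tau>"
  shows "p \<in> fldom (s + \<tau>)" "fl (s + \<tau>) p = fl \<tau> (fl s p)"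
proof -
  obtain c1 where c1: "solution U v (closed_segment 0 s) c1" "c1 0 = p" "fl s p = c1 s"
    using assms(1) by (rule flow_domE)
  obtain c2 where c2: "solution U v (closed_segment 0 \<tau>) c2" "c2 0 = fl s p" "fl \<tau> (fl s p) = c2 \<tau>"
    using assms(2) by (rule flow_domE)
  obtain c where c: "c 0 = c1 0" "c (s + \<tau>) = c2 \<tau>" "solution U v (closed_segment 0 (s + \<tau>)) c"
    using solution_glue[OF c1(1) c2(1) _ assms(3)] c1 c2 by metis
  show "p \<in> fldom (s + \<tau>)" "fl (s + \<tau>) p = fl \<tau> (fl s p)"
    using flow_map_eq[OF c(3)] c c1 c2 by auto
qed

text \<open>The existence lemma asks for a globally Lipschitz field, so \<open>v\<close> is first
  composed with the nearest-point retraction onto a ball. Solutions starting near \<open>p\<close>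
  are too slow to leave that ball before time \<open>T\<close>, so they solve the original equation.
  Smoothness in the initial point \<open>x\<close> follows by treating \<open>x\<close> as a
  parameter of the displacement \<open>w x\<close>, which starts at 0.\<close>

lemma local_flow:
  assumes "p \<in> U" "0 < \<rho>"
  obtains r T where "0 < r" "0 < T" "ball p r \<subseteq> U"
    "\<And>x. x \<in> ball p r \<Longrightarrow> solution (U \<inter> ball p \<rho>) v {-T..T} (\<lambda>t. fl t x)"
    "\<And>x. x \<in> ball p r \<Longrightarrow> fl 0 x = x"
    "\<And>x t. x \<in> ball p r \<Longrightarrow> t \<in> {-T..T} \<Longrightarrow> x \<in> fldom t"
    "\<And>t. t \<in> {-T..T} \<Longrightarrow> smooth_on (ball p r) (fl t)"
proof -
  obtain r0 L where r0: "0 < r0" "0 \<le> L" "cball p r0 \<subseteq> U"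
    and lip: "\<And>x y. x \<in> cball p r0 \<Longrightarrow> y \<in> cball p r0 \<Longrightarrow> norm (v x - v y) \<le> L * norm (x - y)"
    using smooth_on_locally_lipschitz[OF openU smooth \<open>p \<in> U\<close>] by metis
  define R where "R = min r0 \<rho>"
  have R: "0 < R" "cball p R \<subseteq> cball p r0" "cball p R \<subseteq> U" "R \<le> \<rho>"
    using r0 assms by (auto simp: R_def)
  have "bounded (v ` cball p R)"
    using smooth_on_imp_continuous_on[OF smooth] R(3)
    by (intro compact_imp_bounded compact_continuous_image) (auto intro: continuous_on_subset)
  then obtain M where M: "0 < M" "\<And>x. x \<in> cball p R \<Longrightarrow> norm (v x) \<le> M"
    unfolding bounded_pos by blast
  \<comment> \<open>Speed at most \<open>M\<close> gives displacement at most \<open>R / 4\<close>,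
    so solutions from the ball of radius \<open>R / 2\<close> stay within radius \<open>R\<close>.
    The second entry gives \<open>L * T \<le> 1 / 2\<close>, with \<open>L + 1\<close> covering
    \<open>L = 0\<close>.\<close>
  define T where "T = min (R / (4 * M)) (1 / (2 * (L + 1)))"
  have T: "0 < T" "M * T \<le> R / 4" "L * T \<le> 1 / 2"
  proof -
    show "0 < T" using R M r0 by (simp add: T_def)
    have "T \<le> R / (4 * M)" by (simp add: T_def)
    then show "M * T \<le> R / 4" using M(1) by (simp add: field_simps)
    have "L * T \<le> (L + 1) * (1 / (2 * (L + 1)))"
      using \<open>0 < T\<close> r0(2) by (intro mult_mono) (auto simp: T_def)
    also have "\<dots> = 1 / 2" using r0(2) by (simp add: field_simps)
    finally show "L * T \<le> 1 / 2" .
  qed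
  let ?cp = "closest_point (cball p R)"
  have cp: "?cp y \<in> cball p R" "norm (?cp y - ?cp y') \<le> norm (y - y')" for y y'
    using closest_point_in_set[of "cball p R" y] closest_point_lipschitz[of "cball p R" y y'] R(1)
    by (auto simp: dist_norm)
  have lipcp: "norm (v (?cp y) - v (?cp y')) \<le> L * norm (y - y')" for y y'
    using lip[of "?cp y" "?cp y'"] cp R(2) mult_left_mono[OF cp(2)[of y y'] r0(2)]
    by (meson order_trans subsetD)
  have "\<exists>w. w 0 = 0 \<and> (\<forall>t\<in>{-T..T}. (w has_vector_derivative v (?cp (x + w t))) (at t within {-T..T}))" for x
  proof (rule ode_short_time_exists[OF T(1) r0(2) T(3)])
    have "continuous_on UNIV (\<lambda>y. v (?cp y))"
    proof (rule lipschitz_on_continuous_on)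
      show "L-lipschitz_on UNIV (\<lambda>y. v (?cp y))"
        using lipcp r0(2) by (intro lipschitz_onI) (auto simp: dist_norm)
    qed
    then show "continuous_on ({-T..T} \<times> UNIV) (\<lambda>(t, z). v (?cp (x + z)))"
      unfolding case_prod_unfold
      by (rule continuous_on_compose2) (auto intro!: continuous_intros)
    show "norm (v (?cp (x + y)) - v (?cp (x + y'))) \<le> L * norm (y - y')" for y y'
      using lipcp[of "x + y" "x + y'"] by simp
  qed
  then obtain w where w0: "\<And>x. w x 0 = 0"
    and w: "\<And>x t. t \<in> {-T..T} \<Longrightarrow> (w x has_vector_derivative v (?cp (x + w x t))) (at t within {-T..T})"
    by metis
  have wb: "norm (w x t) \<le> R / 4" if "t \<in> {-T..T}" for x t
  proof -
    have "norm (w x t - w x 0) \<le> M * \<bar>t - 0\<bar>"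
      by (rule vector_derivative_bound[where I = "{-T..T}"]) (use w M cp that T(1) in auto)
    also have "\<dots> \<le> M * T" using that M(1) by (intro mult_left_mono) auto
    finally show ?thesis using T(2) w0 by simp
  qed
  let ?X = "ball p (R / 2)" and ?Z = "ball (0::'a) (R / 2)"
  have xw: "x + y \<in> ball p R" if "x \<in> ?X" "y \<in> ?Z" for x y
    using that norm_triangle_ineq4[of "p - x" y] by (auto simp: dist_norm algebra_simps)
  have wZ: "w x t \<in> ?Z" if "t \<in> {-T..T}" for x t using wb[OF that, of x] R(1) by simp
  have w': "(w x has_vector_derivative v (x + w x t)) (at t within {-T..T})"
    if "x \<in> ?X" "t \<in> {-T..T}" for x t
  proof -
    have "?cp (x + w x t) = x + w x t"
      using xw[OF that(1) wZ[OF that(2), of x]] by (intro closest_point_self) auto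
    then show ?thesis using w[OF that(2), of x] by simp
  qed
  let ?G = "\<lambda>q. v (fst (fst q) + snd q)" and ?z = "\<lambda>q. w (fst q) (snd q)"
  interpret family: ode_family ?X T L ?Z ?G ?z
  proof
    fix x t assume x: "x \<in> ?X" and t: "t \<in> {-T<..<T}"
    show "norm (?G ((x, t), y) - ?G ((x, t), y')) \<le> L * norm (y - y')" if "y \<in> ?Z" "y' \<in> ?Z" for y y'
    proof -
      have "x + y \<in> cball p r0" "x + y' \<in> cball p r0"
        using subsetD[OF R(2) subsetD[OF ball_subset_cball xw[OF x]]] that by blast+
      from lip[OF this] show ?thesis by simp
    qed
    show "?z (x, t) \<in> ?Z" using wZ[of t x] t by simp
    have "at t within {-T..T} = at t"
      using t by (intro at_within_interior) (simp add: interior_atLeastAtMost_real)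
    then show "((\<lambda>s. ?z (x, s)) has_vector_derivative ?G ((x, t), ?z (x, t))) (at t)"
      using w'[OF x, of t] t by simp
  qed (use w0 T r0 in auto)
  have "smooth_on (family.Base \<times> ?Z) ?G"
  proof (rule smooth_on_compose[OF family.open_Base_Z openU smooth])
    show "smooth_on (family.Base \<times> ?Z) (\<lambda>q. fst (fst q) + snd q)"
      by (rule smooth_on_linear[OF family.open_Base_Z]) (intro bounded_linear_intros)
    show "(\<lambda>q. fst (fst q) + snd q) ` (family.Base \<times> ?Z) \<subseteq> U"
      using xw R(3) by force
  qed
  then have smooth_z: "smooth_on family.Base ?z"
    using ode_family_k_differentiable[OF family.ode_family_axioms] by (simp add: smooth_on_def)
  have sol: "solution (U \<inter> ball p \<rho>) v {-T..T} (\<lambda>t. x + w x t)" if "x \<in> ?X" for x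
    unfolding solution_def
  proof (intro ballI conjI)
    fix t assume t: "t \<in> {-T..T}"
    show "x + w x t \<in> U \<inter> ball p \<rho>" using xw[OF that wZ[OF t, of x]] R by auto
    show "((\<lambda>t. x + w x t) has_vector_derivative v (x + w x t)) (at t within {-T..T})"
      using w'[OF that t] by (auto intro!: derivative_eq_intros)
  qed
  have fl: "fl t x = x + w x t" "x \<in> fldom t" if "x \<in> ?X" "t \<in> {-T..T}" for x t
  proof -
    have "closed_segment 0 t \<subseteq> {-T..T}" using that(2) T(1) by (auto simp: closed_segment_eq_real_ivl)
    with sol[OF that(1)] have "solution U v (closed_segment 0 t) (\<lambda>t. x + w x t)"
      by (blast intro: solution_subset solution_mono)
    from flow_map_eq[OF this] show "fl t x = x + w x t" "x \<in> fldom t" by (simp_all add: w0)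
  qed
  show thesis
  \<comment> \<open>The family is smooth over an open time interval; halving \<open>T\<close> leaves
    a closed one inside it.\<close>
  proof (rule that[of "R / 2" "T / 2"])
    show "ball p (R / 2) \<subseteq> U" using R by force
    fix x assume x: "x \<in> ball p (R / 2)"
    show "fl 0 x = x" using fl[OF x, of 0] T w0 by simp
    show "x \<in> fldom t" if "t \<in> {- (T / 2)..T / 2}" for t using fl[OF x, of t] that T by auto
    have "solution (U \<inter> ball p \<rho>) v {- (T / 2)..T / 2} (\<lambda>t. x + w x t)"
      by (rule solution_subset[OF sol[OF x]]) (use T in auto)
    then show "solution (U \<inter> ball p \<rho>) v {- (T / 2)..T / 2} (\<lambda>t. fl t x)"
      by (rule solution_cong) (use fl[OF x] T in auto)
  next
    fix t assume t: "t \<in> {- (T / 2)..T / 2}"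
    have "smooth_on ?X (\<lambda>x. ?z (x, t))"
      by (rule smooth_on_compose[OF open_ball family.open_Base smooth_z
            smooth_on_Pair[OF open_ball smooth_on_linear[OF open_ball bounded_linear_ident] smooth_on_const]])
        (use t T in auto)
    then have "smooth_on ?X (\<lambda>x. x + w x t)"
      by (intro smooth_on_add smooth_on_linear[OF open_ball bounded_linear_ident]) auto
    then show "smooth_on ?X (fl t)"
      by (rule smooth_on_cong[rotated 2]) (use fl t T in auto)
  qed (use R T in auto)
qed

text \<open>The time-\<open>t\<close> map near \<open>p\<close> is a composition of time-\<open>t / n\<close> maps near points of the trajectory
  of \<open>p\<close>, which is compact.\<close>

lemma flow_induct:
  assumes "p \<in> fldom t"
    and local: "\<And>q. q \<in> U \<Longrightarrow> \<exists>r>0. \<exists>T>0. \<forall>x\<in>ball q r. \<forall>\<tau>\<in>{-T..T}. Q \<tau> x"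
    and compose: "\<And>p s \<tau>. p \<in> fldom s \<Longrightarrow> fl s p \<in> fldom \<tau> \<Longrightarrow> 0 \<le> s * \<tau> \<Longrightarrow> Q s p \<Longrightarrow> Q \<tau> (fl s p) \<Longrightarrow> Q (s + \<tau>) p"
  shows "Q t p"
proof -
  obtain c where c: "solution U v (closed_segment 0 t) c" "c 0 = p" "fl t p = c t"
    using assms(1) by (rule flow_domE)
  define K where "K = c ` closed_segment 0 t"
  have K: "compact K" "K \<subseteq> U"
    unfolding K_def using solution_continuous_on[OF c(1)] c(1)
    by (auto intro!: compact_continuous_image simp: solution_def)
  obtain r T where rT: "\<And>q. q \<in> U \<Longrightarrow> 0 < r q" "\<And>q. q \<in> U \<Longrightarrow> 0 < T q"
    "\<And>q x \<tau>. q \<in> U \<Longrightarrow> x \<in> ball q (r q) \<Longrightarrow> \<tau> \<in> {- T q..T q} \<Longrightarrow> Q \<tau> x"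
    using local by metis
  have "K \<subseteq> (\<Union>q\<in>K. ball q (r q))" using rT(1) K(2) by force
  then obtain F where F: "F \<subseteq> K" "finite F" "K \<subseteq> (\<Union>q\<in>F. ball q (r q))"
    by (rule compactE_image[OF K(1), rotated]) auto
  have "p \<in> K" unfolding K_def using c(2) by auto
  then have "F \<noteq> {}" using F(3) by auto
  \<comment> \<open>\<open>F\<close> is finite, so one positive step length serves all points of the
    trajectory.\<close>
  define T0 where "T0 = Min (T ` F)"
  have T0: "0 < T0" "\<And>q. q \<in> F \<Longrightarrow> T0 \<le> T q"
    using F \<open>F \<noteq> {}\<close> rT(2) K(2) by (auto simp: T0_def)
  have Q: "Q \<tau> x" if x: "x \<in> K" and \<tau>: "\<bar>\<tau>\<bar> \<le> T0" for x \<tau>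
  proof -
    obtain q where q: "q \<in> F" "x \<in> ball q (r q)" using F(3) x by auto
    then have "q \<in> U" using F(1) K(2) by blast
    from rT(3)[OF this q(2)] show ?thesis using T0(2)[OF q(1)] \<tau> by (simp add: abs_le_iff)
  qed
  obtain n where n: "\<bar>t\<bar> / T0 < real n" using reals_Archimedean2 by blast
  moreover have "0 \<le> \<bar>t\<bar> / T0" using T0(1) by simp
  ultimately have "0 < real n" by linarith
  define \<tau> where "\<tau> = t / real n"
  have \<tau>: "\<bar>\<tau>\<bar> \<le> T0"
    using n \<open>0 < real n\<close> T0(1) by (simp add: \<tau>_def abs_divide field_simps)
  \<comment> \<open>Induction along the subdivision; the value \<open>c (real k * \<tau>)\<close> is
    carried along because the next step has to start at a point of \<open>K\<close>.\<close>
  have "p \<in> fldom (real k * \<tau>) \<and> fl (real k * \<tau>) p = c (real k * \<tau>) \<and> Q (real k * \<tau>) p" if "k \<le> n" for k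
    using that
  proof (induction k)
    case 0
    have "solution U v (closed_segment 0 0) c" by (rule solution_subset[OF c(1)]) auto
    from flow_map_eq[OF this] show ?case using Q[OF \<open>p \<in> K\<close>, of 0] T0(1) c(2) by auto
  next
    case (Suc k)
    have frac: "real k * \<tau> + u \<in> closed_segment 0 t" if u: "u \<in> closed_segment 0 \<tau>" for u
    proof -
      obtain \<theta> where \<theta>: "0 \<le> \<theta>" "\<theta> \<le> 1" "u = \<theta> * \<tau>" using u by (auto simp: closed_segment_def)
      have "real k + \<theta> \<le> real n" using Suc.prems \<theta> by linarith
      then have "(real k + \<theta>) / real n \<le> 1" using \<open>0 < real n\<close> by simp
      moreover have "real k * \<tau> + u = ((real k + \<theta>) / real n) * t"
        by (simp add: \<theta> \<tau>_def algebra_simps add_divide_distrib)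
      ultimately show ?thesis
        using \<theta> \<open>0 < real n\<close> unfolding closed_segment_def by (auto intro!: exI[of _ "(real k + \<theta>) / real n"])
    qed
    have sol: "solution U v (closed_segment 0 \<tau>) (\<lambda>u. c (u + real k * \<tau>))"
      by (rule solution_shift[OF c(1)]) (use frac in \<open>auto simp: add.commute\<close>)
    have IH: "p \<in> fldom (real k * \<tau>)" "fl (real k * \<tau>) p = c (real k * \<tau>)" "Q (real k * \<tau>) p"
      using Suc by auto
    have step: "c (real k * \<tau>) \<in> fldom \<tau>" "fl \<tau> (c (real k * \<tau>)) = c (\<tau> + real k * \<tau>)"
      using flow_map_eq[OF sol] by auto
    have sgn: "0 \<le> (real k * \<tau>) * \<tau>" by (simp add: mult.assoc)
    have "c (real k * \<tau>) \<in> K" unfolding K_def using frac[of 0] by auto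
    then have "Q (real k * \<tau> + \<tau>) p"
      using compose[OF IH(1) _ sgn IH(3)] Q[OF _ \<tau>] IH(2) step by auto
    moreover have "p \<in> fldom (real k * \<tau> + \<tau>)" "fl (real k * \<tau> + \<tau>) p = c (\<tau> + real k * \<tau>)"
      using flow_map_add[OF IH(1) _ sgn] IH(2) step by auto
    ultimately show ?case by (simp add: algebra_simps)
  qed
  from this[of n] show ?thesis using \<open>0 < real n\<close> by (simp add: \<tau>_def)
qed

text \<open>Openness of the domain is proved together with smoothness: composing two flow maps needs
  the second on a whole neighbourhood of the image point.\<close>

lemma flow_map_smooth_near:
  assumes "p \<in> fldom t"
  shows "\<exists>N. open N \<and> p \<in> N \<and> N \<subseteq> fldom t \<and> smooth_on N (fl t)"
proof (rule flow_induct[OF assms])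
  fix q assume "q \<in> U"
  then obtain r T where "0 < r" "0 < T"
    "\<And>x t. x \<in> ball q r \<Longrightarrow> t \<in> {-T..T} \<Longrightarrow> x \<in> fldom t"
    "\<And>t. t \<in> {-T..T} \<Longrightarrow> smooth_on (ball q r) (fl t)"
    by (rule local_flow[OF _ zero_less_one]) metis
  then show "\<exists>r>0. \<exists>T>0. \<forall>x\<in>ball q r. \<forall>t\<in>{-T..T}.
      \<exists>N. open N \<and> x \<in> N \<and> N \<subseteq> fldom t \<and> smooth_on N (fl t)"
    by (intro exI[of _ r] conjI exI[of _ T] ballI exI[of _ "ball q r"]) auto
next
  fix p s \<tau>
  assume "\<exists>N. open N \<and> p \<in> N \<and> N \<subseteq> fldom s \<and> smooth_on N (fl s)"
    and "\<exists>N. open N \<and> fl s p \<in> N \<and> N \<subseteq> fldom \<tau> \<and> smooth_on N (fl \<tau>)" and sgn: "0 \<le> s * \<tau>"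
  then obtain A B where A: "open A" "p \<in> A" "A \<subseteq> fldom s" "smooth_on A (fl s)"
    and B: "open B" "fl s p \<in> B" "B \<subseteq> fldom \<tau>" "smooth_on B (fl \<tau>)" by blast
  let ?N = "A \<inter> fl s -` B"
  have N: "open ?N"
    using continuous_open_preimage[OF smooth_on_imp_continuous_on[OF A(4)] A(1) B(1)] .
  have sum: "x \<in> fldom (s + \<tau>)" "fl (s + \<tau>) x = fl \<tau> (fl s x)" if "x \<in> ?N" for x
    using that A(3) B(3) by (auto intro!: flow_map_add[OF _ _ sgn])
  have "smooth_on ?N (\<lambda>x. fl \<tau> (fl s x))"
    by (rule smooth_on_compose[OF N B(1) B(4) smooth_on_subset[OF A(4)]]) auto
  then have "smooth_on ?N (fl (s + \<tau>))"
    by (rule smooth_on_cong[OF N, rotated]) (simp add: sum)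
  then show "\<exists>N. open N \<and> p \<in> N \<and> N \<subseteq> fldom (s + \<tau>) \<and> smooth_on N (fl (s + \<tau>))"
    using N A(2) B(2) sum by (intro exI[of _ ?N]) auto
qed

lemma open_flow_dom: "open (fldom t)"
  using flow_map_smooth_near by (subst open_subopen) blast

lemma smooth_on_flow_map: "smooth_on (fldom t) (fl t)"
  using flow_map_smooth_near by (intro smooth_on_local) blast

lemma flow_map_image: "fl t ` fldom t = fldom (- t)"
proof
  show "fldom (- t) \<subseteq> fl t ` fldom t"
    using flow_map_inverse[of _ "- t"] by (auto intro!: image_eqI[of _ _ "fl (- t) _"])
qed (use flow_map_inverse in auto)

lemma flow_map_derivative:
  "p \<in> fldom t \<Longrightarrow> (fl t has_derivative frechet_derivative (fl t) (at p)) (at p)"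
  by (rule smooth_on_imp_has_derivative[OF smooth_on_flow_map])

text \<open>Makes the derivative injective, which later keeps the factors of the line fields from
  vanishing.\<close>

lemma flow_map_derivative_inverse:
  assumes "p \<in> fldom t"
  shows "frechet_derivative (fl (- t)) (at (fl t p)) (frechet_derivative (fl t) (at p) h) = h"
proof -
  have "((\<lambda>x. fl (- t) (fl t x)) has_derivative
      (\<lambda>h. frechet_derivative (fl (- t)) (at (fl t p)) (frechet_derivative (fl t) (at p) h))) (at p)"
    by (rule has_derivative_compose[OF flow_map_derivative[OF assms]
          flow_map_derivative[OF flow_map_inverse(1)[OF assms]]])
  then have "((\<lambda>x. x) has_derivative
      (\<lambda>h. frechet_derivative (fl (- t)) (at (fl t p)) (frechet_derivative (fl t) (at p) h))) (at p)"
    by (rule has_derivative_transform_within_open[OF _ open_flow_dom assms])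
      (simp add: flow_map_inverse)
  from has_derivative_unique[OF this has_derivative_ident] show ?thesis by metis
qed

text \<open>By the chain rule the factors multiply along a composition of flow maps, so short times
  decide.\<close>

lemma flow_preserves_line_field:
  assumes "p \<in> fldom t"
    and local: "\<And>q. q \<in> U \<Longrightarrow> \<exists>r>0. \<exists>T>0. \<forall>x\<in>ball q r. \<forall>\<tau>\<in>{-T..T}.
      \<exists>a. frechet_derivative (fl \<tau>) (at x) (Z x) = a *\<^sub>R Z (fl \<tau> x)"
  shows "\<exists>a. frechet_derivative (fl t) (at p) (Z p) = a *\<^sub>R Z (fl t p)"
proof (rule flow_induct[OF assms(1) local])
  fix p s \<tau>
  assume p: "p \<in> fldom s" "fl s p \<in> fldom \<tau>" and sgn: "0 \<le> s * \<tau>"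
    and "\<exists>a. frechet_derivative (fl s) (at p) (Z p) = a *\<^sub>R Z (fl s p)"
    and "\<exists>a. frechet_derivative (fl \<tau>) (at (fl s p)) (Z (fl s p)) = a *\<^sub>R Z (fl \<tau> (fl s p))"
  then obtain a b where a: "frechet_derivative (fl s) (at p) (Z p) = a *\<^sub>R Z (fl s p)"
    and b: "frechet_derivative (fl \<tau>) (at (fl s p)) (Z (fl s p)) = b *\<^sub>R Z (fl \<tau> (fl s p))" by blast
  let ?N = "fldom s \<inter> fl s -` fldom \<tau>"
  have N: "open ?N"
    by (rule continuous_open_preimage[OF smooth_on_imp_continuous_on[OF smooth_on_flow_map]
          open_flow_dom open_flow_dom])
  have "((\<lambda>x. fl \<tau> (fl s x)) has_derivative
      (\<lambda>h. frechet_derivative (fl \<tau>) (at (fl s p)) (frechet_derivative (fl s) (at p) h))) (at p)"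
    by (rule has_derivative_compose[OF flow_map_derivative[OF p(1)] flow_map_derivative[OF p(2)]])
  then have "(fl (s + \<tau>) has_derivative
      (\<lambda>h. frechet_derivative (fl \<tau>) (at (fl s p)) (frechet_derivative (fl s) (at p) h))) (at p)"
    by (rule has_derivative_transform_within_open[OF _ N]) (use p in \<open>auto simp: flow_map_add[OF _ _ sgn]\<close>)
  then have "frechet_derivative (fl (s + \<tau>)) (at p) =
      (\<lambda>h. frechet_derivative (fl \<tau>) (at (fl s p)) (frechet_derivative (fl s) (at p) h))"
    by (rule frechet_derivative_at[symmetric])
  then have "frechet_derivative (fl (s + \<tau>)) (at p) (Z p) = (a * b) *\<^sub>R Z (fl \<tau> (fl s p))"
    using a b linear_scale[OF has_derivative_linear[OF flow_map_derivative[OF p(2)]]] by simp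
  then show "\<exists>a. frechet_derivative (fl (s + \<tau>)) (at p) (Z p) = a *\<^sub>R Z (fl (s + \<tau>) p)"
    using flow_map_add(2)[OF p sgn] by auto
qed

end

subsection \<open>The hypersurface in coordinates\<close>

lemma bounded_linear_coords: "bounded_linear coords"
proof -
  have eq: "coords = (\<lambda>p. (fst (snd p), snd (snd p), fst (fst p)))"
    by (auto simp: coords_def)
  show ?thesis unfolding eq by (intro bounded_linear_intros)
qed

lemma coords_param [simp]: "coords (param \<phi> q) = q"
  by (cases q) (simp add: coords_def param_def)

locale para_CR =
  fixes N :: "R3 set" and \<phi> :: "R3 \<Rightarrow> real"
  assumes embedded: "embedded_para_CR N \<phi>"
begin

abbreviation "M \<equiv> para_CR_manifold N \<phi>"

definition d_x :: "R3 \<Rightarrow> real" where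
  "d_x q = frechet_derivative \<phi> (at q) (0, 0, 1)"

definition Dparam :: "R3 \<Rightarrow> R3 \<Rightarrow> R4" where
  "Dparam q = (\<lambda>(a, b, x). ((x, (1 + d_a \<phi> q) * a + d_b \<phi> q * b + d_x q * x), (a, b)))"

lemma openN: "open N" and smooth_phi: "smooth_on N \<phi>"
  and transversal: "q \<in> N \<Longrightarrow> 1 + d_a \<phi> q \<noteq> 0"
  using embedded by (auto simp: embedded_para_CR_def)

lemma smooth_on_d_a: "smooth_on N (d_a \<phi>)" and smooth_on_d_b: "smooth_on N (d_b \<phi>)"
  and smooth_on_d_x: "smooth_on N d_x"
  unfolding d_a_def[abs_def] d_b_def[abs_def] d_x_def[abs_def]
  by (rule smooth_on_frechet_derivative[OF smooth_phi])+

lemma phi_derivative: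
  assumes "q \<in> N"
  shows "(\<phi> has_derivative (\<lambda>h. d_a \<phi> q * fst h + d_b \<phi> q * fst (snd h) + d_x q * snd (snd h))) (at q)"
proof -
  have D: "(\<phi> has_derivative frechet_derivative \<phi> (at q)) (at q)"
    by (rule smooth_on_imp_has_derivative[OF smooth_phi assms])
  have lin: "linear (frechet_derivative \<phi> (at q))" using D by (rule has_derivative_linear)
  have "frechet_derivative \<phi> (at q) h =
      d_a \<phi> q * fst h + d_b \<phi> q * fst (snd h) + d_x q * snd (snd h)" for h
  proof -
    have "h = fst h *\<^sub>R (1, 0, 0) + fst (snd h) *\<^sub>R (0, 1, 0) + snd (snd h) *\<^sub>R (0, 0, 1)"
      by (cases h) simp
    then have "frechet_derivative \<phi> (at q) h = frechet_derivative \<phi> (at q)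
        (fst h *\<^sub>R (1, 0, 0) + fst (snd h) *\<^sub>R (0, 1, 0) + snd (snd h) *\<^sub>R (0, 0, 1))" by (rule arg_cong)
    then show ?thesis
      by (simp only: linear_add[OF lin] linear_scale[OF lin] d_a_def d_b_def d_x_def)
        (simp add: mult.commute)
  qed
  then have "frechet_derivative \<phi> (at q) =
      (\<lambda>h. d_a \<phi> q * fst h + d_b \<phi> q * fst (snd h) + d_x q * snd (snd h))" by blast
  with D show ?thesis by simp
qed

lemma param_eq: "param \<phi> = (\<lambda>q. ((snd (snd q), fst q + \<phi> q), (fst q, fst (snd q))))"
  by (auto simp: param_def)

lemma param_derivative:
  assumes "q \<in> N"
  shows "(param \<phi> has_derivative Dparam q) (at q)"
proof -
  have "Dparam q = (\<lambda>h. ((snd (snd h), fst h +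
      (d_a \<phi> q * fst h + d_b \<phi> q * fst (snd h) + d_x q * snd (snd h))), (fst h, fst (snd h))))"
    by (auto simp: Dparam_def algebra_simps)
  then show ?thesis
    unfolding param_eq
    by (auto intro!: derivative_eq_intros phi_derivative[OF assms])
qed

lemma frechet_derivative_param: "q \<in> N \<Longrightarrow> frechet_derivative (param \<phi>) (at q) = Dparam q"
  using frechet_derivative_at[OF param_derivative] by simp

lemma linear_Dparam: "linear (Dparam q)"
  unfolding Dparam_def by (rule linearI) (auto simp: algebra_simps)

lemma coords_Dparam [simp]: "coords (Dparam q h) = h"
  by (cases h) (simp add: coords_def Dparam_def)

lemma smooth_on_param: "smooth_on N (param \<phi>)"
  unfolding param_eq
  by (intro smooth_on_Pair openN smooth_on_add smooth_phi smooth_on_linear bounded_linear_intros)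

lemma in_M: "p \<in> M \<longleftrightarrow> coords p \<in> N \<and> param \<phi> (coords p) = p"
  by (cases p) (auto simp: para_CR_manifold_def coords_def param_def)

lemma param_in_M: "q \<in> N \<Longrightarrow> param \<phi> q \<in> M"
  by (simp add: in_M)

lemma coords_image: "U \<subseteq> M \<Longrightarrow> param \<phi> ` coords ` U = U"
  by (force simp: in_M image_image)

lemma coords_image_param: "coords ` param \<phi> ` A = A"
  by (simp add: image_image)

text \<open>\<open>coords\<close> and \<open>param \<phi>\<close> are mutually inverse and
  continuous between \<open>M\<close> and \<open>N\<close>.\<close>

lemma openin_M_iff: "openin (top_of_set M) U \<longleftrightarrow> U \<subseteq> M \<and> open (coords ` U)"
proof
  assume "openin (top_of_set M) U"
  then obtain T where T: "open T" "U = M \<inter> T" by (auto simp: openin_open)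
  have "coords ` U = N \<inter> param \<phi> -` T"
  proof
    show "N \<inter> param \<phi> -` T \<subseteq> coords ` U"
    proof
      fix q assume "q \<in> N \<inter> param \<phi> -` T"
      then show "q \<in> coords ` U"
        by (intro image_eqI[of _ _ "param \<phi> q"]) (simp_all add: T(2) param_in_M)
    qed
  qed (auto simp: T(2) in_M)
  moreover have "open (N \<inter> param \<phi> -` T)"
    by (rule continuous_open_preimage[OF smooth_on_imp_continuous_on[OF smooth_on_param] openN T(1)])
  ultimately show "U \<subseteq> M \<and> open (coords ` U)" using T(2) by auto
next
  assume U: "U \<subseteq> M \<and> open (coords ` U)"
  have "open (coords -` (coords ` U))"
    by (rule open_vimage[OF conjunct2[OF U]])
      (rule linear_continuous_on[OF bounded_linear_coords])
  moreover have "U = M \<inter> coords -` (coords ` U)"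
  proof
    show "M \<inter> coords -` (coords ` U) \<subseteq> U"
    proof
      fix p assume "p \<in> M \<inter> coords -` (coords ` U)"
      then obtain u where "u \<in> U" "coords p = coords u" "param \<phi> (coords p) = p" by (auto simp: in_M)
      moreover have "param \<phi> (coords u) = u" using \<open>u \<in> U\<close> U in_M by blast
      ultimately show "p \<in> U" by metis
    qed
  qed (use U in auto)
  ultimately show "openin (top_of_set M) U" unfolding openin_open by blast
qed

lemma X_field_eq: "p \<in> M \<Longrightarrow> X_field \<phi> p = Dparam (coords p) (0, 0, 1)"
  by (simp add: X_field_def in_M frechet_derivative_param)

lemma Y_field_eq: "p \<in> M \<Longrightarrow> Y_field \<phi> p = Dparam (coords p) (- d_b \<phi> (coords p), 1 + d_a \<phi> (coords p), 0)"
  by (simp add: Y_field_def in_M frechet_derivative_param)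

end

section \<open>Transport of the flow between the hypersurface and its coordinate domain\<close>

locale vector_field_on_M = para_CR +
  fixes U :: "R4 set" and V :: "R4 \<Rightarrow> R4"
  assumes vector_field: "M_vector_field N \<phi> U V"
begin

abbreviation "U' \<equiv> coords ` U"

definition v :: "R3 \<Rightarrow> R3" where
  "v q = coords (V (param \<phi> q))"

lemma U_subset: "U \<subseteq> M" and openU': "open U'"
  using vector_field by (auto simp: M_vector_field_def openin_M_iff)

lemma param_coords: "p \<in> U \<Longrightarrow> param \<phi> (coords p) = p"
  using U_subset in_M by blast

lemma U'_subset: "U' \<subseteq> N"
  using U_subset by (auto simp: in_M)

lemma param_in_U: "q \<in> U' \<Longrightarrow> param \<phi> q \<in> U"
  using coords_image[OF U_subset] by blast

text \<open>A tangent vector lies in the range of \<open>Dparam q\<close>, of which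
  \<open>coords\<close> is a left inverse; so the coordinate field \<open>v\<close> determines
  \<open>V\<close>.\<close>

lemma V_eq:
  assumes "q \<in> U'"
  shows "V (param \<phi> q) = Dparam q (v q)"
proof -
  have "V (param \<phi> q) \<in> tangent_space \<phi> (param \<phi> q)"
    using vector_field param_in_U[OF assms] by (simp add: M_vector_field_def)
  then obtain h where "V (param \<phi> q) = Dparam q h"
    using assms U'_subset by (auto simp: tangent_space_def frechet_derivative_param)
  then show ?thesis by (simp add: v_def)
qed

lemma smooth_on_V: "smooth_on U' (\<lambda>q. V (param \<phi> q))"
  using vector_field by (simp add: M_vector_field_def M_smooth_on_def o_def)

sublocale smooth_field U' v
proof
  show "open U'" by (rule openU')
  show "smooth_on U' v"
    unfolding v_def[abs_def] by (rule smooth_on_compose_linear[OF openU' bounded_linear_coords smooth_on_V])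
qed

lemma integral_curve_coords:
  assumes "integral_curve U V I \<gamma>"
  shows "solution U' v I (\<lambda>t. coords (\<gamma> t))"
  unfolding solution_def
proof (intro ballI conjI)
  fix t assume t: "t \<in> I"
  then have \<gamma>: "\<gamma> t \<in> U" "(\<gamma> has_vector_derivative V (\<gamma> t)) (at t within I)"
    using assms by (auto simp: integral_curve_def)
  then show "coords (\<gamma> t) \<in> U'" by simp
  have "v (coords (\<gamma> t)) = coords (V (\<gamma> t))"
    using \<gamma>(1) by (simp add: v_def param_coords)
  then show "((\<lambda>t. coords (\<gamma> t)) has_vector_derivative v (coords (\<gamma> t))) (at t within I)"
    using bounded_linear.has_vector_derivative[OF bounded_linear_coords \<gamma>(2)] by simp
qed

lemma param_solution_derivative:
  assumes "solution U' v I c" "t \<in> I"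
  shows "((\<lambda>t. param \<phi> (c t)) has_vector_derivative V (param \<phi> (c t))) (at t within I)"
proof -
  have c: "c t \<in> U'" "(c has_vector_derivative v (c t)) (at t within I)"
    using assms by (auto simp: solution_def)
  then have "c t \<in> N" using U'_subset by blast
  have "((param \<phi> \<circ> c) has_vector_derivative Dparam (c t) (v (c t))) (at t within I)"
    by (rule vector_derivative_diff_chain_within[OF c(2)
          has_derivative_at_withinI[OF param_derivative[OF \<open>c t \<in> N\<close>]]])
  then show ?thesis by (simp add: o_def V_eq[OF c(1)])
qed

lemma integral_curve_param:
  assumes "solution U' v I c"
  shows "integral_curve U V I (\<lambda>t. param \<phi> (c t))"
  using assms param_solution_derivative[OF assms] param_in_U
  unfolding integral_curve_def solution_def by blast

lemma flow_domain_eq: "flow_domain U V t = param \<phi> ` fldom t"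
proof (intro set_eqI iffI)
  fix p assume "p \<in> flow_domain U V t"
  then obtain \<gamma> where \<gamma>: "\<gamma> 0 = p" "integral_curve U V (closed_segment 0 t) \<gamma>"
    by (auto simp: flow_domain_def)
  then have "p \<in> U" by (auto simp: integral_curve_def)
  then have "p = param \<phi> (coords p)" by (simp add: param_coords)
  moreover have "coords p \<in> fldom t"
    using integral_curve_coords[OF \<gamma>(2)] \<gamma>(1) unfolding flow_dom_def by auto
  ultimately show "p \<in> param \<phi> ` fldom t" by blast
next
  fix p assume "p \<in> param \<phi> ` fldom t"
  then obtain c where "solution U' v (closed_segment 0 t) c" "p = param \<phi> (c 0)"
    by (auto simp: flow_dom_def)
  then show "p \<in> flow_domain U V t"
    using integral_curve_param unfolding flow_domain_def by auto
qed

lemma flow_eq: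
  assumes "q \<in> fldom t"
  shows "flow U V t (param \<phi> q) = param \<phi> (fl t q)"
proof -
  obtain c where c: "solution U' v (closed_segment 0 t) c" "c 0 = q" "fl t q = c t"
    using assms by (rule flow_domE)
  show ?thesis
    unfolding flow_def
  proof (rule the_equality)
    show "\<exists>\<gamma>. \<gamma> 0 = param \<phi> q \<and> \<gamma> t = param \<phi> (fl t q) \<and> integral_curve U V (closed_segment 0 t) \<gamma>"
      using integral_curve_param[OF c(1)] c by auto
    fix p assume "\<exists>\<gamma>. \<gamma> 0 = param \<phi> q \<and> \<gamma> t = p \<and> integral_curve U V (closed_segment 0 t) \<gamma>"
    then obtain \<gamma> where \<gamma>: "\<gamma> 0 = param \<phi> q" "\<gamma> t = p" "integral_curve U V (closed_segment 0 t) \<gamma>"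
      by blast
    then have "p \<in> U" by (auto simp: integral_curve_def)
    then have "p = param \<phi> (coords p)" by (simp add: param_coords)
    then show "p = param \<phi> (fl t q)"
      using flow_map_eq(1)[OF integral_curve_coords[OF \<gamma>(3)]] \<gamma> by simp
  qed
qed

lemma fldom_subset: "fldom t \<subseteq> N"
  using flow_map_in U'_subset by blast

lemma fl_in_N: "q \<in> fldom t \<Longrightarrow> fl t q \<in> N"
  using flow_map_in U'_subset by blast

lemma differential_flow:
  assumes "q \<in> fldom t"
  shows "differential \<phi> (flow U V t) (param \<phi> q) (Dparam q h) =
    Dparam (fl t q) (frechet_derivative (fl t) (at q) h)"
proof -
  have "((\<lambda>q. param \<phi> (fl t q)) has_derivative
      (\<lambda>h. Dparam (fl t q) (frechet_derivative (fl t) (at q) h))) (at q)"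
    by (rule has_derivative_compose[OF flow_map_derivative[OF assms] param_derivative[OF fl_in_N[OF assms]]])
  then have "((flow U V t \<circ> param \<phi>) has_derivative
      (\<lambda>h. Dparam (fl t q) (frechet_derivative (fl t) (at q) h))) (at q)"
    by (rule has_derivative_transform_within_open[OF _ open_flow_dom assms]) (simp add: flow_eq)
  from frechet_derivative_at[OF this, symmetric] show ?thesis by (simp add: differential_def)
qed

text \<open>A pointwise condition on lines only; smoothness and non-vanishing of the factor are
  recovered from the flow in \<open>preserves_imp_infinitesimal\<close>.\<close>

definition preserves :: "(R3 \<Rightarrow> R3) \<Rightarrow> bool" where
  "preserves Z \<longleftrightarrow> (\<forall>t. \<forall>q\<in>fldom t. \<exists>a. frechet_derivative (fl t) (at q) (Z q) = a *\<^sub>R Z (fl t q))"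

abbreviation (input) "ZX \<equiv> (\<lambda>q::R3. (0::real, 0::real, 1::real))"
abbreviation (input) "ZY \<equiv> (\<lambda>q. (- d_b \<phi> q, 1 + d_a \<phi> q, 0::real))"

lemma infinitesimal_imp_preserves:
  assumes "infinitesimal_para_CR_automorphism N \<phi> U V"
  shows "preserves ZX" "preserves ZY"
proof -
  have "(\<exists>a. frechet_derivative (fl t) (at q) (ZX q) = a *\<^sub>R ZX (fl t q)) \<and>
      (\<exists>a. frechet_derivative (fl t) (at q) (ZY q) = a *\<^sub>R ZY (fl t q))"
    if q: "q \<in> fldom t" for t q
  proof -
    have "local_para_CR_automorphism N \<phi> (flow_domain U V t) (flow U V t ` flow_domain U V t) (flow U V t)"
      using assms by (simp add: infinitesimal_para_CR_automorphism_def)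
    then obtain l m where lm: "\<forall>p\<in>flow_domain U V t.
        differential \<phi> (flow U V t) p (X_field \<phi> p) = l (flow U V t p) *\<^sub>R X_field \<phi> (flow U V t p) \<and>
        differential \<phi> (flow U V t) p (Y_field \<phi> p) = m (flow U V t p) *\<^sub>R Y_field \<phi> (flow U V t p)"
      unfolding local_para_CR_automorphism_def by blast
    have "param \<phi> q \<in> flow_domain U V t" using q by (simp add: flow_domain_eq)
    note lm = bspec[OF lm this]
    have M: "param \<phi> q \<in> M" "param \<phi> (fl t q) \<in> M"
      using subsetD[OF fldom_subset q] fl_in_N[OF q] by (simp_all add: param_in_M)
    obtain a b where "Dparam (fl t q) (frechet_derivative (fl t) (at q) (ZX q)) = a *\<^sub>R Dparam (fl t q) (ZX (fl t q))"
      "Dparam (fl t q) (frechet_derivative (fl t) (at q) (ZY q)) = b *\<^sub>R Dparam (fl t q) (ZY (fl t q))"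
      using lm by (simp only: flow_eq[OF q] X_field_eq[OF M(1)] X_field_eq[OF M(2)] Y_field_eq[OF M(1)]
          Y_field_eq[OF M(2)] coords_param differential_flow[OF q])
    then have "coords (Dparam (fl t q) (frechet_derivative (fl t) (at q) (ZX q))) = coords (Dparam (fl t q) (a *\<^sub>R ZX (fl t q)))"
      "coords (Dparam (fl t q) (frechet_derivative (fl t) (at q) (ZY q))) = coords (Dparam (fl t q) (b *\<^sub>R ZY (fl t q)))"
      by (simp_all only: linear_scale[OF linear_Dparam])
    then show ?thesis unfolding coords_Dparam by blast
  qed
  then show "preserves ZX" "preserves ZY" by (auto simp: preserves_def)
qed

text \<open>Each factor can be read off from one component of the image vector: the third for
  \<open>ZX\<close>, and the second divided by \<open>1 + d_a \<phi>\<close> for \<open>ZY\<close>.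
  This makes the factors smooth, and injectivity of the derivative makes them nonzero.\<close>

lemma preserves_imp_infinitesimal:
  assumes "preserves ZX" "preserves ZY"
  shows "infinitesimal_para_CR_automorphism N \<phi> U V"
proof -
  have "local_para_CR_automorphism N \<phi> (flow_domain U V t) (flow U V t ` flow_domain U V t) (flow U V t)" for t
  proof -
    let ?F = "flow U V t" and ?A = "flow_domain U V t"
    let ?D = "\<lambda>q. frechet_derivative (fl t) (at q)"
    have img: "?F ` ?A = param \<phi> ` fldom (- t)"
      unfolding flow_domain_eq image_image flow_map_image[symmetric]
      by (intro image_cong refl) (simp add: flow_eq)
    have inj: "inj_on ?F ?A"
    proof (rule inj_onI)
      fix p p' assume p: "p \<in> ?A" "p' \<in> ?A" and eq: "?F p = ?F p'"
      obtain q q' where q: "q \<in> fldom t" "q' \<in> fldom t" "p = param \<phi> q" "p' = param \<phi> q'"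
        using p by (auto simp: flow_domain_eq)
      then have "coords (param \<phi> (fl t q)) = coords (param \<phi> (fl t q'))"
        using eq by (simp add: flow_eq)
      then have "fl (- t) (fl t q) = fl (- t) (fl t q')" by simp
      then show "p = p'" using q by (simp add: flow_map_inverse)
    qed
    have inv: "inv_into ?A ?F (param \<phi> q) = param \<phi> (fl (- t) q)" if "q \<in> fldom (- t)" for q
    proof (rule inv_into_f_eq[OF inj])
      note i = flow_map_inverse[OF that]
      show "param \<phi> (fl (- t) q) \<in> ?A" using i(1) by (simp add: flow_domain_eq)
      show "?F (param \<phi> (fl (- t) q)) = param \<phi> q" using i by (simp add: flow_eq)
    qed
    have smooth_pfl: "smooth_on (fldom s) (\<lambda>q. param \<phi> (fl s q))" for s
      by (rule smooth_on_compose[OF open_flow_dom openN smooth_on_param smooth_on_flow_map])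
        (use fl_in_N in auto)
    have returns: "fl (- t) ` fldom (- t) \<subseteq> fldom t" using flow_map_image[of "- t"] by simp
    have smooth_back: "smooth_on (fldom (- t)) (\<lambda>q. f (fl (- t) q))" if "smooth_on (fldom t) f" for f :: "R3 \<Rightarrow> real"
      by (rule smooth_on_compose[OF open_flow_dom open_flow_dom that smooth_on_flow_map returns])
    \<comment> \<open>The automorphism condition evaluates the factors at the image point, hence the
      pullback by \<open>fl (- t)\<close>.\<close>
    define l where "l p = snd (snd (?D (fl (- t) (coords p)) (0, 0, 1)))" for p
    define m where "m p = fst (snd (?D (fl (- t) (coords p)) (ZY (fl (- t) (coords p))))) *
        inverse (1 + d_a \<phi> (coords p))" for p
    have l: "?D q (ZX q) = l (param \<phi> (fl t q)) *\<^sub>R ZX (fl t q)"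
      and m: "?D q (ZY q) = m (param \<phi> (fl t q)) *\<^sub>R ZY (fl t q)" if q: "q \<in> fldom t" for q
    proof -
      obtain a b where ab: "?D q (ZX q) = a *\<^sub>R ZX (fl t q)" "?D q (ZY q) = b *\<^sub>R ZY (fl t q)"
        using assms q unfolding preserves_def by blast
      then have "l (param \<phi> (fl t q)) = a" using q by (simp add: l_def flow_map_inverse)
      then show "?D q (ZX q) = l (param \<phi> (fl t q)) *\<^sub>R ZX (fl t q)" using ab by simp
      have "m (param \<phi> (fl t q)) = b"
        using ab q transversal[OF fl_in_N[OF q]] by (simp add: m_def flow_map_inverse)
      then show "?D q (ZY q) = m (param \<phi> (fl t q)) *\<^sub>R ZY (fl t q)" using ab by simp
    qed
    have nonzero: "l (param \<phi> (fl t q)) \<noteq> 0 \<and> m (param \<phi> (fl t q)) \<noteq> 0" if q: "q \<in> fldom t" for q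
    proof -
      have "h = 0" if "?D q h = 0" for h
      proof -
        have "linear (frechet_derivative (fl (- t)) (at (fl t q)))"
          by (rule has_derivative_linear[OF flow_map_derivative[OF flow_map_inverse(1)[OF q]]])
        then show ?thesis
          using flow_map_derivative_inverse[OF q, of h] that by (simp add: linear_0)
      qed
      moreover have "ZX q \<noteq> 0" "ZY q \<noteq> 0"
        using transversal[of q] fldom_subset q by (auto simp: zero_prod_def)
      ultimately show ?thesis using l[OF q] m[OF q] by (metis scaleR_zero_left)
    qed
    have sl: "M_smooth_on \<phi> (?F ` ?A) l"
    proof -
      have "smooth_on (fldom t) (\<lambda>q. snd (snd (?D q (0, 0, 1))))"
        by (rule smooth_on_compose_linear[OF open_flow_dom _ smooth_on_frechet_derivative[OF smooth_on_flow_map]])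
          (intro bounded_linear_intros)
      from smooth_back[OF this] show ?thesis
        unfolding M_smooth_on_def img coords_image_param by (simp add: o_def l_def)
    qed
    have sm: "M_smooth_on \<phi> (?F ` ?A) m"
    proof -
      have sN: "smooth_on (fldom s) f" if "smooth_on N f" for f :: "R3 \<Rightarrow> real" and s
        using that fldom_subset by (rule smooth_on_subset)
      have lin: "bounded_linear (\<lambda>h :: R3. fst (snd h))" by (intro bounded_linear_intros)
      note sD = smooth_on_frechet_derivative[OF smooth_on_flow_map]
      \<comment> \<open>\<open>ZY q\<close> varies with \<open>q\<close>, while the derivative is
        known to be smooth in constant directions; linearity separates the two.\<close>
      have "smooth_on (fldom t) (\<lambda>q. fst (snd ((- d_b \<phi> q) *\<^sub>R ?D q (1, 0, 0) + (1 + d_a \<phi> q) *\<^sub>R ?D q (0, 1, 0))))"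
        by (intro smooth_on_compose_linear[OF open_flow_dom lin] smooth_on_add smooth_on_scaleR open_flow_dom sD
            smooth_on_const sN[OF smooth_on_d_a] sN[OF smooth_on_d_b]
            smooth_on_compose_linear[OF open_flow_dom bounded_linear_minus[OF bounded_linear_ident]])
      then have "smooth_on (fldom t) (\<lambda>q. fst (snd (?D q (ZY q))))"
      proof (rule smooth_on_cong[OF open_flow_dom, rotated])
        fix q assume q: "q \<in> fldom t"
        have lD: "linear (?D q)" by (rule has_derivative_linear[OF flow_map_derivative[OF q]])
        have "ZY q = (- d_b \<phi> q) *\<^sub>R (1, 0, 0) + (1 + d_a \<phi> q) *\<^sub>R (0, 1, 0)" by simp
        then have "?D q (ZY q) = ?D q ((- d_b \<phi> q) *\<^sub>R (1, 0, 0) + (1 + d_a \<phi> q) *\<^sub>R (0, 1, 0))"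
          by (rule arg_cong)
        then show "fst (snd ((- d_b \<phi> q) *\<^sub>R ?D q (1, 0, 0) + (1 + d_a \<phi> q) *\<^sub>R ?D q (0, 1, 0))) = fst (snd (?D q (ZY q)))"
          by (simp only: linear_add[OF lD] linear_scale[OF lD])
      qed
      note sb = smooth_back[OF this]
      have "smooth_on (fldom (- t)) (\<lambda>q. fst (snd (?D (fl (- t) q) (ZY (fl (- t) q)))) * inverse (1 + d_a \<phi> q))"
        by (intro smooth_on_mult smooth_on_inverse open_flow_dom smooth_on_add smooth_on_const
            sN[OF smooth_on_d_a] sb transversal subsetD[OF fldom_subset])
      then show ?thesis
        unfolding M_smooth_on_def img coords_image_param by (simp add: o_def m_def)
    qed
    show ?thesis
      unfolding local_para_CR_automorphism_def
    proof (intro conjI)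
      have "openin (top_of_set M) (param \<phi> ` fldom s)" for s
        unfolding openin_M_iff coords_image_param
        using param_in_M fldom_subset open_flow_dom by blast
      then show "openin (top_of_set M) ?A" "openin (top_of_set M) (?F ` ?A)"
        unfolding img by (simp_all only: flow_domain_eq)
      show "bij_betw ?F ?A (?F ` ?A)" using inj by (rule inj_on_imp_bij_betw)
      show "M_smooth_on \<phi> ?A ?F"
        unfolding M_smooth_on_def flow_domain_eq coords_image_param
        by (rule smooth_on_cong[OF open_flow_dom _ smooth_pfl]) (simp add: flow_eq)
      show "M_smooth_on \<phi> (?F ` ?A) (inv_into ?A ?F)"
        unfolding M_smooth_on_def img coords_image_param
        by (rule smooth_on_cong[OF open_flow_dom _ smooth_pfl]) (simp add: inv)
      have "l p \<noteq> 0 \<and> m p \<noteq> 0" if "p \<in> ?F ` ?A" for p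
        using that nonzero by (auto simp: flow_domain_eq flow_eq)
      moreover have "differential \<phi> ?F p (X_field \<phi> p) = l (?F p) *\<^sub>R X_field \<phi> (?F p) \<and>
          differential \<phi> ?F p (Y_field \<phi> p) = m (?F p) *\<^sub>R Y_field \<phi> (?F p)" if p: "p \<in> ?A" for p
      proof -
        obtain q where q: "q \<in> fldom t" "p = param \<phi> q" using p by (auto simp: flow_domain_eq)
        have M: "param \<phi> q \<in> M" "param \<phi> (fl t q) \<in> M"
          using subsetD[OF fldom_subset q(1)] fl_in_N[OF q(1)] by (simp_all add: param_in_M)
        show ?thesis
          using l[OF q(1)] m[OF q(1)]
          by (simp only: q(2) X_field_eq[OF M(1)] Y_field_eq[OF M(1)] flow_eq[OF q(1)] X_field_eq[OF M(2)]
              Y_field_eq[OF M(2)] coords_param differential_flow[OF q(1)] linear_scale[OF linear_Dparam])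
      qed
      ultimately show "\<exists>l m. M_smooth_on \<phi> (?F ` ?A) l \<and> M_smooth_on \<phi> (?F ` ?A) m \<and>
          (\<forall>q\<in>?F ` ?A. l q \<noteq> 0 \<and> m q \<noteq> 0) \<and>
          (\<forall>p\<in>?A. differential \<phi> ?F p (X_field \<phi> p) = l (?F p) *\<^sub>R X_field \<phi> (?F p) \<and>
            differential \<phi> ?F p (Y_field \<phi> p) = m (?F p) *\<^sub>R Y_field \<phi> (?F p))"
        using sl sm by blast
    qed
  qed
  then show ?thesis
    using vector_field by (simp add: infinitesimal_para_CR_automorphism_def)
qed

end

subsection \<open>The two foliations\<close>

text \<open>Treats both line fields at once: for the leaves tangent to \<open>X\<close> take \<open>P = snd\<close>, for those tangent
  to \<open>Y\<close> take \<open>P = fst\<close>; the leaves are the level sets of \<open>P\<close> on the hypersurface.\<close>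

locale leaves = vector_field_on_M +
  fixes P :: "R4 \<Rightarrow> real \<times> real" and J :: "real \<times> real \<Rightarrow> R4" and Z :: "R3 \<Rightarrow> R3"
  assumes bounded_linear_P: "bounded_linear P"
    and P_J: "\<And>u. P (J u) = u" and norm_P: "\<And>p. norm (P p) \<le> norm p" and norm_J: "\<And>u. norm (J u) = norm u"
    and kernel: "\<And>q h. q \<in> N \<Longrightarrow> P (Dparam q h) = 0 \<longleftrightarrow> (\<exists>a. h = a *\<^sub>R Z q)"
    and curve: "\<And>q. q \<in> N \<Longrightarrow> \<exists>\<kappa> \<kappa>' e a. 0 < e \<and> \<kappa> 0 = q \<and> a \<noteq> 0 \<and> \<kappa>' 0 = a *\<^sub>R Z q \<and>
      (\<forall>s. \<bar>s\<bar> < e \<longrightarrow> \<kappa> s \<in> N \<and> (\<kappa> has_vector_derivative \<kappa>' s) (at s) \<and> P (param \<phi> (\<kappa> s)) = P (param \<phi> q))"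
begin

lemma linear_P: "linear P"
  using bounded_linear_P by (rule bounded_linear.linear)

lemma P_param_derivative:
  assumes "q \<in> N"
  shows "((\<lambda>q. P (param \<phi> q)) has_derivative (\<lambda>h. P (Dparam q h))) (at q)"
  by (rule bounded_linear.has_derivative[OF bounded_linear_P param_derivative[OF assms]])

lemma P_param_vector_derivative:
  assumes "c t \<in> N" "(c has_vector_derivative c') (at t within I)"
  shows "((\<lambda>t. P (param \<phi> (c t))) has_vector_derivative P (Dparam (c t) c')) (at t within I)"
  using vector_derivative_diff_chain_within[OF assms(2)
      has_derivative_at_withinI[OF P_param_derivative[OF assms(1)]]]
  by (simp add: o_def)

text \<open>Since \<open>P\<close> is constant along the curve, \<open>P\<close> kills its velocity
  at every time and not only at 0, so by \<open>kernel\<close> the velocity is a multiple of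
  \<open>Z\<close> throughout.\<close>

lemma curve_in_ball:
  assumes "q \<in> N" "0 < r"
  obtains \<kappa> \<kappa>' e a where "0 < e" "\<kappa> 0 = q" "a \<noteq> 0" "\<kappa>' 0 = a *\<^sub>R Z q"
    "\<And>s. \<bar>s\<bar> < e \<Longrightarrow> \<kappa> s \<in> N \<and> \<kappa> s \<in> ball q r" "\<And>s. \<bar>s\<bar> < e \<Longrightarrow> (\<kappa> has_vector_derivative \<kappa>' s) (at s)"
    "\<And>s. \<bar>s\<bar> < e \<Longrightarrow> P (param \<phi> (\<kappa> s)) = P (param \<phi> q)"
    "\<And>s. \<bar>s\<bar> < e \<Longrightarrow> \<exists>b. \<kappa>' s = b *\<^sub>R Z (\<kappa> s)"
proof -
  obtain \<kappa> \<kappa>' e a where \<kappa>: "0 < e" "\<kappa> 0 = q" "a \<noteq> 0" "\<kappa>' 0 = a *\<^sub>R Z q"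
    "\<And>s. \<bar>s\<bar> < e \<Longrightarrow> \<kappa> s \<in> N" "\<And>s. \<bar>s\<bar> < e \<Longrightarrow> (\<kappa> has_vector_derivative \<kappa>' s) (at s)"
    "\<And>s. \<bar>s\<bar> < e \<Longrightarrow> P (param \<phi> (\<kappa> s)) = P (param \<phi> q)"
    using curve[OF assms(1)] by blast
  have "continuous (at 0) \<kappa>"
    using has_vector_derivative_continuous[OF \<kappa>(6)[of 0]] \<kappa>(1) by simp
  then obtain d where d: "0 < d" "\<And>s. dist s 0 < d \<Longrightarrow> dist (\<kappa> s) (\<kappa> 0) < r"
    using assms(2) unfolding continuous_at_eps_delta by blast
  show thesis
  proof (rule that[of "min e d" \<kappa> a \<kappa>'])
    fix s :: real assume s: "\<bar>s\<bar> < min e d"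
    then show "\<kappa> s \<in> N \<and> \<kappa> s \<in> ball q r" using \<kappa>(2,5) d(2)[of s] by (simp add: dist_commute)
    have "((\<lambda>s. P (param \<phi> (\<kappa> s))) has_vector_derivative P (Dparam (\<kappa> s) (\<kappa>' s))) (at s)"
      using s by (intro P_param_vector_derivative \<kappa>) auto
    moreover have "((\<lambda>s. P (param \<phi> (\<kappa> s))) has_vector_derivative 0) (at s)"
      by (rule has_vector_derivative_transform_within_open[of "\<lambda>s. P (param \<phi> q)" _ _ "{-e<..<e}"])
        (use s \<kappa>(7) in auto)
    ultimately have "P (Dparam (\<kappa> s) (\<kappa>' s)) = 0" by (rule vector_derivative_unique_at)
    then show "\<exists>b. \<kappa>' s = b *\<^sub>R Z (\<kappa> s)" using kernel \<kappa>(5)[of s] s by simp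
  qed (use \<kappa> d in auto)
qed

lemma preserves_imp_projected_derivative_zero:
  assumes "preserves Z" "q \<in> U'"
  shows "frechet_derivative (\<lambda>q. P (V (param \<phi> q))) (at q) (Z q) = 0"
proof -
  have qN: "q \<in> N" using assms(2) U'_subset by blast
  obtain r T where rT: "0 < r" "0 < T" "ball q r \<subseteq> U'"
    "\<And>x. x \<in> ball q r \<Longrightarrow> solution (U' \<inter> ball q 1) v {-T..T} (\<lambda>t. fl t x)"
    "\<And>x. x \<in> ball q r \<Longrightarrow> fl 0 x = x"
    "\<And>x t. x \<in> ball q r \<Longrightarrow> t \<in> {-T..T} \<Longrightarrow> x \<in> fldom t"
    using local_flow[OF assms(2) zero_less_one] by metis
  obtain \<kappa> \<kappa>' e a where \<kappa>: "0 < e" "\<kappa> 0 = q" "a \<noteq> 0" "\<kappa>' 0 = a *\<^sub>R Z q"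
    "\<And>s. \<bar>s\<bar> < e \<Longrightarrow> \<kappa> s \<in> N \<and> \<kappa> s \<in> ball q r" "\<And>s. \<bar>s\<bar> < e \<Longrightarrow> (\<kappa> has_vector_derivative \<kappa>' s) (at s)"
    "\<And>s. \<bar>s\<bar> < e \<Longrightarrow> \<exists>b. \<kappa>' s = b *\<^sub>R Z (\<kappa> s)"
    using curve_in_ball[OF qN rT(1)] by metis
  \<comment> \<open>For fixed \<open>t\<close> the image curve again has a multiple of
    \<open>Z\<close> as velocity, because the flow preserves \<open>Z\<close>, and \<open>P\<close>
    kills it.\<close>
  have const: "P (param \<phi> (fl t (\<kappa> s))) = P (param \<phi> (fl t q))" if s: "\<bar>s\<bar> < e" and t: "t \<in> {-T..T}" for s t
  proof -
    let ?I = "{-e<..<e}"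
    have "((\<lambda>s. P (param \<phi> (fl t (\<kappa> s)))) has_vector_derivative 0) (at u within ?I)" if "u \<in> ?I" for u
    proof -
      have u: "\<bar>u\<bar> < e" using that by auto
      have udom: "\<kappa> u \<in> fldom t" using rT(6) \<kappa>(5)[OF u] t by blast
      obtain b c where b: "\<kappa>' u = b *\<^sub>R Z (\<kappa> u)"
        and c: "frechet_derivative (fl t) (at (\<kappa> u)) (Z (\<kappa> u)) = c *\<^sub>R Z (fl t (\<kappa> u))"
        using \<kappa>(7)[OF u] assms(1) udom unfolding preserves_def by blast
      have lin: "linear (frechet_derivative (fl t) (at (\<kappa> u)))"
        by (rule has_derivative_linear[OF flow_map_derivative[OF udom]])
      have "((\<lambda>s. fl t (\<kappa> s)) has_vector_derivative frechet_derivative (fl t) (at (\<kappa> u)) (\<kappa>' u)) (at u)"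
        using vector_derivative_diff_chain_within[OF \<kappa>(6)[OF u]
            has_derivative_at_withinI[OF flow_map_derivative[OF udom]]] by (simp add: o_def)
      then have "((\<lambda>s. P (param \<phi> (fl t (\<kappa> s)))) has_vector_derivative
          P (Dparam (fl t (\<kappa> u)) (frechet_derivative (fl t) (at (\<kappa> u)) (\<kappa>' u)))) (at u)"
        by (rule P_param_vector_derivative[where c = "\<lambda>s. fl t (\<kappa> s)", OF fl_in_N[OF udom]])
      moreover have "frechet_derivative (fl t) (at (\<kappa> u)) (\<kappa>' u) = (b * c) *\<^sub>R Z (fl t (\<kappa> u))"
        using b c by (simp add: linear_scale[OF lin])
      then have "P (Dparam (fl t (\<kappa> u)) (frechet_derivative (fl t) (at (\<kappa> u)) (\<kappa>' u))) = 0"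
        using kernel[OF fl_in_N[OF udom]] by blast
      ultimately show ?thesis by (simp add: has_vector_derivative_at_within)
    qed
    then have "norm (P (param \<phi> (fl t (\<kappa> s))) - P (param \<phi> (fl t (\<kappa> 0)))) \<le> 0 * \<bar>s - 0\<bar>"
      using s \<kappa>(1) by (intro vector_derivative_bound[where I = ?I]) auto
    then show ?thesis using \<kappa>(2) by simp
  qed
  \<comment> \<open>By \<open>const\<close> the projected trajectories of \<open>\<kappa> s\<close>
    and of \<open>q\<close> coincide on a time interval around 0, so their velocities at time 0
    agree.\<close>
  have PV: "P (V (param \<phi> (\<kappa> s))) = P (V (param \<phi> q))" if s: "\<bar>s\<bar> < e" for s
  proof -
    have der: "((\<lambda>t. P (param \<phi> (fl t x))) has_vector_derivative P (V (param \<phi> x))) (at 0 within {-T..T})"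
      if x: "x \<in> ball q r" for x
    proof -
      have "solution U' v {-T..T} (\<lambda>t. fl t x)" using rT(4)[OF x] by (rule solution_mono) auto
      from param_solution_derivative[OF this, of 0] rT(2) rT(5)[OF x]
      show ?thesis by (intro bounded_linear.has_vector_derivative[OF bounded_linear_P]) auto
    qed
    have d1: "((\<lambda>t. P (param \<phi> (fl t q))) has_vector_derivative P (V (param \<phi> (\<kappa> s)))) (at 0 within {-T..T})"
      by (rule has_vector_derivative_transform[OF _ _ der]) (use const[OF s] \<kappa>(5)[OF s] rT(2) in auto)
    have d2: "((\<lambda>t. P (param \<phi> (fl t q))) has_vector_derivative P (V (param \<phi> q))) (at 0 within {-T..T})"
      using der rT(1) by simp
    show ?thesis
      by (rule vector_derivative_unique_within_closed_interval[of "-T" T 0]) (use d1 d2 rT(2) in auto)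
  qed
  let ?f = "\<lambda>q. P (V (param \<phi> q))"
  have D: "(?f has_derivative frechet_derivative ?f (at q)) (at q)"
    by (rule smooth_on_imp_has_derivative[OF smooth_on_compose_linear[OF openU' bounded_linear_P smooth_on_V] assms(2)])
  have "((?f \<circ> \<kappa>) has_vector_derivative frechet_derivative ?f (at q) (\<kappa>' 0)) (at 0)"
    using vector_derivative_diff_chain_within[OF \<kappa>(6)[of 0], of ?f] D \<kappa>(1,2)
    by (simp add: has_derivative_at_withinI)
  moreover have "((?f \<circ> \<kappa>) has_vector_derivative 0) (at 0)"
    by (rule has_vector_derivative_transform_within_open[of "\<lambda>s. ?f q" _ _ "{-e<..<e}"])
      (use \<kappa>(1) PV in auto)
  ultimately have "frechet_derivative ?f (at q) (\<kappa>' 0) = 0" by (rule vector_derivative_unique_at)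
  then show ?thesis
    using \<kappa>(3,4) linear_scale[OF has_derivative_linear[OF D]] by simp
qed

text \<open>The estimate stands in for a differential equation in the plane: the projected
  difference of two trajectories starting on one leaf vanishes at time 0, and its derivative is at
  most \<open>L\<close> times itself, so it stays 0. Applied to a curve in the leaf, this puts the
  image of \<open>Z\<close> into the kernel of \<open>P\<close>.\<close>

lemma projected_lipschitz_imp_preserves:
  assumes "\<And>p. p \<in> U \<Longrightarrow> \<exists>r>0. \<exists>L\<ge>0. \<forall>p1\<in>ball p r \<inter> U. \<forall>p2\<in>ball p r \<inter> U. norm (P (V p1) - P (V p2)) \<le> L * norm (P p1 - P p2)"
  shows "preserves Z"
  unfolding preserves_def
proof (intro allI ballI flow_preserves_line_field)
  fix q assume q: "q \<in> U'"
  then have qN: "q \<in> N" using U'_subset by blast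
  obtain r L where r: "0 < r" "0 \<le> L"
    and lip: "\<And>p1 p2. p1 \<in> ball (param \<phi> q) r \<inter> U \<Longrightarrow> p2 \<in> ball (param \<phi> q) r \<inter> U \<Longrightarrow>
      norm (P (V p1) - P (V p2)) \<le> L * norm (P p1 - P p2)"
    using assms[OF param_in_U[OF q]] by blast
  have "isCont (param \<phi>) q"
    using param_derivative[OF qN] has_derivative_continuous by blast
  then obtain \<rho> where \<rho>: "0 < \<rho>" "\<And>x. dist x q < \<rho> \<Longrightarrow> dist (param \<phi> x) (param \<phi> q) < r"
    using r(1) unfolding continuous_at_eps_delta by blast
  obtain r1 T1 where r1: "0 < r1" "0 < T1" "ball q r1 \<subseteq> U'"
    "\<And>x. x \<in> ball q r1 \<Longrightarrow> solution (U' \<inter> ball q \<rho>) v {-T1..T1} (\<lambda>t. fl t x)"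
    "\<And>x. x \<in> ball q r1 \<Longrightarrow> fl 0 x = x"
    "\<And>x t. x \<in> ball q r1 \<Longrightarrow> t \<in> {-T1..T1} \<Longrightarrow> x \<in> fldom t"
    using local_flow[OF q \<rho>(1)] by metis
  define T where "T = min T1 (1 / (2 * (L + 1)))"
  have T: "0 < T" "L * T \<le> 1 / 2" "T \<le> T1"
  proof -
    show "0 < T" using r1 r by (simp add: T_def)
    have "L * T \<le> (L + 1) * (1 / (2 * (L + 1)))"
      using \<open>0 < T\<close> r(2) by (intro mult_mono) (auto simp: T_def)
    also have "\<dots> = 1 / 2" using r(2) by (simp add: field_simps)
    finally show "L * T \<le> 1 / 2" .
  qed (simp add: T_def)
  have "\<exists>a. frechet_derivative (fl \<tau>) (at x) (Z x) = a *\<^sub>R Z (fl \<tau> x)"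
    if x: "x \<in> ball q r1" and \<tau>: "\<tau> \<in> {-T..T}" for x \<tau>
  proof -
    have xN: "x \<in> N" using x r1(3) U'_subset by blast
    have xdom: "x \<in> fldom \<tau>" using r1(6)[OF x] \<tau> T(3) by auto
    \<comment> \<open>This radius keeps the curve through \<open>x\<close> inside the ball around
      \<open>q\<close> on which the local flow is controlled.\<close>
    have "0 < r1 - dist q x" using x by simp
    from curve_in_ball[OF xN this]
    obtain \<kappa> \<kappa>' e a where \<kappa>: "0 < e" "\<kappa> 0 = x" "a \<noteq> 0" "\<kappa>' 0 = a *\<^sub>R Z x"
      "\<And>s. \<bar>s\<bar> < e \<Longrightarrow> \<kappa> s \<in> N \<and> \<kappa> s \<in> ball x (r1 - dist q x)" "\<And>s. \<bar>s\<bar> < e \<Longrightarrow> (\<kappa> has_vector_derivative \<kappa>' s) (at s)"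
      "\<And>s. \<bar>s\<bar> < e \<Longrightarrow> P (param \<phi> (\<kappa> s)) = P (param \<phi> x)"
      by metis
    have const: "P (param \<phi> (fl \<tau> (\<kappa> s))) = P (param \<phi> (fl \<tau> x))" if s: "\<bar>s\<bar> < e" for s
    proof -
      have y: "\<kappa> s \<in> ball q r1"
        using \<kappa>(5)[OF s] dist_triangle[of q "\<kappa> s" x] by auto
      have sol: "solution (U' \<inter> ball q \<rho>) v {-T..T} (\<lambda>t. fl t z)" if "z \<in> ball q r1" for z
        by (rule solution_subset[OF r1(4)[OF that]]) (use T in auto)
      have "norm (P (param \<phi> (fl \<tau> (\<kappa> s))) - P (param \<phi> (fl \<tau> x))) \<le> 2 * T * 0"
      proof (rule short_time_bound[where I = "{-T..T}" and s = 0 and L = L and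
            f' = "\<lambda>t. P (V (param \<phi> (fl t (\<kappa> s)))) - P (V (param \<phi> (fl t x)))"])
        fix t assume t: "t \<in> {-T..T}"
        have der: "((\<lambda>t. P (param \<phi> (fl t z))) has_vector_derivative P (V (param \<phi> (fl t z)))) (at t within {-T..T})"
          and mem: "param \<phi> (fl t z) \<in> ball (param \<phi> q) r \<inter> U" if "z \<in> ball q r1" for z
        proof -
          have "solution U' v {-T..T} (\<lambda>t. fl t z)" using sol[OF that] by (rule solution_mono) auto
          from bounded_linear.has_vector_derivative[OF bounded_linear_P param_solution_derivative[OF this t]]
          show "((\<lambda>t. P (param \<phi> (fl t z))) has_vector_derivative P (V (param \<phi> (fl t z)))) (at t within {-T..T})" .
          have "fl t z \<in> U' \<inter> ball q \<rho>" using sol[OF that] t by (simp add: solution_def)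
          then show "param \<phi> (fl t z) \<in> ball (param \<phi> q) r \<inter> U"
            using \<rho>(2)[of "fl t z"] param_in_U by (auto simp: dist_commute)
        qed
        show "((\<lambda>t. P (param \<phi> (fl t (\<kappa> s))) - P (param \<phi> (fl t x))) has_vector_derivative
            P (V (param \<phi> (fl t (\<kappa> s)))) - P (V (param \<phi> (fl t x)))) (at t within {-T..T})"
          by (intro has_vector_derivative_diff der x y)
        show "norm (P (V (param \<phi> (fl t (\<kappa> s)))) - P (V (param \<phi> (fl t x)))) \<le>
            L * norm (P (param \<phi> (fl t (\<kappa> s))) - P (param \<phi> (fl t x))) + 0"
          using lip[OF mem[OF y] mem[OF x]] by simp
      next
        show "P (param \<phi> (fl 0 (\<kappa> s))) - P (param \<phi> (fl 0 x)) = 0"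
          using r1(5)[OF x] r1(5)[OF y] \<kappa>(7)[OF s] by simp
      qed (use T \<tau> r in auto)
      then show ?thesis by simp
    qed
    have "((\<lambda>s. P (param \<phi> (fl \<tau> (\<kappa> s)))) has_vector_derivative 0) (at 0)"
    proof (rule has_vector_derivative_transform_within_open)
      show "((\<lambda>s. P (param \<phi> (fl \<tau> x))) has_vector_derivative 0) (at 0)" by simp
      show "P (param \<phi> (fl \<tau> x)) = P (param \<phi> (fl \<tau> (\<kappa> s)))" if "s \<in> {-e<..<e}" for s
        using const[of s] that by (simp add: abs_less_iff)
    qed (use \<kappa>(1) in auto)
    moreover have "((\<lambda>s. P (param \<phi> (fl \<tau> (\<kappa> s)))) has_vector_derivative
        P (Dparam (fl \<tau> x) (frechet_derivative (fl \<tau>) (at x) (\<kappa>' 0)))) (at 0)"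
    proof -
      have "((fl \<tau> \<circ> \<kappa>) has_vector_derivative frechet_derivative (fl \<tau>) (at x) (\<kappa>' 0)) (at 0)"
        using vector_derivative_diff_chain_within[OF \<kappa>(6)[of 0], of "fl \<tau>"] \<kappa>(1,2) flow_map_derivative[OF xdom]
        by (simp add: has_derivative_at_withinI)
      from P_param_vector_derivative[OF _ this] show ?thesis
        using fl_in_N[OF xdom] \<kappa>(2) by (simp add: o_def)
    qed
    ultimately have "P (Dparam (fl \<tau> x) (frechet_derivative (fl \<tau>) (at x) (\<kappa>' 0))) = 0"
      using vector_derivative_unique_at by blast
    then obtain b where b: "frechet_derivative (fl \<tau>) (at x) (\<kappa>' 0) = b *\<^sub>R Z (fl \<tau> x)"
      using kernel[OF fl_in_N[OF xdom]] by blast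
    have "a *\<^sub>R frechet_derivative (fl \<tau>) (at x) (Z x) = b *\<^sub>R Z (fl \<tau> x)"
      using b \<kappa>(4) linear_scale[OF has_derivative_linear[OF flow_map_derivative[OF xdom]]] by simp
    then have "(1 / a) *\<^sub>R (a *\<^sub>R frechet_derivative (fl \<tau>) (at x) (Z x)) = (1 / a) *\<^sub>R (b *\<^sub>R Z (fl \<tau> x))"
      by (rule arg_cong)
    then have "frechet_derivative (fl \<tau>) (at x) (Z x) = (b / a) *\<^sub>R Z (fl \<tau> x)"
      using \<kappa>(3) by simp
    then show ?thesis by blast
  qed
  then show "\<exists>r>0. \<exists>T>0. \<forall>x\<in>ball q r. \<forall>\<tau>\<in>{-T..T}.
      \<exists>a. frechet_derivative (fl \<tau>) (at x) (Z x) = a *\<^sub>R Z (fl \<tau> x)"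
    using r1(1) T(1) by blast
qed

lemma para_holomorphic_imp_preserves:
  assumes "open D" "smooth_on D V" "U \<subseteq> D"
    and kill: "\<And>p h. p \<in> D \<Longrightarrow> P h = 0 \<Longrightarrow> frechet_derivative (\<lambda>p. P (V p)) (at p) h = 0"
  shows "preserves Z"
proof (rule projected_lipschitz_imp_preserves)
  fix p assume "p \<in> U"
  then have "p \<in> D" using assms(3) by blast
  have smooth_PV: "smooth_on D (\<lambda>p. P (V p))"
    by (rule smooth_on_compose_linear[OF assms(1) bounded_linear_P assms(2)])
  obtain r L where r: "0 < r" "0 \<le> L" "cball p r \<subseteq> D"
    and lip: "\<And>x y. x \<in> cball p r \<Longrightarrow> y \<in> cball p r \<Longrightarrow> norm (P (V x) - P (V y)) \<le> L * norm (x - y)"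
    using smooth_on_locally_lipschitz[OF assms(1) smooth_PV \<open>p \<in> D\<close>] by metis
  have "norm (P (V p1) - P (V p2)) \<le> L * norm (P p1 - P p2)"
    if p1: "p1 \<in> ball p (r / 3)" and p2: "p2 \<in> ball p (r / 3)" for p1 p2
  proof -
    \<comment> \<open>\<open>p3\<close> has the same projection as \<open>p2\<close> and lies at
      distance \<open>norm (P p1 - P p2)\<close> from \<open>p1\<close>. Between \<open>p1\<close>
      and \<open>p3\<close> the Lipschitz bound applies; from \<open>p3\<close> to \<open>p2\<close>
      the direction is killed, so the projection of \<open>V\<close> does not change. The radius
      \<open>r / 3\<close> keeps \<open>p3\<close>, which may lie off \<open>M\<close>, in the ball
      of radius \<open>r\<close>.\<close>
    define p3 where "p3 = p1 + J (P p2 - P p1)"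
    have d13: "norm (p1 - p3) = norm (P p1 - P p2)" by (simp add: p3_def norm_J norm_minus_commute)
    have P3: "P (p2 - p3) = 0" by (simp add: p3_def linear_diff[OF linear_P] linear_add[OF linear_P] P_J)
    have "norm (P p1 - P p2) \<le> norm (p1 - p2)"
      using norm_P[of "p1 - p2"] by (simp add: linear_diff[OF linear_P])
    then have "dist p1 p3 < 2 * (r / 3)"
      using d13 p1 p2 dist_triangle[of p1 p2 p] by (simp add: dist_norm[symmetric] dist_commute)
    then have p3: "p3 \<in> ball p r" using p1 dist_triangle[of p p3 p1] by simp
    have p12: "p1 \<in> ball p r" "p2 \<in> ball p r" using p1 p2 r(1) by auto
    have "norm (P (V (p3 + 1 *\<^sub>R (p2 - p3))) - P (V (p3 + 0 *\<^sub>R (p2 - p3)))) \<le> 0 * \<bar>1 - 0\<bar>"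
    proof (rule vector_derivative_bound[where I = "{0..1}" and f' = "\<lambda>_. 0"])
      fix s :: real assume s: "s \<in> {0..1}"
      have "(1 - s) *\<^sub>R p3 + s *\<^sub>R p2 \<in> ball p r"
        by (rule convexD[OF convex_ball p3 p12(2)]) (use s in auto)
      then have "p3 + s *\<^sub>R (p2 - p3) \<in> ball p r" by (simp add: algebra_simps)
      then have mem: "p3 + s *\<^sub>R (p2 - p3) \<in> D" using r(3) by auto
      have "((\<lambda>s. p3 + s *\<^sub>R (p2 - p3)) has_vector_derivative (p2 - p3)) (at s within {0..1})"
        by (auto intro!: derivative_eq_intros)
      from vector_derivative_diff_chain_within[OF this
          has_derivative_at_withinI[OF smooth_on_imp_has_derivative[OF smooth_PV mem]]]
      show "((\<lambda>s. P (V (p3 + s *\<^sub>R (p2 - p3)))) has_vector_derivative 0) (at s within {0..1})"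
        by (simp add: o_def kill[OF mem P3])
    qed auto
    then have "P (V p3) = P (V p2)" by simp
    then have "norm (P (V p1) - P (V p2)) = norm (P (V p1) - P (V p3))" by simp
    also have "\<dots> \<le> L * norm (p1 - p3)" using p12 p3 by (intro lip) auto
    finally show ?thesis by (simp add: d13)
  qed
  then show "\<exists>r>0. \<exists>L\<ge>0. \<forall>p1\<in>ball p r \<inter> U. \<forall>p2\<in>ball p r \<inter> U. norm (P (V p1) - P (V p2)) \<le> L * norm (P p1 - P p2)"
    using r by (intro exI[of _ "r / 3"] conjI exI[of _ L]) auto
qed

end

section \<open>The straightening chart and curves inside the leaves\<close>

context para_CR
begin

text \<open>The chart \<open>(a, b, x) \<mapsto> (y, b, x)\<close> of the hypersurface straightens the leaves of \<open>Y\<close>.\<close>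

definition G :: "R3 \<Rightarrow> R3" where
  "G q = (fst q + \<phi> q, snd q)"

definition DG :: "R3 \<Rightarrow> R3 \<Rightarrow> R3" where
  "DG q h = ((1 + d_a \<phi> q) * fst h + d_b \<phi> q * fst (snd h) + d_x q * snd (snd h), snd h)"

definition DG_inv :: "R3 \<Rightarrow> R3 \<Rightarrow> R3" where
  "DG_inv q k = ((fst k - d_b \<phi> q * fst (snd k) - d_x q * snd (snd k)) * inverse (1 + d_a \<phi> q), snd k)"

lemma fst_param: "fst (param \<phi> q) = (snd (snd (G q)), fst (G q))"
  by (simp add: G_def param_eq)

lemma G_derivative: "q \<in> N \<Longrightarrow> (G has_derivative DG q) (at q)"
  unfolding G_def[abs_def] DG_def[abs_def]
  by (auto intro!: derivative_eq_intros phi_derivative simp: algebra_simps)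

lemma bounded_linear_DG: "bounded_linear (DG q)" and bounded_linear_DG_inv: "bounded_linear (DG_inv q)"
  unfolding DG_def[abs_def] DG_inv_def[abs_def]
  by (intro bounded_linear_intros)+

lemma DG_inverse: "q \<in> N \<Longrightarrow> DG_inv q (DG q h) = h" "q \<in> N \<Longrightarrow> DG q (DG_inv q k) = k"
  using transversal[of q] by (auto simp: DG_def DG_inv_def field_simps prod_eq_iff)

text \<open>The derivative of \<open>G\<close> is triangular, so its inverse is explicit. Smoothness
  of the local inverse \<open>H\<close> bootstraps: its derivative \<open>DG_inv (H w)\<close>
  depends smoothly on \<open>H w\<close>, hence is as differentiable as \<open>H\<close> is already
  known to be.\<close>

lemma G_local_inverse:
  assumes "q \<in> N"
  obtains B H where "open B" "G q \<in> B" "H (G q) = q"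
    "\<And>w. w \<in> B \<Longrightarrow> H w \<in> N" "\<And>w. w \<in> B \<Longrightarrow> G (H w) = w"
    "\<And>w. w \<in> B \<Longrightarrow> (H has_derivative DG_inv (H w)) (at w)" "smooth_on B H"
proof -
  have ap: "blinfun_apply (Blinfun (DG q)) = DG q" "blinfun_apply (Blinfun (DG_inv q)) = DG_inv q" for q
    by (simp_all add: bounded_linear_Blinfun_apply bounded_linear_DG bounded_linear_DG_inv)
  have cont: "continuous_on N (\<lambda>q. Blinfun (DG q))"
  proof (rule continuous_on_blinfun_componentwise)
    fix i :: R3
    have "continuous_on N (\<lambda>q. DG q i)"
      unfolding DG_def
      by (intro continuous_intros smooth_on_imp_continuous_on smooth_on_d_a smooth_on_d_b smooth_on_d_x)
    then show "continuous_on N (\<lambda>q. blinfun_apply (Blinfun (DG q)) i)" by (simp add: ap)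
  qed
  have inv0: "Blinfun (DG_inv q) o\<^sub>L Blinfun (DG q) = id_blinfun"
    by (rule blinfun_eqI) (simp add: ap DG_inverse assms)
  have der: "(G has_derivative blinfun_apply (Blinfun (DG x))) (at x)" if "x \<in> N" for x
    using G_derivative[OF that] by (simp add: ap)
  show thesis
  proof (rule inverse_function_theorem[OF openN der cont assms inv0])
    fix A B H g'
    assume AB: "open A" "A \<subseteq> N" "q \<in> A" "open B" "G q \<in> B" "homeomorphism A B G H"
      and H: "\<And>w. w \<in> B \<Longrightarrow> (H has_derivative g' w) (at w)"
      and g': "\<And>w. w \<in> B \<Longrightarrow> g' w = inv (blinfun_apply (Blinfun (DG (H w))))"
    have HN: "H w \<in> N" if "w \<in> B" for w
      using AB(2,6) that unfolding homeomorphism_def by blast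
    have GH: "G (H w) = w" if "w \<in> B" for w
      using AB(6) that unfolding homeomorphism_def by blast
    have "inv (DG (H w)) = DG_inv (H w)" if "w \<in> B" for w
      by (rule inv_equality) (simp_all add: DG_inverse HN that)
    then have H': "(H has_derivative DG_inv (H w)) (at w)" if "w \<in> B" for w
      using H[OF that] g'[OF that] that by (simp add: ap)
    have "k_differentiable_on k B H" for k
    proof (induction k)
      case 0
      show ?case
        by (auto intro!: continuous_at_imp_continuous_on has_derivative_continuous[OF H'])
    next
      case (Suc k)
      have c: "k_differentiable_on k B (\<lambda>w. f (H w))" if "smooth_on N f" for f :: "R3 \<Rightarrow> real"
        by (rule k_differentiable_on_compose[OF AB(4) openN _ _ Suc]) (use that HN in \<open>auto simp: smooth_on_def\<close>)
      show ?case
      proof (rule k_differentiable_on_SucI[OF AB(4) H'])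
        fix h :: R3
        note mult = k_differentiable_on_bilinear[OF AB(4) bounded_bilinear_mult]
        have "k_differentiable_on k B (\<lambda>w. - (d_b \<phi> (H w) * fst (snd h)))"
          "k_differentiable_on k B (\<lambda>w. - (d_x (H w) * snd (snd h)))"
          by (intro k_differentiable_on_compose_linear[OF AB(4) bounded_linear_minus[OF bounded_linear_ident]]
              mult c smooth_on_d_b smooth_on_d_x k_differentiable_on_const)+
        moreover have "k_differentiable_on k B (\<lambda>w. inverse (1 + d_a \<phi> (H w)))"
          by (intro k_differentiable_on_inverse k_differentiable_on_add AB(4) k_differentiable_on_const
              c smooth_on_d_a transversal HN)
        ultimately have "k_differentiable_on k B (\<lambda>w. ((fst h + - (d_b \<phi> (H w) * fst (snd h)) +
            - (d_x (H w) * snd (snd h))) * inverse (1 + d_a \<phi> (H w)), snd h))"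
          by (intro k_differentiable_on_Pair k_differentiable_on_const mult k_differentiable_on_add AB(4))
        then show "k_differentiable_on k B (\<lambda>w. DG_inv (H w) h)" by (simp add: DG_inv_def)
      qed
    qed
    then have smooth_H: "smooth_on B H" by (simp add: smooth_on_def)
    have "H (G q) = q" using AB(3,6) unfolding homeomorphism_def by blast
    from that[OF AB(4,5) this HN GH H' smooth_H] show thesis .
  qed
qed

lemma kernel_X: "snd (Dparam q h) = 0 \<longleftrightarrow> (\<exists>a. h = a *\<^sub>R (0, 0, 1))"
  by (cases h) (auto simp: Dparam_def zero_prod_def)

lemma kernel_Y:
  assumes "q \<in> N"
  shows "fst (Dparam q h) = 0 \<longleftrightarrow> (\<exists>a. h = a *\<^sub>R (- d_b \<phi> q, 1 + d_a \<phi> q, 0))"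
proof
  obtain \<alpha> \<beta> \<xi> where h: "h = (\<alpha>, \<beta>, \<xi>)" by (cases h)
  assume "fst (Dparam q h) = 0"
  then have "\<xi> = 0" "(1 + d_a \<phi> q) * \<alpha> + d_b \<phi> q * \<beta> = 0" by (auto simp: Dparam_def h zero_prod_def)
  then show "\<exists>a. h = a *\<^sub>R (- d_b \<phi> q, 1 + d_a \<phi> q, 0)"
    using transversal[OF assms]
    by (intro exI[of _ "\<beta> / (1 + d_a \<phi> q)"]) (simp add: h field_simps eq_neg_iff_add_eq_0)
qed (auto simp: Dparam_def zero_prod_def algebra_simps)

lemma curve_X:
  assumes "q \<in> N"
  shows "\<exists>\<kappa> \<kappa>' e a. 0 < e \<and> \<kappa> 0 = q \<and> a \<noteq> 0 \<and> \<kappa>' 0 = a *\<^sub>R (0, 0, 1) \<and>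
    (\<forall>s. \<bar>s\<bar> < e \<longrightarrow> \<kappa> s \<in> N \<and> (\<kappa> has_vector_derivative \<kappa>' s) (at s) \<and>
      snd (param \<phi> (\<kappa> s)) = snd (param \<phi> q))"
proof -
  obtain e where e: "0 < e" "ball q e \<subseteq> N" using openN assms openE by blast
  let ?\<kappa> = "\<lambda>s. q + s *\<^sub>R (0, 0, 1)"
  have "?\<kappa> s \<in> N \<and> (?\<kappa> has_vector_derivative (0, 0, 1)) (at s) \<and>
      snd (param \<phi> (?\<kappa> s)) = snd (param \<phi> q)" if "\<bar>s\<bar> < e" for s
  proof (intro conjI)
    have "?\<kappa> s \<in> ball q e" using that by (simp add: dist_norm norm_Pair)
    then show "?\<kappa> s \<in> N" using e(2) by blast
    have "((\<lambda>s. q + s *\<^sub>R w) has_vector_derivative w) (at s)" for w :: R3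
      by (auto intro!: derivative_eq_intros)
    then show "(?\<kappa> has_vector_derivative (0, 0, 1)) (at s)" .
    show "snd (param \<phi> (?\<kappa> s)) = snd (param \<phi> q)" by (simp add: param_eq)
  qed
  with e(1) show ?thesis
    by - (rule exI[of _ ?\<kappa>], rule exI[of _ "\<lambda>_. (0, 0, 1)"], rule exI[of _ e], rule exI[of _ 1],
        auto simp: zero_prod_def[symmetric])
qed

lemma DG_inv_b: "q \<in> N \<Longrightarrow> DG_inv q (0, 1, 0) = inverse (1 + d_a \<phi> q) *\<^sub>R (- d_b \<phi> q, 1 + d_a \<phi> q, 0)"
  using transversal[of q] by (simp add: DG_inv_def)

text \<open>In the chart \<open>G\<close> the leaf is a line in the b-direction. Pulling this line
  back by \<open>H\<close> gives a curve whose velocity at \<open>q\<close> is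
  \<open>DG_inv q (0, 1, 0)\<close>, a nonzero multiple of \<open>Y\<close>.\<close>

lemma curve_Y:
  assumes "q \<in> N"
  shows "\<exists>\<kappa> \<kappa>' e a. 0 < e \<and> \<kappa> 0 = q \<and> a \<noteq> 0 \<and> \<kappa>' 0 = a *\<^sub>R (- d_b \<phi> q, 1 + d_a \<phi> q, 0) \<and>
    (\<forall>s. \<bar>s\<bar> < e \<longrightarrow> \<kappa> s \<in> N \<and> (\<kappa> has_vector_derivative \<kappa>' s) (at s) \<and>
      fst (param \<phi> (\<kappa> s)) = fst (param \<phi> q))"
proof -
  obtain B H where H: "open B" "G q \<in> B" "H (G q) = q" "\<And>w. w \<in> B \<Longrightarrow> H w \<in> N"
    "\<And>w. w \<in> B \<Longrightarrow> G (H w) = w" "\<And>w. w \<in> B \<Longrightarrow> (H has_derivative DG_inv (H w)) (at w)"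
    using G_local_inverse[OF assms] by metis
  obtain e where e: "0 < e" "ball (G q) e \<subseteq> B" using H(1,2) openE by blast
  let ?w = "\<lambda>s. G q + s *\<^sub>R (0, 1, 0)"
  let ?\<kappa> = "\<lambda>s. H (?w s)"
  have "?\<kappa> s \<in> N \<and> (?\<kappa> has_vector_derivative DG_inv (?\<kappa> s) (0, 1, 0)) (at s) \<and>
      fst (param \<phi> (?\<kappa> s)) = fst (param \<phi> q)" if "\<bar>s\<bar> < e" for s
  proof (intro conjI)
    have "?w s \<in> ball (G q) e" using that by (simp add: dist_norm norm_Pair)
    then have w: "?w s \<in> B" using e(2) by blast
    then show "?\<kappa> s \<in> N" by (rule H(4))
    have "((\<lambda>s. G q + s *\<^sub>R w) has_vector_derivative w) (at s)" for w :: R3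
      by (auto intro!: derivative_eq_intros)
    from vector_derivative_diff_chain_within[OF this has_derivative_at_withinI[OF H(6)[OF w]]]
    show "(?\<kappa> has_vector_derivative DG_inv (?\<kappa> s) (0, 1, 0)) (at s)" by (simp add: o_def)
    show "fst (param \<phi> (?\<kappa> s)) = fst (param \<phi> q)"
      unfolding fst_param H(5)[OF w] by simp
  qed
  then show ?thesis
    using e(1) H(3) DG_inv_b[OF assms] transversal[OF assms]
    by - (rule exI[of _ ?\<kappa>], rule exI[of _ "\<lambda>s. DG_inv (?\<kappa> s) (0, 1, 0)"], rule exI[of _ e],
        rule exI[of _ "inverse (1 + d_a \<phi> q)"], auto simp: zero_prod_def[symmetric])
qed

text \<open>The two segments share the end \<open>c\<close> and vary only in the first coordinate,
  so together they cover the segment from \<open>Q\<close> to \<open>Q'\<close>. On it the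
  derivative \<open>1 + d_a \<phi>\<close> has no zero, and Rolle's theorem forbids equal values at
  distinct ends.\<close>

lemma G_inj_on_segments:
  assumes "closed_segment c Q \<subseteq> N" "closed_segment c Q' \<subseteq> N" "snd c = snd Q" "G Q = G Q'"
  shows "Q = Q'"
proof -
  have False if seg: "closed_segment c Q \<subseteq> N" "closed_segment c Q' \<subseteq> N" "snd c = snd Q" "G Q = G Q'"
    and less: "fst Q < fst Q'" for c Q Q'
  proof -
    have snd_eq: "snd Q' = snd Q" using seg(4) by (simp add: G_def)
    have sub: "(z, snd Q) \<in> N" if z: "fst Q \<le> z" "z \<le> fst Q'" for z
    proof (cases "fst c \<le> z")
      case True
      then have "z \<in> closed_segment (fst c) (fst Q')" using z by (auto simp: closed_segment_eq_real_ivl)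
      then obtain u where "0 \<le> u" "u \<le> 1" "z = (1 - u) * fst c + u * fst Q'" by (auto simp: closed_segment_def)
      then have "(z, snd Q) = (1 - u) *\<^sub>R c + u *\<^sub>R Q'"
        by (intro prod_eqI) (simp_all add: snd_eq seg(3) algebra_simps flip: scaleR_left.add)
      then show ?thesis using seg(2) \<open>0 \<le> u\<close> \<open>u \<le> 1\<close> by (auto simp: closed_segment_def)
    next
      case False
      then have "z \<in> closed_segment (fst c) (fst Q)" using z by (auto simp: closed_segment_eq_real_ivl)
      then obtain u where "0 \<le> u" "u \<le> 1" "z = (1 - u) * fst c + u * fst Q" by (auto simp: closed_segment_def)
      then have "(z, snd Q) = (1 - u) *\<^sub>R c + u *\<^sub>R Q"
        by (intro prod_eqI) (simp_all add: seg(3) algebra_simps flip: scaleR_left.add)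
      then show ?thesis using seg(1) \<open>0 \<le> u\<close> \<open>u \<le> 1\<close> by (auto simp: closed_segment_def)
    qed
    let ?f = "\<lambda>z. fst (G (z, snd Q))"
    have der: "(?f has_real_derivative 1 + d_a \<phi> (z, snd Q)) (at z)" if "fst Q \<le> z" "z \<le> fst Q'" for z
    proof -
      have "((\<lambda>z. (z, snd Q)) has_derivative (\<lambda>h. (h, 0))) (at z)"
        by (auto intro!: derivative_eq_intros)
      from has_derivative_fst[OF has_derivative_compose[OF this G_derivative[OF sub[OF that]]]]
      show ?thesis by (simp add: has_field_derivative_def DG_def mult_commute_abs)
    qed
    have "\<exists>z. fst Q < z \<and> z < fst Q' \<and> DERIV ?f z :> 0"
    proof (rule Rolle[OF less])
      show "?f (fst Q) = ?f (fst Q')" using seg(4) snd_eq by (metis prod.collapse)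
      show "continuous_on {fst Q..fst Q'} ?f"
        by (intro continuous_at_imp_continuous_on ballI DERIV_isCont[OF der]) auto
      show "?f differentiable (at z)" if "fst Q < z" "z < fst Q'" for z
        using der[of z] that by (auto simp: real_differentiable_def)
    qed
    then show False
      using der sub transversal by (metis DERIV_unique less_imp_le)
  qed
  moreover have "snd c = snd Q'" using assms(3,4) by (simp add: G_def)
  ultimately have "\<not> fst Q < fst Q'" "\<not> fst Q' < fst Q"
    using assms by metis+
  then show ?thesis using assms(4) by (simp add: G_def prod_eq_iff)
qed

end

lemma closed_segment_subset_open:
  fixes p q :: "'a::euclidean_space"
  assumes "closed_segment p q \<subseteq> U" "open U"
  obtains e where "0 < e" "\<And>p' q'. dist p' p < e \<Longrightarrow> dist q' q < e \<Longrightarrow> closed_segment p' q' \<subseteq> U"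
proof -
  obtain e where e: "0 < e" "(\<Union>x\<in>closed_segment p q. ball x e) \<subseteq> U"
    using compact_subset_open_imp_ball_epsilon_subset[OF compact_segment assms(2,1)] by blast
  show thesis
  proof (rule that[OF e(1)])
    fix p' q' assume d: "dist p' p < e" "dist q' q < e"
    show "closed_segment p' q' \<subseteq> U"
    proof
      fix y assume "y \<in> closed_segment p' q'"
      then obtain u where u: "0 \<le> u" "u \<le> 1" "y = (1 - u) *\<^sub>R p' + u *\<^sub>R q'"
        by (auto simp: closed_segment_def)
      define x where "x = (1 - u) *\<^sub>R p + u *\<^sub>R q"
      have x: "x \<in> closed_segment p q" using u by (auto simp: x_def closed_segment_def)
      have "(1 - u) *\<^sub>R (p - p') + u *\<^sub>R (q - q') \<in> ball 0 e"
        by (rule convexD[OF convex_ball]) (use u d in \<open>auto simp: dist_norm norm_minus_commute\<close>)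
      moreover have "(1 - u) *\<^sub>R (p - p') + u *\<^sub>R (q - q') = x - y"
        by (simp add: x_def u(3) algebra_simps)
      ultimately have "x - y \<in> ball 0 e" by (simp only:)
      then have "y \<in> ball x e" by (simp add: dist_norm norm_minus_commute)
      then show "y \<in> U" using e(2) x by blast
    qed
  qed
qed

section \<open>Para-holomorphic extension off the hypersurface\<close>

context vector_field_on_M
begin

lemma leaves_X: "leaves N \<phi> U V snd (\<lambda>u. (0, u)) ZX"
proof (intro leaves.intro leaves_axioms.intro vector_field_on_M_axioms)
  show "bounded_linear snd" by (rule bounded_linear_snd)
  show "norm (snd p) \<le> norm p" for p :: R4 by (metis norm_snd_le prod.collapse)
  show "norm (0 :: real \<times> real, u) = norm u" for u :: "real \<times> real" by (simp add: norm_Pair)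
  show "snd (Dparam q h) = 0 \<longleftrightarrow> (\<exists>a. h = a *\<^sub>R ZX q)" for q h by (rule kernel_X)
qed (simp, rule curve_X)

lemma leaves_Y: "leaves N \<phi> U V fst (\<lambda>u. (u, 0)) ZY"
proof (intro leaves.intro leaves_axioms.intro vector_field_on_M_axioms)
  show "bounded_linear fst" by (rule bounded_linear_fst)
  show "norm (fst p) \<le> norm p" for p :: R4 by (metis norm_fst_le prod.collapse)
  show "norm (u, 0 :: real \<times> real) = norm u" for u :: "real \<times> real" by (simp add: norm_Pair)
  show "fst (Dparam q h) = 0 \<longleftrightarrow> (\<exists>a. h = a *\<^sub>R ZY q)" if "q \<in> N" for q h using that by (rule kernel_Y)
qed (simp, rule curve_Y)

text \<open>Slide along the leaf of \<open>\<partial>\<^sub>a\<close> through \<open>coords q\<close> inside \<open>U'\<close> to the point with the same \<open>y\<close> as \<open>q\<close>;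
  this point is unique although the leaf may meet \<open>U'\<close> in several intervals.\<close>

definition slide :: "R4 \<Rightarrow> R3 \<Rightarrow> bool" where
  "slide q Q \<longleftrightarrow> closed_segment (coords q) Q \<subseteq> U' \<and> G Q = (snd (fst q), snd (coords q))"

lemma slide_unique:
  assumes "slide q Q" "slide q Q'"
  shows "Q = Q'"
proof (rule G_inj_on_segments)
  show "closed_segment (coords q) Q \<subseteq> N" "closed_segment (coords q) Q' \<subseteq> N"
    using assms U'_subset unfolding slide_def by blast+
  have "G Q = (snd (fst q), snd (coords q))" using assms(1) unfolding slide_def by blast
  then show "snd (coords q) = snd Q" unfolding G_def by (metis snd_conv)
  show "G Q = G Q'" using assms unfolding slide_def by metis
qed

lemma slide_THE: "slide q Q \<Longrightarrow> (THE Q. slide q Q) = Q"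
  using slide_unique by blast

text \<open>Near a given slide the target is found by a local inverse of \<open>G\<close>, and the
  segment stays in \<open>U'\<close> under small perturbations of its ends. By uniqueness the target
  chosen in the extension is then a smooth function of (y, b, x) near each point.\<close>

lemma slide_local:
  assumes "slide q0 Q0"
  obtains E B H where "open E" "q0 \<in> E" "open B" "smooth_on B H"
    "\<forall>w\<in>B. (H has_derivative DG_inv (H w)) (at w)"
    "\<forall>q\<in>E. (snd (fst q), snd (coords q)) \<in> B \<and> slide q (H (snd (fst q), snd (coords q)))"
proof -
  let ?j = "\<lambda>q. (snd (fst q), snd (coords q))"
  have seg: "closed_segment (coords q0) Q0 \<subseteq> U'" and GQ0: "G Q0 = ?j q0"
    using assms by (auto simp: slide_def)
  then have "Q0 \<in> N" using U'_subset by auto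
  from G_local_inverse[OF this]
  obtain B H where H: "open B" "G Q0 \<in> B" "H (G Q0) = Q0" "\<And>w. w \<in> B \<Longrightarrow> G (H w) = w"
    "\<And>w. w \<in> B \<Longrightarrow> (H has_derivative DG_inv (H w)) (at w)" "smooth_on B H"
    by metis
  obtain e where e: "0 < e" "\<And>p' q'. dist p' (coords q0) < e \<Longrightarrow> dist q' Q0 < e \<Longrightarrow> closed_segment p' q' \<subseteq> U'"
    using closed_segment_subset_open[OF seg openU'] by metis
  have blj: "bounded_linear ?j"
    by (intro bounded_linear_Pair bounded_linear_compose[OF bounded_linear_snd bounded_linear_fst]
        bounded_linear_compose[OF bounded_linear_snd bounded_linear_coords])
  define B' where "B' = B \<inter> H -` ball Q0 e"
  define E where "E = ?j -` B' \<inter> coords -` ball (coords q0) e"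
  have "open B'"
    unfolding B'_def by (rule continuous_open_preimage[OF smooth_on_imp_continuous_on[OF H(6)] H(1) open_ball])
  then have "open E"
    unfolding E_def using linear_continuous_on[OF blj] linear_continuous_on[OF bounded_linear_coords]
    by (intro open_Int open_vimage) auto
  moreover have "q0 \<in> E" using H(2,3) GQ0 e(1) by (simp add: E_def B'_def)
  moreover have "?j q \<in> B \<and> slide q (H (?j q))" if "q \<in> E" for q
    using that e(2)[of "coords q" "H (?j q)"] H(4)[of "?j q"]
    by (simp add: E_def B'_def slide_def dist_commute)
  ultimately show thesis using that H(1,5,6) by blast
qed

lemma preserves_imp_extension:
  assumes "preserves ZX" "preserves ZY"
  shows "\<exists>D W. U \<subseteq> D \<and> para_holomorphic_on D W \<and> (\<forall>p\<in>U. W p = V p)"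
proof -
  define D where "D = {q. \<exists>Q. slide q Q}"
  \<comment> \<open>The (a,b)-component is read at the point of \<open>M\<close> with the
    coordinates of \<open>q\<close>, which ignores y; the (x,y)-component is read at the target of
    the slide, which locally depends only on (y, b, x). On \<open>U\<close> the slide is trivial, so
    both agree with \<open>V\<close>.\<close>
  define W where "W q = (fst (V (param \<phi> (THE Q. slide q Q))), snd (V (param \<phi> (coords q))))" for q
  have slide_U: "slide p (coords p)" if "p \<in> U" for p
  proof -
    have "fst (param \<phi> (coords p)) = fst p" using that by (simp add: param_coords)
    then have "fst (G (coords p)) = snd (fst p)" by (simp add: fst_param) (metis snd_conv)
    then show ?thesis using that by (simp add: slide_def G_def)
  qed
  have coords_D: "coords q \<in> U'" if "q \<in> D" for q
    using that ends_in_segment(1)[of "coords q"] unfolding D_def slide_def by blast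
  have openD: "open D"
  proof (subst open_subopen, rule ballI)
    fix q assume "q \<in> D"
    then obtain Q where "slide q Q" by (auto simp: D_def)
    then obtain E B H where "open E" "q \<in> E" "open B" "smooth_on B H"
      "\<forall>w\<in>B. (H has_derivative DG_inv (H w)) (at w)"
      "\<forall>q\<in>E. (snd (fst q), snd (coords q)) \<in> B \<and> slide q (H (snd (fst q), snd (coords q)))"
      by (rule slide_local)
    then show "\<exists>E. open E \<and> q \<in> E \<and> E \<subseteq> D" unfolding D_def by blast
  qed
  let ?f = "\<lambda>Q. fst (V (param \<phi> Q))" and ?g = "\<lambda>Q. snd (V (param \<phi> Q))"
  have smooth_f: "smooth_on U' ?f" and smooth_g: "smooth_on U' ?g"
    by (intro smooth_on_compose_linear[OF openU' bounded_linear_fst smooth_on_V]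
        smooth_on_compose_linear[OF openU' bounded_linear_snd smooth_on_V])+
  have fY: "frechet_derivative ?f (at Q) (ZY Q) = 0" and gX: "frechet_derivative ?g (at Q) (ZX Q) = 0"
    if "Q \<in> U'" for Q
    using leaves.preserves_imp_projected_derivative_zero[OF leaves_Y assms(2) that]
      leaves.preserves_imp_projected_derivative_zero[OF leaves_X assms(1) that] by auto
  let ?j = "\<lambda>q :: R4. (snd (fst q), snd (coords q))"
  have blj: "bounded_linear ?j"
    by (intro bounded_linear_Pair bounded_linear_compose[OF bounded_linear_snd bounded_linear_fst]
        bounded_linear_compose[OF bounded_linear_snd bounded_linear_coords])
  have local_fst: "\<exists>E. open E \<and> p \<in> E \<and> E \<subseteq> D \<and> smooth_on E (\<lambda>q. fst (W q)) \<and>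
      frechet_derivative (fst \<circ> W) (at p) ((0, 0), (1, 0)) = 0 \<and>
      frechet_derivative (fst \<circ> W) (at p) ((0, 0), (0, 1)) = 0" if p: "p \<in> D" for p
  proof -
    obtain Q where "slide p Q" using p by (auto simp: D_def)
    then obtain E B H where E: "open E" "p \<in> E" and B: "open B" "smooth_on B H"
      "\<forall>w\<in>B. (H has_derivative DG_inv (H w)) (at w)"
      and EB: "\<forall>q\<in>E. ?j q \<in> B \<and> slide q (H (?j q))"
      by (rule slide_local)
    note EB = bspec[OF EB]
    have ED: "E \<subseteq> D" using EB unfolding D_def by blast
    have HU: "H (?j q) \<in> U'" if "q \<in> E" for q
      using EB[OF that] ends_in_segment(2)[of "H (?j q)" "coords q"] unfolding slide_def by blast
    have eq: "fst (W q) = ?f (H (?j q))" if "q \<in> E" for q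
      by (simp only: W_def fst_conv slide_THE[OF conjunct2[OF EB[OF that]]])
    have "smooth_on E (\<lambda>q. H (?j q))"
      by (rule smooth_on_compose[OF E(1) B(1,2) smooth_on_linear[OF E(1) blj]]) (use EB in auto)
    then have "smooth_on E (\<lambda>q. ?f (H (?j q)))"
      by (rule smooth_on_compose[OF E(1) openU' smooth_f]) (use HU in auto)
    then have "smooth_on E (\<lambda>q. fst (W q))"
      by (rule smooth_on_cong[OF E(1), rotated]) (simp add: eq)
    moreover
    let ?Q = "H (?j p)"
    let ?F = "\<lambda>h. frechet_derivative ?f (at ?Q) (DG_inv ?Q (?j h))"
    have f': "(?f has_derivative frechet_derivative ?f (at ?Q)) (at ?Q)"
      by (rule smooth_on_imp_has_derivative[OF smooth_f HU[OF E(2)]])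
    have "((\<lambda>q. H (?j q)) has_derivative (\<lambda>h. DG_inv ?Q (?j h))) (at p)"
      by (rule has_derivative_compose[OF bounded_linear_imp_has_derivative[OF blj] bspec[OF B(3)]]) (use EB E in auto)
    then have "((\<lambda>q. ?f (H (?j q))) has_derivative ?F) (at p)"
      by (rule has_derivative_compose[where f = "\<lambda>q. H (?j q)" and g = ?f, OF _ f'])
    then have "((fst \<circ> W) has_derivative ?F) (at p)"
      by (rule has_derivative_transform_within_open[OF _ E]) (simp add: eq)
    then have F: "frechet_derivative (fst \<circ> W) (at p) = ?F" by (rule frechet_derivative_at[symmetric])
    have lin: "linear (frechet_derivative ?f (at ?Q))" using f' by (rule has_derivative_linear)
    have QN: "?Q \<in> N" using HU[OF E(2)] U'_subset by blast
    \<comment> \<open>The a-direction leaves \<open>(y, b, x)\<close> fixed, so the target of the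
      slide is stationary.\<close>
    have "?F ((0, 0), (1, 0)) = 0"
    proof -
      have "DG_inv Q' (?j ((0, 0), (1, 0))) = 0" for Q' by (simp add: coords_def DG_inv_def zero_prod_def)
      then show ?thesis by (simp only: linear_0[OF lin])
    qed
    \<comment> \<open>In the straightened chart the b-direction runs along the leaf of
      \<open>Y\<close>, on which this component of \<open>V\<close> has zero derivative.\<close>
    moreover have "?F ((0, 0), (0, 1)) = 0"
    proof -
      have "?j ((0, 0), (0, 1)) = (0, 1, 0)" by (simp add: coords_def)
      then show ?thesis
        by (simp only: DG_inv_b[OF QN] linear_scale[OF lin] fY[OF HU[OF E(2)]] scaleR_zero_right)
    qed
    ultimately show ?thesis using E ED F by (intro exI[of _ E]) simp
  qed
  have "smooth_on D (\<lambda>q. fst (W q))"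
    using local_fst by (intro smooth_on_local) blast
  moreover have smooth_snd: "smooth_on D (\<lambda>q. snd (W q))"
    unfolding W_def snd_conv
    by (rule smooth_on_compose[OF openD openU' smooth_g smooth_on_linear[OF openD bounded_linear_coords]])
      (use coords_D in auto)
  ultimately have "smooth_on D (\<lambda>q. (fst (W q), snd (W q)))" by (rule smooth_on_Pair[OF openD])
  then have smooth_W: "smooth_on D W" by simp
  have snd_zero: "frechet_derivative (snd \<circ> W) (at p) ((1, 0), (0, 0)) = 0 \<and>
      frechet_derivative (snd \<circ> W) (at p) ((0, 1), (0, 0)) = 0" if p: "p \<in> D" for p
  proof -
    have g': "(?g has_derivative frechet_derivative ?g (at (coords p))) (at (coords p))"
      by (rule smooth_on_imp_has_derivative[OF smooth_g coords_D[OF p]])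
    have "((\<lambda>q. ?g (coords q)) has_derivative (\<lambda>h. frechet_derivative ?g (at (coords p)) (coords h))) (at p)"
      by (rule has_derivative_compose[OF bounded_linear_imp_has_derivative[OF bounded_linear_coords] g'])
    then have "((snd \<circ> W) has_derivative (\<lambda>h. frechet_derivative ?g (at (coords p)) (coords h))) (at p)"
      by (simp add: W_def o_def)
    \<comment> \<open>\<open>coords\<close> sends the x-direction to the vector \<open>ZX\<close>
      and the y-direction to 0.\<close>
    from frechet_derivative_at[OF this, symmetric] show ?thesis
      using gX[OF coords_D[OF p]] linear_0[OF has_derivative_linear[OF g']]
      by (simp add: coords_def zero_prod_def)
  qed
  have "para_holomorphic_on D W"
    unfolding para_holomorphic_on_def using openD smooth_W snd_zero local_fst by blast
  moreover have "U \<subseteq> D" using slide_U unfolding D_def by blast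
  moreover have "W p = V p" if "p \<in> U" for p
    using slide_THE[OF slide_U[OF that]] that by (simp add: W_def param_coords)
  ultimately show ?thesis by blast
qed

end

section \<open>Restriction of tangent para-holomorphic fields, and the two implications
  assembled\<close>

context para_CR
begin

lemma tangent_para_holomorphic_is_infinitesimal:
  assumes W: "para_holomorphic_on D W" and tangent: "\<forall>p\<in>M \<inter> D. W p \<in> tangent_space \<phi> p"
  shows "infinitesimal_para_CR_automorphism N \<phi> (M \<inter> D) W"
proof -
  have D: "open D" "smooth_on D W" using W by (auto simp: para_holomorphic_on_def)
  have op: "openin (top_of_set M) (M \<inter> D)" using D(1) by (rule openin_open_Int)
  then have oc: "open (coords ` (M \<inter> D))" by (simp add: openin_M_iff)
  have mem: "q \<in> N" "param \<phi> q \<in> D" if "q \<in> coords ` (M \<inter> D)" for q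
    using that by (auto simp: in_M)
  have "smooth_on (coords ` (M \<inter> D)) (\<lambda>q. W (param \<phi> q))"
    by (rule smooth_on_compose[OF oc D smooth_on_subset[OF smooth_on_param]]) (use mem in blast)+
  then have "M_vector_field N \<phi> (M \<inter> D) W"
    using op tangent by (simp add: M_vector_field_def M_smooth_on_def o_def)
  then interpret vector_field_on_M N \<phi> "M \<inter> D" W by unfold_locales
  have lin: "linear (frechet_derivative (\<lambda>p. P (W p)) (at p))"
    if "bounded_linear P" "p \<in> D" for P :: "R4 \<Rightarrow> real \<times> real" and p
    by (rule has_derivative_linear[OF smooth_on_imp_has_derivative[OF
            smooth_on_compose_linear[OF D(1) that(1) D(2)] that(2)]])
  have "preserves ZX"
  proof (rule leaves.para_holomorphic_imp_preserves[OF leaves_X D])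
    fix p h :: R4 assume p: "p \<in> D" and h: "snd h = 0"
    have l: "linear (frechet_derivative (\<lambda>p. snd (W p)) (at p))" by (rule lin[OF bounded_linear_snd p])
    \<comment> \<open>The two directions in which para-holomorphy makes the derivative of this
      component vanish span the kernel of \<open>snd\<close>.\<close>
    have "h = fst (fst h) *\<^sub>R ((1, 0), (0, 0)) + snd (fst h) *\<^sub>R ((0, 1), (0, 0))"
      using h by (simp add: prod_eq_iff)
    then have "frechet_derivative (\<lambda>p. snd (W p)) (at p) h = frechet_derivative (\<lambda>p. snd (W p)) (at p)
        (fst (fst h) *\<^sub>R ((1, 0), (0, 0)) + snd (fst h) *\<^sub>R ((0, 1), (0, 0)))" by (rule arg_cong)
    then show "frechet_derivative (\<lambda>p. snd (W p)) (at p) h = 0"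
      using W p by (simp only: linear_add[OF l] linear_scale[OF l]) (simp add: para_holomorphic_on_def o_def)
  qed auto
  moreover have "preserves ZY"
  proof (rule leaves.para_holomorphic_imp_preserves[OF leaves_Y D])
    fix p h :: R4 assume p: "p \<in> D" and h: "fst h = 0"
    have l: "linear (frechet_derivative (\<lambda>p. fst (W p)) (at p))" by (rule lin[OF bounded_linear_fst p])
    have "h = fst (snd h) *\<^sub>R ((0, 0), (1, 0)) + snd (snd h) *\<^sub>R ((0, 0), (0, 1))"
      using h by (simp add: prod_eq_iff)
    then have "frechet_derivative (\<lambda>p. fst (W p)) (at p) h = frechet_derivative (\<lambda>p. fst (W p)) (at p)
        (fst (snd h) *\<^sub>R ((0, 0), (1, 0)) + snd (snd h) *\<^sub>R ((0, 0), (0, 1)))" by (rule arg_cong)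
    then show "frechet_derivative (\<lambda>p. fst (W p)) (at p) h = 0"
      using W p by (simp only: linear_add[OF l] linear_scale[OF l]) (simp add: para_holomorphic_on_def o_def)
  qed auto
  ultimately show ?thesis by (rule preserves_imp_infinitesimal)
qed

lemma infinitesimal_extends:
  assumes "infinitesimal_para_CR_automorphism N \<phi> U V"
  shows "\<exists>D W. U \<subseteq> D \<and> para_holomorphic_on D W \<and> (\<forall>p\<in>U. W p = V p)"
proof -
  interpret vector_field_on_M N \<phi> U V
    using assms by unfold_locales (simp add: infinitesimal_para_CR_automorphism_def)
  show ?thesis by (rule preserves_imp_extension[OF infinitesimal_imp_preserves[OF assms]])
qed

end

theorem corollary1:
  fixes N :: "R3 set" and \<phi> :: "R3 \<Rightarrow> real"
  assumes "embedded_para_CR N \<phi>"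
  shows "(\<forall>U V. infinitesimal_para_CR_automorphism N \<phi> U V \<longrightarrow>
            (\<exists>D W. U \<subseteq> D \<and> para_holomorphic_on D W \<and> (\<forall>p\<in>U. W p = V p))) \<and>
         (\<forall>D W. para_holomorphic_on D W \<longrightarrow>
            (\<forall>p\<in>para_CR_manifold N \<phi> \<inter> D. W p \<in> tangent_space \<phi> p) \<longrightarrow>
            infinitesimal_para_CR_automorphism N \<phi> (para_CR_manifold N \<phi> \<inter> D) W)"
proof -
  interpret para_CR N \<phi> using assms by unfold_locales
  show ?thesis
    using infinitesimal_extends tangent_para_holomorphic_is_infinitesimal by blast
qed

end
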